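(* Let $\mathcal B = (\Sigma, P, \mu, p_0, F)$ be a fixed partial deterministic finite automaton with $|P|\le 3$ and $|\Sigma|\le 2$. Then the following decision problem is solvable in polynomial time: given as input a (deterministic and complete) semi-automaton $\mathcal A=(\Sigma,Q,\delta)$ with simple idempotents, decide whether $\mathcal A$ has a synchronizing word in $L(\mathcal B)$.
   Context: A partial deterministic finite automaton (PDFA) is a tuple $\mathcal B = (\Sigma, P, \mu, p_0, F)$ with finite alphabet $\Sigma$, finite state set $P$, start state $p_0\in P$, final states $F\subseteq P$ and partial transition function $\mu\colon P\times\Sigma\rightharpoonup P$, extended to words in the usual way; $L(\mathcal B)=\{w\in\Sigma^* \mid \mu(p_0,w) \text{ is defined and lies in } F\}$. The PDFA $\mathcal B$ is fixed and not part of the input. A deterministic and complete semi-automaton is a triple $\mathcal A = (\Sigma, Q, \delta)$ with $\Sigma$ a finite alphabet, $Q$ a finite set of states and $\delta\colon Q\times\Sigma\to Q$ a total function, extended to words as usual, with $\delta(S,w)=\{\delta(q,w)\mid q\in S\}$ for $S\subseteq Q$. A word $w\in\Sigma^*$ is synchronizing for $\mathcal A$ if $|\delta(Q,w)|=1$. $\mathcal A$ is an automaton with simple idempotents if every $a\in\Sigma$ either (1) permutes the states, i.e., $\delta(Q,a)=Q$, or (2) is a simple idempotent, i.e., $|\delta(Q,a)|=|Q|-1$ and $\delta(q,aa)=\delta(q,a)$ for every $q\in Q$. *)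

theory Defs
  imports
    "HOL-Library.Log_Nat"
    "HOL-Computational_Algebra.Polynomial"
begin

section \<open>Constraint automata and semi-automata\<close>

record ('p, 'a) pdfa =
  pdfa_alphabet :: "'a set"
  pdfa_states :: "'p set"
  pdfa_trans :: "'p \<Rightarrow> 'a \<Rightarrow> 'p option"
  pdfa_start :: 'p
  pdfa_final :: "'p set"

text \<open>Values of the transition functions outside states and alphabet are irrelevant, here and for
  semi-automata below.\<close>

definition is_pdfa :: "('p, 'a) pdfa \<Rightarrow> bool" where
  "is_pdfa B \<longleftrightarrow>
     finite (pdfa_alphabet B) \<and> finite (pdfa_states B) \<and>
     pdfa_start B \<in> pdfa_states B \<and> pdfa_final B \<subseteq> pdfa_states B \<and>
     (\<forall>p\<in>pdfa_states B. \<forall>a\<in>pdfa_alphabet B. \<forall>p'.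
        pdfa_trans B p a = Some p' \<longrightarrow> p' \<in> pdfa_states B)"

fun pdfa_run :: "('p, 'a) pdfa \<Rightarrow> 'p \<Rightarrow> 'a list \<Rightarrow> 'p option" where
  "pdfa_run B p [] = Some p"
| "pdfa_run B p (a # w) = Option.bind (pdfa_trans B p a) (\<lambda>p'. pdfa_run B p' w)"

definition pdfa_lang :: "('p, 'a) pdfa \<Rightarrow> 'a list set" where
  "pdfa_lang B =
     {w \<in> lists (pdfa_alphabet B). \<exists>p\<in>pdfa_final B. pdfa_run B (pdfa_start B) w = Some p}"

record ('q, 'a) semi_automaton =
  sa_alphabet :: "'a set"
  sa_states :: "'q set"
  sa_trans :: "'q \<Rightarrow> 'a \<Rightarrow> 'q"

definition is_semi_automaton :: "('q, 'a) semi_automaton \<Rightarrow> bool" where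
  "is_semi_automaton A \<longleftrightarrow>
     finite (sa_alphabet A) \<and> finite (sa_states A) \<and>
     (\<forall>q\<in>sa_states A. \<forall>a\<in>sa_alphabet A. sa_trans A q a \<in> sa_states A)"

definition sa_run :: "('q, 'a) semi_automaton \<Rightarrow> 'q \<Rightarrow> 'a list \<Rightarrow> 'q" where
  "sa_run A q w = foldl (sa_trans A) q w"

definition sa_image :: "('q, 'a) semi_automaton \<Rightarrow> 'q set \<Rightarrow> 'a list \<Rightarrow> 'q set" where
  "sa_image A S w = (\<lambda>q. sa_run A q w) ` S"

definition synchronizing :: "('q, 'a) semi_automaton \<Rightarrow> 'a list \<Rightarrow> bool" where
  "synchronizing A w \<longleftrightarrow> w \<in> lists (sa_alphabet A) \<and> card (sa_image A (sa_states A) w) = 1"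

definition permutes_states :: "('q, 'a) semi_automaton \<Rightarrow> 'a \<Rightarrow> bool" where
  "permutes_states A a \<longleftrightarrow> sa_image A (sa_states A) [a] = sa_states A"

definition simple_idempotent :: "('q, 'a) semi_automaton \<Rightarrow> 'a \<Rightarrow> bool" where
  "simple_idempotent A a \<longleftrightarrow>
     card (sa_image A (sa_states A) [a]) + 1 = card (sa_states A) \<and>
     (\<forall>q\<in>sa_states A. sa_run A q [a, a] = sa_run A q [a])"

definition has_simple_idempotents :: "('q, 'a) semi_automaton \<Rightarrow> bool" where
  "has_simple_idempotents A \<longleftrightarrow>
     (\<forall>a\<in>sa_alphabet A. permutes_states A a \<or> simple_idempotent A a)"


section \<open>Polynomial time\<close>

text \<open>The machine model is a random access machine with structured control flow. A state is a pair of
  a register file, addressed directly by the program, and a memory, addressed indirectly through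
  registers; both hold natural numbers. Every instruction and every test costs one time unit. As the
  arithmetic is restricted to addition and truncated subtraction, the largest number around (counting
  the constants of the program) gains at most one bit per time unit, so that polynomial time in this model (measured in the bit size of the input) coincides
  with polynomial time on Turing machines.\<close>

type_synonym ram_state = "(nat \<Rightarrow> nat) \<times> (nat \<Rightarrow> nat)"

datatype ram_com =
    RSkip
  | RConst nat nat
  | RAdd nat nat nat
  | RSub nat nat nat
  | RLoad nat nat
  | RStore nat nat
  | RSeq ram_com ram_com
  | RIf nat ram_com ram_com
  | RWhile nat ram_com

text \<open>\<open>ram_exec c s t s'\<close>: started in state \<open>s\<close>, the program \<open>c\<close> halts in state \<open>s'\<close>
  after exactly \<open>t\<close> time units. Tests are for being nonzero.\<close>

inductive ram_exec :: "ram_com \<Rightarrow> ram_state \<Rightarrow> nat \<Rightarrow> ram_state \<Rightarrow> bool" where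
  Skip: "ram_exec RSkip s 1 s"
| Const: "ram_exec (RConst x k) (r, m) 1 (r(x := k), m)"
| Add: "ram_exec (RAdd x y z) (r, m) 1 (r(x := r y + r z), m)"
| Sub: "ram_exec (RSub x y z) (r, m) 1 (r(x := r y - r z), m)"
| Load: "ram_exec (RLoad x y) (r, m) 1 (r(x := m (r y)), m)"
| Store: "ram_exec (RStore x y) (r, m) 1 (r, m(r x := r y))"
| Seq: "\<lbrakk>ram_exec c1 s1 t1 s2; ram_exec c2 s2 t2 s3\<rbrakk> \<Longrightarrow> ram_exec (RSeq c1 c2) s1 (t1 + t2) s3"
| IfTrue: "\<lbrakk>fst s x \<noteq> 0; ram_exec c1 s t s'\<rbrakk> \<Longrightarrow> ram_exec (RIf x c1 c2) s (t + 1) s'"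
| IfFalse: "\<lbrakk>fst s x = 0; ram_exec c2 s t s'\<rbrakk> \<Longrightarrow> ram_exec (RIf x c1 c2) s (t + 1) s'"
| WhileFalse: "fst s x = 0 \<Longrightarrow> ram_exec (RWhile x c) s 1 s"
| WhileTrue: "\<lbrakk>fst s1 x \<noteq> 0; ram_exec c s1 t1 s2; ram_exec (RWhile x c) s2 t2 s3\<rbrakk>
    \<Longrightarrow> ram_exec (RWhile x c) s1 (t1 + t2 + 1) s3"

lemma ram_exec_deterministic:
  assumes "ram_exec c s t s'" and "ram_exec c s u s''"
  shows "t = u \<and> s' = s''"
  using assms
proof (induction arbitrary: u s'' rule: ram_exec.induct)
  case (Seq c1 s1 t1 s2 c2 t2 s3)
  from Seq.prems show ?case
    by (cases rule: ram_exec.cases) (use Seq.IH in blast)+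
next
  case (IfTrue s x c1 t s' c2)
  from IfTrue.prems show ?case
    by (cases rule: ram_exec.cases) (use IfTrue in blast)+
next
  case (IfFalse s x c2 t s' c1)
  from IfFalse.prems show ?case
    by (cases rule: ram_exec.cases) (use IfFalse in blast)+
next
  case (WhileFalse s x c)
  from WhileFalse.prems WhileFalse.hyps show ?case
    by (cases rule: ram_exec.cases) auto
next
  case (WhileTrue s1 x c t1 s2 t2 s3)
  from WhileTrue.prems show ?case
    by (cases rule: ram_exec.cases) (use WhileTrue in blast)+
qed (auto elim: ram_exec.cases)

text \<open>Inputs are finite sequences of numbers. Initially the input occupies the first memory cells,
  register 0 holds the number of its entries, and everything else is 0. The answer is yes if
  register 0 is nonzero on termination.\<close>

definition ram_init :: "nat list \<Rightarrow> ram_state" where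
  "ram_init xs = ((\<lambda>_. 0)(0 := length xs), \<lambda>i. if i < length xs then xs ! i else 0)"

definition ram_accepting :: "ram_state \<Rightarrow> bool" where
  "ram_accepting s \<longleftrightarrow> fst s 0 \<noteq> 0"

definition input_size :: "nat list \<Rightarrow> nat" where
  "input_size xs = (\<Sum>x\<leftarrow>xs. max 1 (floorlog 2 x))"

text \<open>A decision problem is given by its set of instances \<open>I\<close>, an encoding of instances
  and the question \<open>Q\<close> to be decided.\<close>

definition decidable_in_polynomial_time ::
  "'i set \<Rightarrow> ('i \<Rightarrow> nat list) \<Rightarrow> ('i \<Rightarrow> bool) \<Rightarrow> bool" where
  "decidable_in_polynomial_time I enc Q \<longleftrightarrow>
     (\<exists>(c :: ram_com) (p :: nat poly). \<forall>x\<in>I. \<exists>t s.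
        ram_exec c (ram_init (enc x)) t s \<and>
        t \<le> poly p (input_size (enc x)) \<and>
        (ram_accepting s \<longleftrightarrow> Q x))"


section \<open>The constrained synchronization problem\<close>

text \<open>As usual for inputs, the states of a semi-automaton are numbered \<open>0, \<dots>, n - 1\<close>. It is
  presented by \<open>n\<close> followed by the rows of its transition table, whose columns are ordered by an
  enumeration \<open>as\<close> of the fixed alphabet.\<close>

definition simple_idempotent_instances :: "'a set \<Rightarrow> (nat, 'a) semi_automaton set" where
  "simple_idempotent_instances Sig =
     {A. is_semi_automaton A \<and> sa_alphabet A = Sig \<and> (\<exists>n. sa_states A = {..<n}) \<and>
         has_simple_idempotents A}"

definition encode_semi_automaton :: "'a list \<Rightarrow> (nat, 'a) semi_automaton \<Rightarrow> nat list" where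
  "encode_semi_automaton as A =
     card (sa_states A) # [sa_trans A q a. q \<leftarrow> [0..<card (sa_states A)], a \<leftarrow> as]"

definition has_constrained_sync_word ::
  "('p, 'a) pdfa \<Rightarrow> ('q, 'a) semi_automaton \<Rightarrow> bool" where
  "has_constrained_sync_word B A \<longleftrightarrow> (\<exists>w\<in>pdfa_lang B. synchronizing A w)"

end

theory Submission
  imports Defs
begin

text \<open>Let \<open>A\<close> have at least ten states. If some word synchronizes \<open>A\<close>, then one letter
  \<open>a\<close> is an idempotent moving a single state \<open>x0\<close> to \<open>d\<close>, and the other letter
  \<open>b\<close> is a permutation whose cycle through \<open>x0\<close> covers all states except possibly
  \<open>d\<close>. In this case a synchronizing word in the language exists if and only if the loops of
  \<open>B\<close> at some useful state contain a synchronizing word. Indeed, a run of \<open>B\<close> that stays in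
  one strongly connected component extends to a loop. A component with a single state either loops with
  both letters or contributes a power of one letter, which merges at most one pair of states; so a run
  through such components only cannot synchronize ten states. This leaves a component with two states and one such
  power before or after it. The loops of the component either contain a synchronizing word, or
  its words are injective on so many states that the power cannot make up for it.

  Whether the loops at a state contain a synchronizing word depends only on the mergeability of pairs of
  states of \<open>A\<close>, decided by backward reachability in the product of the components
  of \<open>B\<close> with the pairs. The finitely many smaller \<open>A\<close> are looked up in a table.\<close>


section \<open>Synchronizing words and runs\<close>

text \<open>The obstacle is that the loops of a component may fail to synchronize while a longer
  word of the language still might: a power of one letter, and also the letter that connects two
  components, can each merge one more pair. So for words of a two-state component it must be shown
  that they stay injective on four states, or that they separate two states that survive both losses
  (\<open>rigid\<close>). What such a component can do depends on the gaps, the numbers of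
  \<open>b\<close> between consecutive \<open>a\<close>. If the gaps are arbitrary odd numbers,
  loops always synchronize; if they are even, they do so unless the cycle length is even, where
  position and component state keep their parities locked; if \<open>bb\<close> cannot be read, the
  position of \<open>d\<close> on the cycle decides. The algorithm is blind to all these cases: it
  tests every useful state. Its merging paths may end anywhere in the component, since they extend
  to loops, and merging pairs is enough because loops at a state are closed under concatenation. Ten
  states guarantee a cycle of length at least 9, long enough for four positions of one parity; a
  chain of three single-state components loses at most 5 states.\<close>

lemma sa_run_Nil [simp]: "sa_run A q [] = q"
  and sa_run_Cons [simp]: "sa_run A q (c # w) = sa_run A (sa_trans A q c) w"
  and sa_run_append [simp]: "sa_run A q (u @ v) = sa_run A (sa_run A q u) v"
  by (simp_all add: sa_run_def)

lemma sa_run_replicate: "sa_run A q (replicate i c) = ((\<lambda>q. sa_trans A q c) ^^ i) q"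
  by (induction i arbitrary: q) (simp_all add: funpow_Suc_right del: funpow.simps(2))

lemma sa_run_closed:
  assumes "is_semi_automaton A" "w \<in> lists (sa_alphabet A)" "q \<in> sa_states A"
  shows "sa_run A q w \<in> sa_states A"
  using assms(2,3) by (induction w arbitrary: q) (use assms(1) in \<open>auto simp: is_semi_automaton_def\<close>)

text \<open>Formulated for arbitrary sets and without nonemptiness, so that it can be proved by
  induction over \<open>S\<close> and applied to images.\<close>

definition collapses :: "('q, 'a) semi_automaton \<Rightarrow> 'q set \<Rightarrow> 'a list \<Rightarrow> bool" where
  "collapses A S w \<longleftrightarrow> (\<forall>q\<in>S. \<forall>r\<in>S. sa_run A q w = sa_run A r w)"

lemma collapsesD: "collapses A S w \<Longrightarrow> q \<in> S \<Longrightarrow> r \<in> S \<Longrightarrow> sa_run A q w = sa_run A r w"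
  unfolding collapses_def by blast

lemma collapses_append: "collapses A S u \<Longrightarrow> collapses A S (u @ v)"
  unfolding collapses_def sa_run_append by metis

lemma synchronizing_iff_collapses:
  fixes A :: "('q, 'a) semi_automaton"
  assumes "is_semi_automaton A"
  shows "synchronizing A w \<longleftrightarrow>
    w \<in> lists (sa_alphabet A) \<and> sa_states A \<noteq> {} \<and> collapses A (sa_states A) w"
proof -
  have "card (f ` S) = 1 \<longleftrightarrow> S \<noteq> {} \<and> (\<forall>q\<in>S. \<forall>r\<in>S. f q = f r)" for f :: "'q \<Rightarrow> 'q" and S
  proof
    assume "card (f ` S) = 1"
    then obtain y where y: "f ` S = {y}"
      using card_1_singletonE by blast
    then have "f q = y" if "q \<in> S" for q using that by blast
    with y show "S \<noteq> {} \<and> (\<forall>q\<in>S. \<forall>r\<in>S. f q = f r)" by auto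
  next
    assume *: "S \<noteq> {} \<and> (\<forall>q\<in>S. \<forall>r\<in>S. f q = f r)"
    then obtain q where "q \<in> S" by auto
    with * have "f ` S = {f q}" by blast
    then show "card (f ` S) = 1" by simp
  qed
  then show ?thesis
    by (simp add: synchronizing_def sa_image_def collapses_def del: One_nat_def)
qed

text \<open>The classical pair criterion, relative to a set \<open>X\<close> of words closed under
  concatenation: a word that merges \<open>S\<close> is prolonged by one that merges the image of
  \<open>S\<close> with the image of one more state.\<close>

lemma collapses_if_pairs:
  assumes "is_semi_automaton A" and X: "[] \<in> X" "\<And>u v. u \<in> X \<Longrightarrow> v \<in> X \<Longrightarrow> u @ v \<in> X"
    and closed: "X \<subseteq> lists (sa_alphabet A)"
    and pairs: "\<And>q r. q \<in> sa_states A \<Longrightarrow> r \<in> sa_states A \<Longrightarrow> \<exists>w\<in>X. sa_run A q w = sa_run A r w"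
  shows "\<exists>w\<in>X. collapses A (sa_states A) w"
proof -
  have "finite (sa_states A)"
    using assms(1) by (simp add: is_semi_automaton_def)
  moreover have "\<exists>w\<in>X. collapses A S w" if "finite S" "S \<subseteq> sa_states A" for S
    using that
  proof (induction S rule: finite_induct)
    case empty
    then show ?case using X(1) by (auto simp: collapses_def)
  next
    case (insert q S)
    then obtain u where u: "u \<in> X" "collapses A S u"
      by auto
    show ?case
    proof (cases "S = {}")
      case True
      then show ?thesis using X(1) by (auto simp: collapses_def)
    next
      case False
      then obtain r where r: "r \<in> S" by auto
      obtain v where v: "v \<in> X" "sa_run A (sa_run A q u) v = sa_run A (sa_run A r u) v"
        using pairs[of "sa_run A q u" "sa_run A r u"] insert.prems r u(1) closed
          sa_run_closed[OF assms(1)] by (meson insert_subset subsetD)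
      have "sa_run A s (u @ v) = sa_run A (sa_run A r u) v" if "s \<in> insert q S" for s
      proof (cases "s = q")
        case False
        then have "sa_run A s u = sa_run A r u"
          using that r by (intro collapsesD[OF u(2)]) auto
        then show ?thesis by simp
      qed (use v in simp)
      then have "collapses A (insert q S) (u @ v)"
        unfolding collapses_def by metis
      with X(2)[OF u(1) v(1)] show ?thesis by blast
    qed
  qed
  ultimately show ?thesis by blast
qed

section \<open>Loops of the constraint automaton\<close>

lemma pdfa_run_append:
  "pdfa_run B p (u @ v) = Option.bind (pdfa_run B p u) (\<lambda>p'. pdfa_run B p' v)"
  by (induction u arbitrary: p) (auto split: bind_splits)

definition loops :: "('p, 'a) pdfa \<Rightarrow> 'p \<Rightarrow> 'a list set" where
  "loops B p = {w \<in> lists (pdfa_alphabet B). pdfa_run B p w = Some p}"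

lemma loops_Nil: "[] \<in> loops B p"
  by (simp add: loops_def)

lemma loops_append: "u \<in> loops B p \<Longrightarrow> v \<in> loops B p \<Longrightarrow> u @ v \<in> loops B p"
  by (simp add: loops_def pdfa_run_append)

lemma loops_power: "u \<in> loops B p \<Longrightarrow> concat (replicate k u) \<in> loops B p"
  by (induction k) (simp_all add: loops_Nil loops_append)

lemma sa_run_power: "sa_run A q (concat (replicate k u)) = ((\<lambda>q. sa_run A q u) ^^ k) q"
  by (induction k arbitrary: q) (simp_all add: funpow_Suc_right del: funpow.simps(2))


section \<open>A permutation and a simple idempotent\<close>

text \<open>\<open>x0\<close> is the only state moved by \<open>a\<close>. On a finite state set,
  injectivity already makes \<open>b\<close> a permutation. The letters are distinct, since
  \<open>a\<close> merges \<open>x0\<close> and \<open>d\<close>.\<close>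

locale idem_perm =
  fixes A :: "('q, 'a) semi_automaton" and a b :: 'a and x0 d :: 'q
  assumes sa: "is_semi_automaton A"
    and alphabet: "sa_alphabet A = {a, b}"
    and x0: "x0 \<in> sa_states A" and d: "d \<in> sa_states A" and d_neq: "d \<noteq> x0"
    and a_x0: "sa_trans A x0 a = d"
    and a_fix: "\<And>q. q \<in> sa_states A \<Longrightarrow> q \<noteq> x0 \<Longrightarrow> sa_trans A q a = q"
    and b_inj: "inj_on (\<lambda>q. sa_trans A q b) (sa_states A)"
begin

abbreviation Q :: "'q set" where "Q \<equiv> sa_states A"
abbreviation \<beta> :: "'q \<Rightarrow> 'q" where "\<beta> q \<equiv> sa_trans A q b"
abbreviation orb :: "nat \<Rightarrow> 'q" where "orb i \<equiv> (\<beta> ^^ i) x0"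

lemma finite_Q: "finite Q"
  using sa by (simp add: is_semi_automaton_def)

lemma trans_closed: "q \<in> Q \<Longrightarrow> c \<in> {a, b} \<Longrightarrow> sa_trans A q c \<in> Q"
  using sa alphabet by (auto simp: is_semi_automaton_def)

lemma run_closed: "w \<in> lists {a, b} \<Longrightarrow> q \<in> Q \<Longrightarrow> sa_run A q w \<in> Q"
  using sa_run_closed[OF sa] alphabet by auto

lemma \<beta>_pow_closed [simp]: "q \<in> Q \<Longrightarrow> (\<beta> ^^ i) q \<in> Q"
  by (induction i) (auto intro: trans_closed)

lemma \<beta>_pow_inj: "q \<in> Q \<Longrightarrow> r \<in> Q \<Longrightarrow> (\<beta> ^^ i) q = (\<beta> ^^ i) r \<Longrightarrow> q = r"
  by (induction i) (auto dest: inj_onD[OF b_inj])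

lemma \<beta>_surj: "q \<in> Q \<Longrightarrow> \<exists>r\<in>Q. (\<beta> ^^ i) r = q"
proof -
  assume "q \<in> Q"
  moreover have "inj_on (\<beta> ^^ i) Q"
    using \<beta>_pow_inj by (auto simp: inj_on_def)
  then have "(\<beta> ^^ i) ` Q = Q"
    by (intro endo_inj_surj finite_Q) auto
  ultimately show ?thesis by (metis imageE)
qed

lemma a_run: "q \<in> Q \<Longrightarrow> sa_run A q (replicate i a) = (if i = 0 then q else sa_trans A q a)"
proof (induction i arbitrary: q)
  case (Suc i)
  have "sa_trans A (sa_trans A q a) a = sa_trans A q a"
    using Suc.prems a_x0 a_fix d d_neq by (cases "q = x0") auto
  with Suc show ?case by (auto simp: trans_closed)
qed simp

text \<open>A bound on the loss of rank. It ranges over all subsets of \<open>Q\<close> and not only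
  over \<open>Q\<close>, which makes the bounds additive under concatenation.\<close>

definition drops :: "nat \<Rightarrow> 'a list \<Rightarrow> bool" where
  "drops k v \<longleftrightarrow> (\<forall>S\<subseteq>Q. card S \<le> card (sa_image A S v) + k)"

lemma drops_append:
  assumes "drops k u" "drops l v" "u \<in> lists {a, b}"
  shows "drops (k + l) (u @ v)"
  unfolding drops_def
proof (intro allI impI)
  fix S assume "S \<subseteq> Q"
  moreover from this have "sa_image A S u \<subseteq> Q"
    using run_closed[OF assms(3)] by (auto simp: sa_image_def)
  moreover have "sa_image A S (u @ v) = sa_image A (sa_image A S u) v"
    by (auto simp: sa_image_def image_image)
  moreover have "card S \<le> card (sa_image A S u) + k"
    using assms(1) \<open>S \<subseteq> Q\<close> by (simp add: drops_def)
  moreover have "card (sa_image A S u) \<le> card (sa_image A (sa_image A S u) v) + l"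
    using assms(2) \<open>sa_image A S u \<subseteq> Q\<close> by (simp add: drops_def)
  ultimately show "card S \<le> card (sa_image A S (u @ v)) + (k + l)"
    by simp
qed

lemma drops_power:
  assumes "c \<in> {a, b}"
  shows "drops 1 (replicate i c)"
  unfolding drops_def
proof (intro allI impI)
  fix S assume S: "S \<subseteq> Q"
  then have fin: "finite S" using finite_Q finite_subset by blast
  \<comment> \<open>Away from \<open>x0\<close> every power of \<open>a\<close> is the identity, and
    every power of \<open>b\<close> is injective.\<close>
  have "inj_on (\<lambda>q. sa_run A q (replicate i c)) (S - {x0})"
  proof (cases "c = b")
    case True
    show ?thesis
      by (rule inj_onI, rule \<beta>_pow_inj[of _ _ i]) (use S True in \<open>auto simp: sa_run_replicate\<close>)
  next
    case False
    with assms have "c = a" by simp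
    have "sa_run A q (replicate i a) = q" if "q \<in> S - {x0}" for q
      using that S a_fix[of q] a_run[of q i] by auto
    then have "inj_on (\<lambda>q. sa_run A q (replicate i c)) (S - {x0}) \<longleftrightarrow> inj_on (\<lambda>q. q) (S - {x0})"
      unfolding \<open>c = a\<close> by (intro inj_on_cong)
    then show ?thesis by simp
  qed
  then have "card (S - {x0}) = card ((\<lambda>q. sa_run A q (replicate i c)) ` (S - {x0}))"
    by (simp add: card_image)
  also have "\<dots> \<le> card (sa_image A S (replicate i c))"
    unfolding sa_image_def using fin by (intro card_mono) auto
  finally have "card (S - {x0}) \<le> card (sa_image A S (replicate i c))" .
  moreover have "card S \<le> card (S - {x0}) + 1"
    using fin by (auto simp: card_Diff_singleton_if)
  ultimately show "card S \<le> card (sa_image A S (replicate i c)) + 1" by simp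
qed

lemma drops_single: "c \<in> {a, b} \<Longrightarrow> drops 1 [c]"
  using drops_power[of c 1] by (simp add: One_nat_def)

lemma drops_not_collapses:
  assumes "drops k v" "S \<subseteq> Q" "k + 2 \<le> card S"
  shows "\<not> collapses A S v"
proof
  assume coll: "collapses A S v"
  have "\<exists>y. sa_image A S v \<subseteq> {y}"
  proof (cases "S = {}")
    case False
    then obtain q where "q \<in> S" by auto
    then have "sa_image A S v \<subseteq> {sa_run A q v}"
      using collapsesD[OF coll] unfolding sa_image_def by blast
    then show ?thesis ..
  qed (simp add: sa_image_def)
  then obtain y where "sa_image A S v \<subseteq> {y}" by blast
  then have "card (sa_image A S v) \<le> 1"
    using card_mono[of "{y}" "sa_image A S v"] by simp
  moreover have "card S \<le> card (sa_image A S v) + k"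
    using assms(1,2) by (simp add: drops_def)
  ultimately show False using assms(3) by simp
qed

text \<open>The image of \<open>Q\<close> under \<open>u\<close> misses at most two states, so it
  contains two of the four states of \<open>H\<close>, and \<open>m\<close> keeps them apart. In the
  other order, \<open>m\<close> leaves four distinct states, whose number \<open>u\<close> reduces
  by at most two.\<close>

lemma inj_not_collapses:
  assumes H: "H \<subseteq> Q" "4 \<le> card H" "inj_on (\<lambda>q. sa_run A q m) H"
    and m: "m \<in> lists {a, b}" and u: "u \<in> lists {a, b}" "drops 2 u"
  shows "\<not> collapses A Q (u @ m)" and "\<not> collapses A Q (m @ u)"
proof -
  let ?S = "sa_image A Q u"
  have S: "?S \<subseteq> Q" using run_closed[OF u(1)] by (auto simp: sa_image_def)
  have fin: "finite H" using H finite_Q finite_subset by blast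
  have "card Q \<le> card ?S + 2" using u(2) by (auto simp: drops_def)
  moreover have "card (Q - ?S) = card Q - card ?S"
    using S finite_Q by (simp add: card_Diff_subset finite_subset)
  ultimately have "card (Q - ?S) \<le> 2" by simp
  moreover have "card H \<le> card (H \<inter> ?S) + card (Q - ?S)"
  proof -
    have "card H \<le> card ((H \<inter> ?S) \<union> (Q - ?S))"
      using H(1) finite_Q fin by (intro card_mono) auto
    then show ?thesis using card_Un_le order_trans by blast
  qed
  ultimately have "\<not> card (H \<inter> ?S) \<le> 1" using H(2) by simp
  then obtain y z where yz: "y \<in> H \<inter> ?S" "z \<in> H \<inter> ?S" "y \<noteq> z"
    using fin card_le_Suc0_iff_eq[of "H \<inter> ?S"] by (auto simp: One_nat_def)
  then obtain y' z' where "y' \<in> Q" "z' \<in> Q" "sa_run A y' u = y" "sa_run A z' u = z"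
    by (auto simp: sa_image_def)
  moreover have "sa_run A y m \<noteq> sa_run A z m"
    using yz H(3) by (auto simp: inj_on_def)
  ultimately show "\<not> collapses A Q (u @ m)"
    by (metis collapsesD sa_run_append)
  have "card (sa_image A H m) = card H"
    using H(3) by (simp add: sa_image_def card_image)
  moreover have "sa_image A H m \<subseteq> Q"
    using H(1) run_closed[OF m] by (auto simp: sa_image_def)
  ultimately have "\<not> collapses A (sa_image A H m) u"
    using drops_not_collapses[OF u(2)] H(2) by simp
  then show "\<not> collapses A Q (m @ u)"
  proof (rule contrapos_nn)
    assume coll: "collapses A Q (m @ u)"
    show "collapses A (sa_image A H m) u"
      unfolding collapses_def sa_image_def
    proof clarify
      fix q r assume "q \<in> H" "r \<in> H"
      then show "sa_run A (sa_run A q m) u = sa_run A (sa_run A r m) u"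
        using collapsesD[OF coll, of q r] H(1) by auto
    qed
  qed
qed

end

locale sync_idem_perm = idem_perm +
  fixes w0 :: "'b list"
  assumes w0: "w0 \<in> lists {a, b}" "collapses A (sa_states A) w0"
    and card_Q: "10 \<le> card (sa_states A)"
begin

text \<open>The complement of the orbit of \<open>x0\<close> under \<open>b\<close> is invariant
  under both letters, and both act injectively on it, so a collapsing word leaves room for at most
  one state there. Both letters fix such a state; the orbit can merge with it only if
  \<open>a\<close> leads out of the orbit, that is, if the state is \<open>d\<close>.\<close>

lemma orbit_structure:
  obtains N where "9 \<le> N" "\<And>q. q \<in> Q \<Longrightarrow> (\<beta> ^^ N) q = q"
    "\<And>i j. orb i = orb j \<longleftrightarrow> i mod N = j mod N"
    "Q = range orb \<or> d \<notin> range orb \<and> \<beta> d = d \<and> Q = insert d (range orb)"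
proof -
  have "finite (range orb)"
    by (rule finite_subset[OF _ finite_Q]) (use x0 in auto)
  then have "\<not> inj orb"
    using finite_imageD infinite_UNIV_nat by blast
  then obtain i j where "i \<noteq> j" "orb i = orb j"
    unfolding inj_def by blast
  then obtain i j where ij: "i < j" "orb i = orb j"
    using linorder_less_linear[of i j] by auto
  \<comment> \<open>Cancelling the injective \<open>i\<close>-th power turns a repetition into a
    return to \<open>x0\<close>, so the orbit has no preperiod.\<close>
  have "orb j = (\<beta> ^^ i) (orb (j - i))"
    using ij(1) funpow_add[of i "j - i" \<beta>] by simp
  with ij have "\<exists>N>0. orb N = x0"
    using \<beta>_pow_inj[of x0 "orb (j - i)" i] x0 by (intro exI[of _ "j - i"]) auto
  define N where "N = (LEAST N. N > 0 \<and> orb N = x0)"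
  have N: "N > 0" "orb N = x0"
    using LeastI_ex[OF \<open>\<exists>N>0. orb N = x0\<close>] by (auto simp: N_def)
  have least: "orb k \<noteq> x0" if "0 < k" "k < N" for k
    using not_less_Least[of k "\<lambda>N. N > 0 \<and> orb N = x0"] that by (auto simp: N_def)
  have mod: "orb (i mod N) = orb i" for i
    using funpow_mod_eq[where f = \<beta> and n = N and x = x0 and m = i] N(2) by simp
  have inj: "i = j" if "orb i = orb j" "i \<le> j" "j < N" for i j
  proof (rule ccontr)
    assume "i \<noteq> j"
    have "orb j = (\<beta> ^^ i) (orb (j - i))"
      using that(2) funpow_add[of i "j - i" \<beta>] by simp
    with that have "x0 = orb (j - i)"
      using \<beta>_pow_inj[of x0 "orb (j - i)" i] x0 by auto
    moreover have "j - i < N" using that by linarith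
    ultimately show False using least[of "j - i"] that(2) \<open>i \<noteq> j\<close> by simp
  qed
  have iff: "orb i = orb j \<longleftrightarrow> i mod N = j mod N" for i j
  proof
    assume "orb i = orb j"
    then have "orb (i mod N) = orb (j mod N)" by (simp add: mod)
    then show "i mod N = j mod N"
      using inj[of "i mod N" "j mod N"] inj[of "j mod N" "i mod N"] N(1)
      by (cases "i mod N \<le> j mod N") auto
  next
    assume "i mod N = j mod N"
    then show "orb i = orb j" using mod[of i] mod[of j] by simp
  qed
  have range: "range orb = orb ` {..<N}"
  proof (intro equalityI subsetI)
    fix q assume "q \<in> range orb"
    then obtain i where "q = orb (i mod N)" by (auto simp: mod)
    then show "q \<in> orb ` {..<N}" using N(1) by auto
  qed auto
  let ?R = "Q - range orb"
  have \<beta>R: "\<beta> q \<in> ?R" if "q \<in> ?R" for q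
  proof -
    have "\<beta> q \<noteq> orb i" for i
    proof
      assume eq: "\<beta> q = orb i"
      \<comment> \<open>By periodicity an orbit point has a predecessor on the orbit,
        \<open>N - 1\<close> steps ahead of it; injectivity of \<open>b\<close> identifies
        \<open>q\<close> with that predecessor.\<close>
      have "orb i = orb (Suc (i + (N - 1)))"
        using N(1) iff[of i "Suc (i + (N - 1))"] by simp
      with eq have "q = orb (i + (N - 1))"
        using that x0 inj_onD[OF b_inj, of q "orb (i + (N - 1))"] by simp
      with that show False by blast
    qed
    then show ?thesis using that trans_closed by auto
  qed
  have \<alpha>R: "sa_trans A q a = q" if "q \<in> ?R" for q
    using that a_fix[of q] range_eqI[of x0 orb 0] by auto
  have injR: "sa_run A q w \<noteq> sa_run A r w" if "w \<in> lists {a, b}" "q \<in> ?R" "r \<in> ?R" "q \<noteq> r" for w q r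
    using that
  proof (induction w arbitrary: q r rule: list.induct)
    case (Cons c w)
    show ?case
    proof (cases "c = a")
      case True
      then show ?thesis using Cons.IH[OF _ Cons.prems(2-4)] Cons.prems(1) \<alpha>R[OF Cons.prems(2)] \<alpha>R[OF Cons.prems(3)]
        by simp
    next
      case False
      then have [simp]: "c = b" using Cons.prems(1) by simp
      have "\<beta> q \<noteq> \<beta> r"
        using Cons.prems inj_onD[OF b_inj, of q r] by auto
      then show ?thesis
        using Cons.IH[OF _ \<beta>R[OF Cons.prems(2)] \<beta>R[OF Cons.prems(3)]] Cons.prems(1) by simp
    qed
  qed simp
  have R1: "q = r" if "q \<in> ?R" "r \<in> ?R" for q r
    using injR[OF w0(1) that] collapsesD[OF w0(2)] that by blast
  have sub: "range orb \<subseteq> Q" using x0 by auto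
  have cases: "Q = range orb \<or> d \<notin> range orb \<and> \<beta> d = d \<and> Q = insert d (range orb)"
  proof (cases "?R = {}")
    case False
    then obtain s where s: "s \<in> ?R" by auto
    then have "?R = {s}" using R1 by auto
    then have Q: "Q = insert s (range orb)" using sub by auto
    have \<beta>s: "\<beta> s = s" using R1[OF \<beta>R[OF s] s] .
    \<comment> \<open>Otherwise \<open>d\<close> lies on the orbit, which is then closed under both
      letters, so \<open>w0\<close> cannot carry \<open>x0\<close> to the fixed state
      \<open>s\<close>.\<close>
    have "d = s"
    proof (rule ccontr)
      assume "d \<noteq> s"
      then obtain e where e: "d = orb e" using d Q by auto
      have s_run: "sa_run A s w = s" if "w \<in> lists {a, b}" for w
        using that by (induction w) (auto simp: \<beta>s \<alpha>R[OF s])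
      have "sa_run A q w \<in> range orb" if "w \<in> lists {a, b}" "q \<in> range orb" for q w
        using that
      proof (induction w arbitrary: q rule: list.induct)
        case (Cons c w)
        then obtain i where i: "q = orb i" by auto
        have "sa_trans A q a \<in> range orb"
          using a_fix[of q] Cons.prems(2) sub e a_x0 by (cases "q = x0") auto
        moreover have "\<beta> q \<in> range orb"
          using i by (intro range_eqI[of _ _ "Suc i"]) simp
        ultimately show ?case using Cons by (auto simp del: range_eqI)
      qed simp
      then have "sa_run A x0 w0 \<in> range orb"
        using w0(1) range_eqI[of x0 orb 0] by simp
      moreover have "sa_run A x0 w0 = s"
        using collapsesD[OF w0(2), of x0 s] s_run[OF w0(1)] x0 s by simp
      ultimately show False using s by auto
    qed
    then show ?thesis using s \<beta>s Q by auto
  qed (use sub in auto)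
  \<comment> \<open>At most one state lies off the orbit, so ten states leave a cycle of length at
    least nine.\<close>
  have "card (range orb) \<le> N"
    unfolding range using card_image_le[of "{..<N}"] by simp
  moreover have "card Q \<le> Suc (card (range orb))"
    using cases by (auto simp: range card_insert_if)
  ultimately have "9 \<le> N" using card_Q by simp
  moreover have "(\<beta> ^^ N) q = q" if "q \<in> Q" for q
  proof (cases "q \<in> range orb")
    case True
    then obtain i where "q = orb i" by auto
    then have "(\<beta> ^^ N) q = orb (N + i)" by (simp add: funpow_add)
    also have "\<dots> = orb i" by (simp add: iff)
    finally show ?thesis using \<open>q = orb i\<close> by simp
  next
    case False
    then have "q = d" "\<beta> d = d" using that cases by auto
    moreover have "(\<beta> ^^ k) d = d" for k
      by (induction k) (simp_all add: \<open>\<beta> d = d\<close>)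
    ultimately show ?thesis by blast
  qed
  ultimately show ?thesis using that iff cases by blast
qed

end


section \<open>The cycle of the permutation\<close>

text \<open>The cycle structure from \<open>orbit_structure\<close> becomes an assumption with a
  fixed period \<open>N\<close>. \<open>B\<close> will be instantiated with the restriction of the
  constraint automaton to its components, so that runs never leave a component.\<close>

locale orbit_idem_perm = sync_idem_perm +
  fixes N :: nat and B :: "('p, 'b) pdfa"
  assumes N_ge: "9 \<le> N"
    and period: "\<And>q. q \<in> Q \<Longrightarrow> (\<beta> ^^ N) q = q"
    and orb_eq: "\<And>i j. orb i = orb j \<longleftrightarrow> i mod N = j mod N"
    and Q_cases: "Q = range orb \<or> d \<notin> range orb \<and> \<beta> d = d \<and> Q = insert d (range orb)"
    and alphabet_B: "pdfa_alphabet B = {a, b}"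
begin

lemma orb_Q [simp]: "orb i \<in> Q"
  using x0 by simp

lemma orb_eq_x0: "orb i = x0 \<longleftrightarrow> N dvd i"
  using orb_eq[of i 0] by (simp add: dvd_eq_mod_eq_0)

lemma period_dvd: "q \<in> Q \<Longrightarrow> N dvd k \<Longrightarrow> (\<beta> ^^ k) q = q"
proof -
  assume q: "q \<in> Q" and "N dvd k"
  then obtain j where "k = N * j" by auto
  moreover have "(\<beta> ^^ (N * j)) q = q"
    by (induction j) (simp_all add: funpow_add period q)
  ultimately show ?thesis by simp
qed

lemma a_eqD:
  assumes "sa_trans A q a = sa_trans A r a" "q \<noteq> r" "q \<in> Q" "r \<in> Q"
  shows "{q, r} = {x0, d}"
  using assms a_fix[of q] a_fix[of r] a_x0 by (cases "q = x0"; cases "r = x0") auto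

section \<open>Loops that synchronize\<close>

lemma loops_lists: "loops B p \<subseteq> lists {a, b}"
  using alphabet_B by (auto simp: loops_def)

text \<open>Loops at \<open>p\<close> can be concatenated, so loops that act like the single letters
  translate \<open>w0\<close> letter by letter into a loop with the same action.\<close>

lemma simulation:
  assumes "\<And>c. c \<in> {a, b} \<Longrightarrow> \<exists>h\<in>loops B p. \<forall>q\<in>Q. sa_run A q h = sa_trans A q c"
  shows "\<exists>m\<in>loops B p. collapses A Q m"
proof -
  have "\<exists>m\<in>loops B p. \<forall>q\<in>Q. sa_run A q m = sa_run A q w" if "w \<in> lists {a, b}" for w
    using that
  proof (induction w rule: list.induct)
    case Nil
    then show ?case using loops_Nil[of B p] by (intro bexI[of _ "[]"]) auto
  next
    case (Cons c w)
    then obtain m where m: "m \<in> loops B p" "\<forall>q\<in>Q. sa_run A q m = sa_run A q w"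
      by auto
    from Cons.prems assms obtain h where h: "h \<in> loops B p" "\<forall>q\<in>Q. sa_run A q h = sa_trans A q c"
      by (metis listsE)
    have "sa_run A q (h @ m) = sa_run A q (c # w)" if "q \<in> Q" for q
    proof -
      have "sa_trans A q c \<in> Q" using Cons.prems that by (intro trans_closed) auto
      then show ?thesis using h(2) m(2) that by simp
    qed
    then show ?case using loops_append[OF h(1) m(1)] by blast
  qed
  from this[OF w0(1)] obtain m where m: "m \<in> loops B p" "\<forall>q\<in>Q. sa_run A q m = sa_run A q w0"
    by blast
  then have "collapses A Q m"
    using collapsesD[OF w0(2)] unfolding collapses_def by metis
  with m show ?thesis by blast
qed

lemma bb_run: "sa_run A q (concat (replicate j [b, b])) = (\<beta> ^^ (2 * j)) q"
  by (induction j arbitrary: q) (simp_all add: funpow_Suc_right del: funpow.simps(2))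

text \<open>Powers of \<open>b\<close> are available, and \<open>N - 1\<close> of them undo one
  \<open>b\<close>, so \<open>ab\<close> followed by them acts like \<open>a\<close>. If the other
  loop is \<open>aa\<close>, idempotence does the same.\<close>

lemma collapses_b_loop:
  assumes "[b] \<in> loops B p" "[a, c] \<in> loops B p" "c \<in> {a, b}"
  shows "\<exists>m\<in>loops B p. collapses A Q m"
proof (rule simulation)
  have power: "concat (replicate k [b]) \<in> loops B p"
    and run_power: "sa_run A q (concat (replicate k [b])) = (\<beta> ^^ k) q" for k q
    using loops_power[OF assms(1)] sa_run_power[of A q k "[b]"] by simp_all
  fix c'
  let ?simulates = "\<exists>h\<in>loops B p. \<forall>q\<in>Q. sa_run A q h = sa_trans A q c'"
  assume "c' \<in> {a, b}"
  moreover have ?simulates if "c' = b"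
    using assms(1) that by (intro bexI[of _ "[b]"]) auto
  moreover have ?simulates if "c' = a" "c = a"
  proof -
    have "sa_run A q [a, a] = sa_trans A q a" if "q \<in> Q" for q
      using a_run[OF that, of 2] by (simp add: numeral_2_eq_2)
    with assms(2) that show ?simulates by (intro bexI[of _ "[a, a]"]) auto
  qed
  moreover have ?simulates if "c' = a" "c = b"
  proof -
    have "sa_run A q ([a, b] @ concat (replicate (N - 1) [b])) = sa_trans A q a" if "q \<in> Q" for q
    proof -
      have "sa_run A q ([a, b] @ concat (replicate (N - 1) [b])) = (\<beta> ^^ Suc (N - 1)) (sa_trans A q a)"
        by (simp only: sa_run_append run_power) (simp add: funpow_Suc_right del: funpow.simps(2))
      also have "\<dots> = sa_trans A q a"
        using N_ge that by (simp add: period trans_closed del: funpow.simps(2))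
      finally show ?thesis .
    qed
    moreover have "[a, b] @ concat (replicate (N - 1) [b]) \<in> loops B p"
      using assms(2) that by (intro loops_append power) auto
    ultimately show ?simulates using that by blast
  qed
  ultimately show ?simulates
    using assms(3) by blast
qed

text \<open>For odd \<open>N\<close> the even number \<open>N + 1\<close> of letters
  \<open>b\<close> acts like a single \<open>b\<close>, so both letters can be simulated.\<close>

lemma collapses_even_gap:
  assumes "[b, b] \<in> loops B p" "[a] \<in> loops B p" "odd N"
  shows "\<exists>m\<in>loops B p. collapses A Q m"
proof (rule simulation)
  fix c assume "c \<in> {a, b}"
  moreover have "sa_run A q (concat (replicate ((N + 1) div 2) [b, b])) = \<beta> q" if "q \<in> Q" for q
  proof -
    have "2 * ((N + 1) div 2) = Suc N" using assms(3) by simp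
    then show ?thesis using period[OF that] by (simp add: bb_run)
  qed
  ultimately show "\<exists>h\<in>loops B p. \<forall>q\<in>Q. sa_run A q h = sa_trans A q c"
    using assms(2) loops_power[OF assms(1)] by (metis insertE singletonD sa_run_Cons sa_run_Nil)
qed

text \<open>All shifts of a mergeable pair are mergeable. The letter \<open>a\<close> is available at times of one
  parity only; when \<open>x0\<close> is reached at a time of the wrong parity, the block \<open>ab\<close>
  is spent where it does not move the pair, which changes the parity.\<close>

lemma collapses_odd_gap:
  assumes bb: "[b, b] \<in> loops B p" and ab: "[a, b] \<in> loops B p"
  shows "\<exists>m\<in>loops B p. collapses A Q m"
proof -
  define mg where "mg q r \<longleftrightarrow> (\<exists>m\<in>loops B p. sa_run A q m = sa_run A r m)" for q r
  have mg_refl: "mg q q" for q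
    using loops_Nil[of B p] by (auto simp: mg_def)
  have mg_sym: "mg q r \<Longrightarrow> mg r q" for q r
    unfolding mg_def by metis
  have mg_step: "mg q r" if "u \<in> loops B p" "mg (sa_run A q u) (sa_run A r u)" for q r u
  proof -
    from that(2) obtain m where "m \<in> loops B p" "sa_run A q (u @ m) = sa_run A r (u @ m)"
      by (auto simp: mg_def)
    then show ?thesis unfolding mg_def using loops_append[OF that(1)] by blast
  qed
  have mg_bb: "mg ((\<beta> ^^ i) q) ((\<beta> ^^ i) r)" if "mg ((\<beta> ^^ (2 * j + i)) q) ((\<beta> ^^ (2 * j + i)) r)" for i j q r
    using mg_step[OF loops_power[OF bb, of j], of "(\<beta> ^^ i) q" "(\<beta> ^^ i) r"] that
    by (simp add: bb_run funpow_add)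
  have at_x0: "mg (orb i) ((\<beta> ^^ i) r)"
    if r: "r \<in> Q" "r \<noteq> x0" and IH: "\<And>i. mg ((\<beta> ^^ i) d) ((\<beta> ^^ i) r)" for i r
  proof -
    have even: "mg (orb i) ((\<beta> ^^ i) r)" if "even i" for i
    proof -
      \<comment> \<open>Blocks \<open>bb\<close> rotate the pair back to \<open>x0\<close> and
        \<open>r\<close>: for even \<open>i\<close> the number \<open>N * i - i\<close> of further
        letters \<open>b\<close> is even.\<close>
      have eq: "2 * (i * (N - 1) div 2) + i = N * i"
        using that N_ge by (simp add: algebra_simps diff_mult_distrib2)
      \<comment> \<open>The block \<open>ab\<close> leads from \<open>x0\<close> and
        \<open>r\<close> to the shift by one of the pair \<open>d\<close>, \<open>r\<close>.\<close>
      have "mg x0 r"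
        using mg_step[OF ab, of x0 r] IH[of 1] a_x0 a_fix[OF r] by simp
      then have "mg ((\<beta> ^^ (2 * (i * (N - 1) div 2) + i)) x0) ((\<beta> ^^ (2 * (i * (N - 1) div 2) + i)) r)"
        unfolding eq by (simp add: period_dvd r x0)
      then show ?thesis
        by (rule mg_bb)
    qed
    show ?thesis
    proof (cases "even i \<or> odd N")
      case True
      \<comment> \<open>For odd \<open>N\<close> a full turn changes the parity of the
        shift.\<close>
      moreover have "mg (orb (i + N)) ((\<beta> ^^ (i + N)) r) \<longleftrightarrow> mg (orb i) ((\<beta> ^^ i) r)"
        by (simp add: funpow_add period r x0)
      ultimately show ?thesis using even[of i] even[of "i + N"] by auto
    next
      case False
      \<comment> \<open>Here \<open>N\<close> is even and \<open>i\<close> is odd, so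
        \<open>orb i\<close> is not \<open>x0\<close>. If the other state is not \<open>x0\<close>
        either, the block \<open>ab\<close> acts like \<open>b\<close> on the pair and makes the
        shift even.\<close>
      have odd: "mg (orb i) ((\<beta> ^^ i) r)" if "odd i" "(\<beta> ^^ i) r \<noteq> x0" for i
      proof -
        have "orb i \<noteq> x0"
          using False that(1) dvd_trans[of 2 N i] by (auto simp: orb_eq_x0)
        then show ?thesis
          using mg_step[OF ab, of "orb i" "(\<beta> ^^ i) r"] that(2) even[of "Suc i"] that(1) r
          by (simp add: a_fix)
      qed
      \<comment> \<open>If the other state does sit at \<open>x0\<close>, one block
        \<open>bb\<close> moves it away, because \<open>N\<close> does not divide 2.\<close>
      have "(\<beta> ^^ i) r \<noteq> x0 \<or> (\<beta> ^^ (i + 2)) r \<noteq> x0"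
      proof (rule ccontr)
        assume *: "\<not> ?thesis"
        have "(\<beta> ^^ (i + 2)) r = (\<beta> ^^ 2) ((\<beta> ^^ i) r)"
          using funpow_add[of 2 i \<beta>] by (simp add: add.commute[of i])
        with * have "orb 2 = x0" by simp
        then show False using N_ge by (auto simp: orb_eq_x0 dest: dvd_imp_le)
      qed
      then show ?thesis
        using odd[of i] odd[of "i + 2"] False mg_bb[where j = 1 and i = i and q = x0 and r = r]
        by (auto simp: add.commute)
    qed
  qed
  have "mg ((\<beta> ^^ i) q) ((\<beta> ^^ i) r)"
    if "w \<in> lists {a, b}" "q \<in> Q" "r \<in> Q" "sa_run A q w = sa_run A r w" for w q r i
    using that
  proof (induction w arbitrary: q r i rule: list.induct)
    case (Cons c w)
    show ?case
    proof (cases "c = a")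
      case True
      have IH: "mg ((\<beta> ^^ i) (sa_trans A q a)) ((\<beta> ^^ i) (sa_trans A r a))" for i
        using Cons True by (intro Cons.IH) (auto intro: trans_closed)
      consider "q = r" | "q \<noteq> x0" "r \<noteq> x0" | "q = x0" "r \<noteq> x0" | "q \<noteq> x0" "r = x0"
        by blast
      then show ?thesis
      proof cases
        case 3
        then show ?thesis
          using IH at_x0[of r i] Cons.prems a_fix[of r] a_x0 by simp
      next
        case 4
        then show ?thesis
          using IH at_x0[of q i] Cons.prems a_fix[of q] a_x0 mg_sym by metis
      qed (use mg_refl IH[of i] a_fix Cons.prems in auto)
    next
      case False
      then have "c = b" using Cons.prems by simp
      \<comment> \<open>The induction hypothesis covers all shifts of the successors, and
        \<open>N - 1\<close> additional steps undo the letter \<open>b\<close>.\<close>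
      then have "mg ((\<beta> ^^ (i + N - 1)) (\<beta> q)) ((\<beta> ^^ (i + N - 1)) (\<beta> r))"
        using Cons by (intro Cons.IH) (auto intro: trans_closed)
      moreover have "(\<beta> ^^ (i + N - 1)) (\<beta> s) = (\<beta> ^^ i) s" if "s \<in> Q" for s
      proof -
        have "(\<beta> ^^ (i + N - 1)) (\<beta> s) = (\<beta> ^^ Suc (i + N - 1)) s"
          by (simp add: funpow_Suc_right del: funpow.simps(2))
        also have "\<dots> = (\<beta> ^^ i) s"
          using N_ge that by (simp add: funpow_add period del: funpow.simps(2))
        finally show ?thesis .
      qed
      ultimately show ?thesis using Cons.prems by simp
    qed
  qed (simp add: mg_refl)
  from this[of w0 _ _ 0] have "mg q r" if "q \<in> Q" "r \<in> Q" for q r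
    using collapsesD[OF w0(2) that] w0(1) that by simp
  then show ?thesis
    unfolding mg_def using loops_lists alphabet
    by (intro collapses_if_pairs sa loops_Nil loops_append) auto
qed

text \<open>The block \<open>ab\<close> moves \<open>x0\<close> to \<open>\<beta> d\<close> and
  every other orbit point one step along the cycle. Under \<open>target\<close> it fixes
  \<open>\<beta> d\<close>, which equals \<open>d\<close> if \<open>d\<close> is off the orbit and
  \<open>x0\<close> otherwise. So \<open>N\<close> blocks carry every state there.\<close>

lemma collapses_ab:
  assumes ab: "[a, b] \<in> loops B p" and target: "d \<notin> range orb \<or> d = orb (N - 1)"
  shows "\<exists>m\<in>loops B p. collapses A Q m"
proof -
  define T where "T q = sa_run A q [a, b]" for q
  have T_x0: "T x0 = \<beta> d" using a_x0 by (simp add: T_def)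
  have T_fix: "T (\<beta> d) = \<beta> d"
  proof (cases "d \<in> range orb")
    case True
    have "\<beta> (orb (N - 1)) = orb N"
      using N_ge by (cases N) auto
    then show ?thesis using target True T_x0 orb_eq_x0[of N] by simp
  next
    case False
    then have "\<beta> d = d" using Q_cases d by auto
    then show ?thesis using a_fix[OF d d_neq] by (simp add: T_def)
  qed
  have T_pow_fix: "(T ^^ k) (\<beta> d) = \<beta> d" for k
    by (induction k) (simp_all add: T_fix)
  have T_orb: "(T ^^ Suc j) (orb (N - j)) = \<beta> d" if "j < N" for j
    using that
  proof (induction j)
    case 0
    have "orb N = x0" by (simp add: orb_eq_x0)
    then show ?case by (simp add: T_x0)
  next
    case (Suc j)
    have "orb (N - Suc j) \<noteq> x0"
      using Suc.prems by (auto simp: orb_eq_x0 dest: dvd_imp_le)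
    then have "T (orb (N - Suc j)) = orb (Suc (N - Suc j))"
      by (simp add: T_def a_fix)
    also have "Suc (N - Suc j) = N - j" using Suc.prems by simp
    finally show ?case using Suc by (simp add: funpow_Suc_right del: funpow.simps(2))
  qed
  have "(T ^^ N) q = \<beta> d" if "q \<in> Q" for q
  proof (cases "q \<in> range orb")
    case True
    then obtain i where i: "q = orb i" by auto
    \<comment> \<open>\<open>N - j\<close> is the representative of \<open>i\<close> modulo
      \<open>N\<close> between 1 and \<open>N\<close>; thus \<open>x0\<close> counts as
      \<open>orb N\<close>, with \<open>j = 0\<close>.\<close>
    define j where "j = N - 1 - (i + N - 1) mod N"
    have less: "(i + N - 1) mod N < N" using N_ge by simp
    have "(N - j) mod N = ((i + N - 1) mod N + 1) mod N"
      using less by (simp add: j_def)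
    also have "\<dots> = i mod N"
      using N_ge by (simp add: mod_simps)
    finally have q: "q = orb (N - j)" using i orb_eq by simp
    have j: "j < N" using N_ge by (auto simp: j_def)
    have "(T ^^ N) q = (T ^^ (N - Suc j)) ((T ^^ Suc j) q)"
      using j funpow_add[of "N - Suc j" "Suc j" T] by simp
    then show ?thesis using T_orb[OF j] T_pow_fix q by simp
  next
    case False
    then have "q = d" "\<beta> d = d" using that Q_cases by auto
    then show ?thesis using T_pow_fix[of N] by simp
  qed
  then have "collapses A Q (concat (replicate N [a, b]))"
    unfolding collapses_def sa_run_power T_def by simp
  then show ?thesis using loops_power[OF ab] by blast
qed

text \<open>Tailored to runs through a two-state and a single-state component: \<open>m\<close> is
  read in the former, the power of \<open>c\<close> in the latter, and \<open>l\<close> is the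
  transition between them.\<close>

definition rigid :: "'b list \<Rightarrow> bool" where
  "rigid m \<longleftrightarrow> (\<forall>c\<in>{a, b}. \<forall>l\<in>{a, b}. \<forall>i.
     \<not> collapses A Q (replicate i c @ [l] @ m) \<and> \<not> collapses A Q (m @ [l] @ replicate i c))"

lemma rigid_if_inj:
  assumes "H \<subseteq> Q" "4 \<le> card H" "inj_on (\<lambda>q. sa_run A q m) H" and m: "m \<in> lists {a, b}"
  shows "rigid m"
  unfolding rigid_def
proof (intro ballI allI)
  fix c l i assume cl: "c \<in> {a, b}" "l \<in> {a, b}"
  have lists: "replicate i c \<in> lists {a, b}" "[l] \<in> lists {a, b}" using cl by auto
  \<comment> \<open>One loss is due to the power and one to the connecting letter.\<close>
  moreover have "drops 2 (replicate i c @ [l])" "drops 2 ([l] @ replicate i c)"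
    using drops_append[OF drops_power[OF cl(1)] drops_single[OF cl(2)] lists(1)]
      drops_append[OF drops_single[OF cl(2)] drops_power[OF cl(1)] lists(2)]
    by (simp_all only: one_add_one)
  ultimately show "\<not> collapses A Q (replicate i c @ [l] @ m) \<and> \<not> collapses A Q (m @ [l] @ replicate i c)"
    using inj_not_collapses(1)[OF assms, of "replicate i c @ [l]"]
      inj_not_collapses(2)[OF assms, of "[l] @ replicate i c"] cl by auto
qed

lemma run_invariant:
  assumes "\<And>p q r c p'. \<lbrakk>R p q r; c \<in> {a, b}; pdfa_trans B p c = Some p'\<rbrakk>
      \<Longrightarrow> R p' (sa_trans A q c) (sa_trans A r c)"
    and "m \<in> lists {a, b}" "pdfa_run B p m = Some p'" "R p q r"
  shows "R p' (sa_run A q m) (sa_run A r m)"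
  using assms(2-)
proof (induction m arbitrary: p q r rule: list.induct)
  case (Cons c m)
  then obtain p1 where "pdfa_trans B p c = Some p1" "pdfa_run B p1 m = Some p'"
    by (auto simp: bind_eq_Some_conv)
  then show ?case using Cons assms(1)[of p q r c p1] by auto
qed simp

text \<open>\<open>R p\<close> collects pairs that cannot merge while \<open>B\<close> is in state
  \<open>p\<close>. It is preserved along runs and never relates a state to itself, so
  \<open>m\<close> is injective on \<open>H\<close>.\<close>

lemma rigid_if_invariant:
  assumes "\<And>p q r c p'. \<lbrakk>R p q r; c \<in> {a, b}; pdfa_trans B p c = Some p'\<rbrakk>
      \<Longrightarrow> R p' (sa_trans A q c) (sa_trans A r c)"
    and neq: "\<And>p q. \<not> R p q q"
    and m: "m \<in> lists {a, b}" "pdfa_run B p m = Some p'"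
    and H: "H \<subseteq> Q" "4 \<le> card H" "\<And>q r. q \<in> H \<Longrightarrow> r \<in> H \<Longrightarrow> q \<noteq> r \<Longrightarrow> R p q r"
  shows "rigid m"
proof (rule rigid_if_inj)
  show "inj_on (\<lambda>q. sa_run A q m) H"
  proof (rule inj_onI, rule ccontr)
    fix q r assume qr: "q \<in> H" "r \<in> H" "sa_run A q m = sa_run A r m" "q \<noteq> r"
    have "R p' (sa_run A q m) (sa_run A r m)"
      by (rule run_invariant[of R m p, OF _ assms(3,4)]) (use assms(1) H(3) qr in auto)
    then show False using qr(3) neq by simp
  qed
qed (use assms in auto)

text \<open>On a cycle of even length the parity of a position changes in step with the state of
  \<open>B\<close>. Positions that are odd in \<open>x\<close>, and even in \<open>y\<close>, never
  meet \<open>x0\<close> when \<open>a\<close> is read, so all such words are injective on one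
  parity class.\<close>

lemma rigid_even_gap:
  assumes "pdfa_trans B x b = Some y" "pdfa_trans B y b = Some x"
    and "pdfa_trans B x a = Some x" "pdfa_trans B y a = None" "x \<noteq> y"
    and p: "p \<in> {x, y}" "m \<in> lists {a, b}" "pdfa_run B p m = Some p'" and "even N"
  shows "rigid m"
proof -
  define H where "H = (\<lambda>k :: nat. orb ` {i. i mod 2 = k})"
  \<comment> \<open>The parity class that fits the start state \<open>p\<close>.\<close>
  define k :: nat where "k = (if p = x then 1 else 0)"
  have fixed: "sa_trans A q a = q" if "q \<in> H 1" for q
  proof -
    from that obtain i where i: "q = orb i" "odd i" by (auto simp: H_def odd_iff_mod_2_eq_one)
    then have "q \<noteq> x0" using \<open>even N\<close> by (auto simp: orb_eq_x0 intro: dvd_trans)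
    then show ?thesis using a_fix i by simp
  qed
  have H_b: "\<beta> q \<in> H (1 - k)" if "q \<in> H k" "k \<le> 1" for q k
  proof -
    from that obtain i where i: "q = orb i" "i mod 2 = k" by (auto simp: H_def)
    then have "Suc i mod 2 = 1 - k" using that(2) by presburger
    then show ?thesis using i by (auto simp: H_def intro!: image_eqI[of _ _ "Suc i"])
  qed
  have sub: "H k \<subseteq> Q" for k by (auto simp: H_def)
  show ?thesis
  proof (rule rigid_if_invariant[where R = "\<lambda>p q r. q \<noteq> r \<and>
      (p = x \<and> q \<in> H 1 \<and> r \<in> H 1 \<or> p = y \<and> q \<in> H 0 \<and> r \<in> H 0)" and H = "H k"])
    fix p q r c p'
    assume *: "q \<noteq> r \<and> (p = x \<and> q \<in> H 1 \<and> r \<in> H 1 \<or> p = y \<and> q \<in> H 0 \<and> r \<in> H 0)"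
      "c \<in> {a, b}" "pdfa_trans B p c = Some p'"
    then have "q \<in> Q" "r \<in> Q" using sub by auto
    show "sa_trans A q c \<noteq> sa_trans A r c \<and>
      (p' = x \<and> sa_trans A q c \<in> H 1 \<and> sa_trans A r c \<in> H 1 \<or>
       p' = y \<and> sa_trans A q c \<in> H 0 \<and> sa_trans A r c \<in> H 0)"
    proof (cases "c = a")
      case True
      then show ?thesis using * assms(3,4) fixed by auto
    next
      case False
      then have "c = b" using * by auto
      moreover have "\<beta> q \<noteq> \<beta> r" using * inj_onD[OF b_inj _ \<open>q \<in> Q\<close> \<open>r \<in> Q\<close>] by auto
      ultimately show ?thesis using * assms(1,2) H_b[of q 1] H_b[of r 1] H_b[of q 0] H_b[of r 0] by auto
    qed
  next
    \<comment> \<open>These indices are at most 7, hence distinct modulo \<open>N\<close>.\<close>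
    have "inj_on orb {k, k + 2, k + 4, k + 6}"
      using N_ge by (auto simp: inj_on_def orb_eq k_def)
    then have "card (orb ` {k, k + 2, k + 4, k + 6}) = 4"
      by (simp add: card_image)
    moreover have "orb ` {k, k + 2, k + 4, k + 6} \<subseteq> H k"
      unfolding H_def by (intro image_mono) (auto simp: k_def)
    ultimately show "4 \<le> card (H k)"
      by (metis card_mono finite_Q finite_subset sub)
  next
    fix q r assume "q \<in> H k" "r \<in> H k" "q \<noteq> r"
    then show "q \<noteq> r \<and> (p = x \<and> q \<in> H 1 \<and> r \<in> H 1 \<or> p = y \<and> q \<in> H 0 \<and> r \<in> H 0)"
      using p(1) \<open>x \<noteq> y\<close> by (auto simp: k_def split: if_splits)
  qed (use p sub in auto)
qed

lemma card_Q_minus: "4 \<le> card (Q - {x0})"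
  using card_Q x0 finite_Q by simp

text \<open>Runs from \<open>X\<close> read only \<open>a\<close>, which fixes every state other
  than \<open>x0\<close>.\<close>

lemma rigid_no_b:
  assumes closed: "\<And>p c p'. \<lbrakk>p \<in> X; c \<in> {a, b}; pdfa_trans B p c = Some p'\<rbrakk> \<Longrightarrow> p' \<in> X \<and> c \<noteq> b"
    and p: "p \<in> X" and m: "m \<in> lists {a, b}" "pdfa_run B p m = Some p'"
  shows "rigid m"
proof (rule rigid_if_invariant[where R = "\<lambda>p q r. p \<in> X \<and> q \<noteq> r \<and> q \<in> Q - {x0} \<and> r \<in> Q - {x0}"
      and H = "Q - {x0}", OF _ _ m])
  fix p q r c p'
  assume *: "p \<in> X \<and> q \<noteq> r \<and> q \<in> Q - {x0} \<and> r \<in> Q - {x0}" "c \<in> {a, b}" "pdfa_trans B p c = Some p'"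
  then have "p' \<in> X" "sa_trans A q c = q" "sa_trans A r c = r"
    using closed[of p c p'] a_fix by auto
  with * show "p' \<in> X \<and> sa_trans A q c \<noteq> sa_trans A r c \<and> sa_trans A q c \<in> Q - {x0} \<and> sa_trans A r c \<in> Q - {x0}"
    by simp
qed (use p card_Q_minus in auto)

lemma rigid_no_a:
  assumes closed: "\<And>p c p'. \<lbrakk>p \<in> X; c \<in> {a, b}; pdfa_trans B p c = Some p'\<rbrakk> \<Longrightarrow> p' \<in> X \<and> c \<noteq> a"
    and p: "p \<in> X" and m: "m \<in> lists {a, b}" "pdfa_run B p m = Some p'"
  shows "rigid m"
proof (rule rigid_if_invariant[where R = "\<lambda>p q r. p \<in> X \<and> q \<noteq> r \<and> q \<in> Q \<and> r \<in> Q"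
      and H = Q, OF _ _ m])
  fix p q r c p'
  assume *: "p \<in> X \<and> q \<noteq> r \<and> q \<in> Q \<and> r \<in> Q" "c \<in> {a, b}" "pdfa_trans B p c = Some p'"
  then have "p' \<in> X" "c = b" using closed[of p c p'] by auto
  with * show "p' \<in> X \<and> sa_trans A q c \<noteq> sa_trans A r c \<and> sa_trans A q c \<in> Q \<and> sa_trans A r c \<in> Q"
    using inj_onD[OF b_inj, of q r] trans_closed by auto
qed (use p card_Q in auto)

text \<open>The pair \<open>{x0, d}\<close> is the only one that \<open>a\<close> merges, its powers
  merge no more by idempotence, and powers of \<open>b\<close> merge nothing.\<close>

lemma replicate_distinct:
  assumes "q \<noteq> r" "q \<in> Q" "r \<in> Q" "{q, r} \<noteq> {x0, d}" "c \<in> {a, b}"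
  shows "sa_run A q (replicate i c) \<noteq> sa_run A r (replicate i c)"
proof (cases "c = a")
  case True
  then show ?thesis using assms a_eqD[of q r] by (auto simp: a_run)
next
  case False
  then have "c = b" using assms(5) by simp
  then show ?thesis using assms(1-3) \<beta>_pow_inj[of q r i] by (auto simp: sa_run_replicate)
qed

text \<open>If the gaps between two occurrences of \<open>a\<close> all have length one, the words act
  injectively on the arc from \<open>d\<close> to the predecessor of \<open>x0\<close> on the cycle of
  \<open>b\<close>. If the arc is a single point, powers of \<open>ab\<close> synchronize. If it
  is short, it is so far behind \<open>x0\<close> that a short prefix does not leave it uncovered.\<close>

lemma collapses_or_rigid_single_b:
  assumes tr: "pdfa_trans B x b = Some y" "pdfa_trans B y b = None" "pdfa_trans B y a = Some x"
    and closed: "\<And>p'. pdfa_trans B x a = Some p' \<Longrightarrow> p' \<in> {x, y}" and "x \<noteq> y"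
    and p: "p \<in> {x, y}" and m: "m \<in> lists {a, b}" "pdfa_run B p m = Some p'"
  shows "(\<exists>m\<in>loops B y. collapses A Q m) \<or> rigid m"
proof (cases "d \<in> range orb \<and> d \<noteq> orb (N - 1)")
  case False
  have "[a, b] \<in> loops B y" using tr by (simp add: loops_def alphabet_B)
  with False show ?thesis using collapses_ab by blast
next
  case True
  then obtain e' where "d = orb e'" by auto
  then have "d = orb (e' mod N)" using orb_eq[of e' "e' mod N"] by simp
  moreover have "e' mod N < N" using N_ge by simp
  ultimately obtain e where e: "d = orb e" "e < N" by blast
  have "e \<noteq> 0" using e(1) d_neq by (cases e) auto
  moreover have "e \<noteq> N - 1" using True e(1) by auto
  ultimately have e_bounds: "0 < e" "e + 2 \<le> N" using e(2) by auto
  \<comment> \<open>\<open>a\<close> fixes the arc \<open>C1\<close> from \<open>d\<close> to the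
    predecessor of \<open>x0\<close>. \<open>C2\<close> is its image under \<open>b\<close>; it
    contains \<open>x0\<close>, as \<open>orb N\<close>, but not \<open>d\<close>, so
    \<open>a\<close> maps it injectively into \<open>C1\<close>.\<close>
  define C1 where "C1 = orb ` {e..<N}"
  define C2 where "C2 = orb ` {e<..N}"
  \<comment> \<open>In \<open>y\<close> the pair may lie in either arc: \<open>b\<close> leads from
    \<open>x\<close> to \<open>C2\<close>, whereas \<open>a\<close> may lead from \<open>x\<close>
    to \<open>y\<close> inside \<open>C1\<close>, and a run may also start in \<open>y\<close> with
    a pair in \<open>C1\<close>.\<close>
  define R where "R p q r \<longleftrightarrow> q \<noteq> r \<and>
    (p = x \<and> q \<in> C1 \<and> r \<in> C1 \<or> p = y \<and> (q \<in> C1 \<and> r \<in> C1 \<or> q \<in> C2 \<and> r \<in> C2))" for p q r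
  have sub: "C1 \<subseteq> Q" "C2 \<subseteq> Q" by (auto simp: C1_def C2_def)
  have x0_C1: "x0 \<notin> C1"
  proof
    assume "x0 \<in> C1"
    then obtain i where "x0 = orb i" "e \<le> i" "i < N" by (auto simp: C1_def)
    moreover from this(1) have "orb i = x0" by (rule sym)
    ultimately show False using e_bounds by (auto simp: orb_eq_x0 dest: dvd_imp_le)
  qed
  have not_d: "orb i \<noteq> d" if "e < i" "i < e + N" for i
  proof
    assume "orb i = d"
    then have "i mod N = e mod N" using e(1) orb_eq by simp
    then have "N dvd i - e" using that mod_eq_dvd_iff_nat[of e i N] by simp
    with that show False by (auto dest: dvd_imp_le)
  qed
  have d_C2: "d \<notin> C2"
    using not_d e_bounds by (fastforce simp: C2_def)
  have fix_C1: "sa_trans A q a = q" if "q \<in> C1" for q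
    using that sub x0_C1 a_fix[of q] by auto
  have b_C1: "\<beta> q \<in> C2" if "q \<in> C1" for q
  proof -
    from that obtain i where "q = orb i" "e \<le> i" "i < N" by (auto simp: C1_def)
    then show ?thesis unfolding C2_def by (intro image_eqI[of _ _ "Suc i"]) auto
  qed
  have a_C2: "sa_trans A q a \<in> C1" if "q \<in> C2" for q
  proof (cases "q = x0")
    case True
    then show ?thesis using a_x0 e by (auto simp: C1_def)
  next
    case False
    from that obtain i where i: "q = orb i" "e < i" "i \<le> N" by (auto simp: C2_def)
    with False have "i \<noteq> N" by (auto simp: orb_eq_x0)
    with i False show ?thesis using a_fix[of q] by (auto simp: C1_def)
  qed
  have inj_C2: "sa_trans A q a \<noteq> sa_trans A r a" if "q \<noteq> r" "q \<in> C2" "r \<in> C2" for q r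
  proof
    assume "sa_trans A q a = sa_trans A r a"
    then have "{q, r} = {x0, d}" using that a_eqD[of q r] sub by auto
    then have "d \<in> {q, r}" by simp
    then show False using that d_C2 by auto
  qed
  have inj_b: "\<beta> q \<noteq> \<beta> r" if "q \<noteq> r" "q \<in> Q" "r \<in> Q" for q r
    using that inj_onD[OF b_inj] by blast
  have step: "R p' (sa_trans A q c) (sa_trans A r c)"
    if R: "R p q r" and c: "c \<in> {a, b}" and p': "pdfa_trans B p c = Some p'" for p q r c p'
  proof -
    have neq: "q \<noteq> r" and "p = x \<or> p = y" using R by (auto simp: R_def)
    from this(2) show ?thesis
    proof
      assume [simp]: "p = x"
      then have C1: "q \<in> C1" "r \<in> C1" using R \<open>x \<noteq> y\<close> by (auto simp: R_def)
      show ?thesis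
      proof (cases "c = a")
        case True
        then show ?thesis using closed[of p'] p' neq C1 by (auto simp: R_def fix_C1)
      next
        case False
        then have "c = b" using c by simp
        then show ?thesis using p' tr(1) neq C1 inj_b[of q r] b_C1 sub by (auto simp: R_def)
      qed
    next
      assume [simp]: "p = y"
      then have "c = a" using c p' tr(2) by auto
      then have "p' = x" using p' tr(3) by simp
      moreover have "q \<in> C1 \<and> r \<in> C1 \<or> q \<in> C2 \<and> r \<in> C2" using R \<open>x \<noteq> y\<close> by (auto simp: R_def)
      ultimately show ?thesis
        using \<open>c = a\<close> neq inj_C2[of q r] a_C2 by (auto simp: R_def fix_C1)
    qed
  qed
  show ?thesis
  proof (cases "e + 4 \<le> N")
    case True
    have "inj_on orb {e..<N}" by (auto simp: inj_on_def orb_eq)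
    then have "card C1 = N - e" by (simp add: C1_def card_image)
    then have "4 \<le> card C1" using True by simp
    moreover have "R p q r" if "q \<in> C1" "r \<in> C1" "q \<noteq> r" for q r
      using that p by (auto simp: R_def)
    moreover have "\<not> R p q q" for p q by (simp add: R_def)
    ultimately have "rigid m"
      using rigid_if_invariant[of R m p p' C1] step m sub(1) by blast
    then show ?thesis ..
  next
    \<comment> \<open>The arc has only two or three states, too few for the counting argument.
      Instead the two states right before \<open>x0\<close> are followed explicitly.\<close>
    case False
    have C1_mem: "orb (N - 1) \<in> C1" "orb (N - 2) \<in> C1"
      using e_bounds by (auto simp: C1_def)
    have "orb (N - 1) \<noteq> orb (N - 2)"
      using N_ge by (auto simp: orb_eq)
    with C1_mem have "R p (orb (N - 1)) (orb (N - 2))"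
      using p by (auto simp: R_def)
    then have R_m: "R p' (sa_run A (orb (N - 1)) m) (sa_run A (orb (N - 2)) m)"
      by (intro run_invariant[of R m p]) (use step m in blast)+
    have "rigid m"
      unfolding rigid_def
    proof (intro ballI allI conjI notI)
      fix c l i assume cl: "c \<in> {a, b}" "l \<in> {a, b}"
      {
        \<comment> \<open>A power of one letter covers every cycle position except possibly 0; the
          letter after it can uncover position 1 as well. Positions \<open>N - 1\<close> and
          \<open>N - 2\<close> are far enough from both.\<close>
        have pre: "\<exists>t\<in>Q. sa_run A t (replicate i c) = orb j" if "0 < j" "j < N" for j
        proof (cases "c = a")
          case True
          have "orb j \<noteq> x0" using that by (auto simp: orb_eq_x0 dest: dvd_imp_le)
          then have "sa_run A (orb j) (replicate i c) = orb j"
            using True by (simp add: a_run a_fix)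
          then show ?thesis by (intro bexI[of _ "orb j"]) auto
        next
          case False
          then have "c = b" using cl by simp
          then show ?thesis using \<beta>_surj[of "orb j" i] by (simp add: sa_run_replicate)
        qed
        have pre': "\<exists>t\<in>Q. sa_run A t (replicate i c @ [l]) = orb j" if "1 < j" "j < N" for j
        proof (cases "l = a")
          case True
          have "orb j \<noteq> x0" using that by (auto simp: orb_eq_x0 dest: dvd_imp_le)
          moreover obtain t where "t \<in> Q" "sa_run A t (replicate i c) = orb j"
            using pre[of j] \<open>1 < j\<close> \<open>j < N\<close> by auto
          ultimately show ?thesis using True by (intro bexI[of _ t]) (simp_all add: a_fix)
        next
          case False
          then have "l = b" using cl by simp
          moreover have "orb j = \<beta> (orb (j - 1))" using that by (cases j) auto
          moreover obtain t where "t \<in> Q" "sa_run A t (replicate i c) = orb (j - 1)"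
            using pre[of "j - 1"] \<open>1 < j\<close> \<open>j < N\<close> less_imp_diff_less[of j N 1] by auto
          ultimately show ?thesis by (intro bexI[of _ t]) simp_all
        qed
        assume coll: "collapses A Q (replicate i c @ [l] @ m)"
        have "1 < N - 1" "1 < N - 2" "N - 1 < N" "N - 2 < N" using N_ge by auto
        then obtain t1 t2 where "t1 \<in> Q" "sa_run A t1 (replicate i c @ [l]) = orb (N - 1)"
          "t2 \<in> Q" "sa_run A t2 (replicate i c @ [l]) = orb (N - 2)"
          using pre'[of "N - 1"] pre'[of "N - 2"] by blast
        with collapsesD[OF coll, of t1 t2]
        have "sa_run A (orb (N - 1)) m = sa_run A (orb (N - 2)) m" by simp
        with R_m show False by (simp add: R_def)
      next
        define q where "q = sa_run A (orb (N - 1)) m"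
        define r where "r = sa_run A (orb (N - 2)) m"
        have neq: "q \<noteq> r" and C: "q \<in> C1 \<and> r \<in> C1 \<or> q \<in> C2 \<and> r \<in> C2"
          using R_m by (auto simp: R_def q_def r_def)
        then have Q: "q \<in> Q" "r \<in> Q" using sub by auto
        have "sa_trans A q l \<noteq> sa_trans A r l"
          using C neq cl inj_C2[of q r] inj_b[of q r] Q by (auto simp: fix_C1)
        \<comment> \<open>This is the only pair that the concluding power of \<open>c\<close> could
          still merge.\<close>
        moreover have "{sa_trans A q l, sa_trans A r l} \<noteq> {x0, d}"
        proof (cases "l = a")
          case True
          then have "sa_trans A q l \<in> C1" "sa_trans A r l \<in> C1"
            using C a_C2 by (auto simp: fix_C1)
          then show ?thesis using x0_C1 by (auto simp: doubleton_eq_iff)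
        next
          case False
          then have [simp]: "l = b" using cl by simp
          from C show ?thesis
          proof
            assume "q \<in> C1 \<and> r \<in> C1"
            then have "\<beta> q \<in> C2" "\<beta> r \<in> C2" using b_C1 by auto
            then show ?thesis using d_C2 by (auto simp: doubleton_eq_iff)
          next
            assume *: "q \<in> C2 \<and> r \<in> C2"
            have "\<beta> s \<noteq> d" if "s \<in> C2" for s
            proof -
              from that obtain j where j: "s = orb j" "e < j" "j \<le> N" by (auto simp: C2_def)
              \<comment> \<open>The arc is short, so \<open>e\<close> is at least 6, and positions
                up to \<open>N + 1\<close> do not come round to \<open>d\<close> again.\<close>
              moreover have "Suc j < e + N" using j(3) \<open>\<not> e + 4 \<le> N\<close> N_ge by linarith
              ultimately show ?thesis using not_d[of "Suc j"] by simp
            qed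
            with * show ?thesis by (auto simp: doubleton_eq_iff)
          qed
        qed
        ultimately have "sa_run A q ([l] @ replicate i c) \<noteq> sa_run A r ([l] @ replicate i c)"
          using replicate_distinct[of "sa_trans A q l" "sa_trans A r l" c i] Q cl
          by (simp add: trans_closed)
        moreover assume "collapses A Q (m @ [l] @ replicate i c)"
        ultimately show False
          using collapsesD[of A Q "m @ [l] @ replicate i c" "orb (N - 1)" "orb (N - 2)"]
          by (simp add: q_def r_def)
      }
    qed
    then show ?thesis ..
  qed
qed

end


section \<open>Strongly connected components\<close>

definition reach :: "('p, 'a) pdfa \<Rightarrow> 'p \<Rightarrow> 'p \<Rightarrow> bool" where
  "reach B p p' \<longleftrightarrow> (\<exists>w\<in>lists (pdfa_alphabet B). pdfa_run B p w = Some p')"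

text \<open>The constraint automaton without the transitions between different strongly connected
  components.\<close>

definition intra :: "('p, 'a) pdfa \<Rightarrow> ('p, 'a) pdfa" where
  "intra B = B\<lparr>pdfa_trans := \<lambda>p c. case pdfa_trans B p c of
     None \<Rightarrow> None | Some p' \<Rightarrow> if reach B p' p then Some p' else None\<rparr>"

lemma reachI: "w \<in> lists (pdfa_alphabet B) \<Longrightarrow> pdfa_run B p w = Some p' \<Longrightarrow> reach B p p'"
  by (auto simp: reach_def)

lemma reach_refl [simp]: "reach B p p"
  by (auto intro: reachI[of "[]"])

lemma reach_trans: "reach B p q \<Longrightarrow> reach B q r \<Longrightarrow> reach B p r"
proof -
  assume "reach B p q" "reach B q r"
  then obtain u v where "u \<in> lists (pdfa_alphabet B)" "v \<in> lists (pdfa_alphabet B)"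
    "pdfa_run B p u = Some q" "pdfa_run B q v = Some r"
    by (auto simp: reach_def)
  then show ?thesis by (intro reachI[of "u @ v"]) (auto simp: pdfa_run_append)
qed

lemma reach_step: "c \<in> pdfa_alphabet B \<Longrightarrow> pdfa_trans B p c = Some p' \<Longrightarrow> reach B p p'"
  by (intro reachI[of "[c]"]) auto

lemma intra_alphabet [simp]: "pdfa_alphabet (intra B) = pdfa_alphabet B"
  by (simp add: intra_def)

lemma intra_trans:
  "pdfa_trans (intra B) p c = Some p' \<longleftrightarrow> pdfa_trans B p c = Some p' \<and> reach B p' p"
  by (auto simp: intra_def split: option.splits)

lemma intra_run: "pdfa_run (intra B) p w = Some p' \<Longrightarrow> pdfa_run B p w = Some p'"
  by (induction w arbitrary: p) (auto simp: bind_eq_Some_conv intra_trans)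

lemma intra_run_reach:
  assumes "w \<in> lists (pdfa_alphabet B)" "pdfa_run (intra B) p w = Some p'"
  shows "reach B p p'" "reach B p' p"
proof -
  show "reach B p p'" using assms intra_run reachI by metis
  show "reach B p' p"
    using assms
  proof (induction w arbitrary: p rule: list.induct)
    case (Cons c w)
    then obtain p1 where "pdfa_trans (intra B) p c = Some p1" "pdfa_run (intra B) p1 w = Some p'"
      by (auto simp: bind_eq_Some_conv)
    then show ?case using Cons reach_trans by (fastforce simp: intra_trans)
  qed simp
qed

text \<open>Every state on the run reaches \<open>p'\<close> and hence \<open>p\<close>, so a run
  that ends in the component of its start never leaves it.\<close>

lemma run_intra:
  assumes "w \<in> lists (pdfa_alphabet B)" "pdfa_run B p w = Some p'" "reach B p' p"
  shows "pdfa_run (intra B) p w = Some p'"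
  using assms
proof (induction w arbitrary: p rule: list.induct)
  case (Cons c w)
  then obtain p1 where p1: "pdfa_trans B p c = Some p1" "pdfa_run B p1 w = Some p'"
    by (auto simp: bind_eq_Some_conv)
  have c: "c \<in> pdfa_alphabet B" "w \<in> lists (pdfa_alphabet B)" using Cons.prems by auto
  have "reach B p1 p" using reachI[OF c(2) p1(2)] Cons.prems(3) reach_trans by metis
  then have "pdfa_trans (intra B) p c = Some p1" using p1(1) by (simp add: intra_trans)
  moreover have "reach B p' p1" using reach_step[OF c(1) p1(1)] Cons.prems(3) reach_trans by metis
  ultimately show ?case using Cons.IH[OF c(2) p1(2)] by simp
qed simp

lemma loops_intra: "loops (intra B) p = loops B p"
  using run_intra[of _ B p p] intra_run[of B p _ p] by (auto simp: loops_def)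

text \<open>The run is cut at its first transition that leaves a component: \<open>m\<close> is read
  inside the component of \<open>p\<close>, and \<open>l\<close> leads out of it.\<close>

lemma run_decompose:
  assumes "w \<in> lists (pdfa_alphabet B)" "pdfa_run B p w = Some f"
  shows "pdfa_run (intra B) p w = Some f \<or>
    (\<exists>m l v p1 p2. w = m @ [l] @ v \<and> pdfa_run (intra B) p m = Some p1 \<and>
      pdfa_trans B p1 l = Some p2 \<and> \<not> reach B p2 p1 \<and> pdfa_run B p2 v = Some f)"
  using assms
proof (induction w arbitrary: p rule: list.induct)
  case (Cons c w)
  then obtain p1 where p1: "pdfa_trans B p c = Some p1" "pdfa_run B p1 w = Some f"
    by (auto simp: bind_eq_Some_conv)
  show ?case
  proof (cases "reach B p1 p")
    case True
    then have step: "pdfa_trans (intra B) p c = Some p1" using p1 by (simp add: intra_trans)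
    from Cons.IH[of p1] Cons.prems p1 consider "pdfa_run (intra B) p1 w = Some f"
      | m l v p2 p3 where "w = m @ [l] @ v" "pdfa_run (intra B) p1 m = Some p2"
        "pdfa_trans B p2 l = Some p3" "\<not> reach B p3 p2" "pdfa_run B p3 v = Some f"
      by auto
    then show ?thesis
    proof cases
      case 2
      then have "c # w = (c # m) @ [l] @ v" "pdfa_run (intra B) p (c # m) = Some p2"
        using step by auto
      with 2 show ?thesis by blast
    qed (use step in simp)
  next
    case False
    then have "c # w = [] @ [c] @ w \<and> pdfa_run (intra B) p [] = Some p \<and>
        pdfa_trans B p c = Some p1 \<and> \<not> reach B p1 p \<and> pdfa_run B p1 w = Some f"
      using p1 by simp
    then show ?thesis by blast
  qed
qed simp

lemma run_in_states:
  assumes "is_pdfa B" "p \<in> pdfa_states B" "w \<in> lists (pdfa_alphabet B)" "pdfa_run B p w = Some p'"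
  shows "p' \<in> pdfa_states B"
  using assms(2-)
proof (induction w arbitrary: p rule: list.induct)
  case (Cons c w)
  then obtain p1 where p1: "pdfa_trans B p c = Some p1" "pdfa_run B p1 w = Some p'"
    by (auto simp: bind_eq_Some_conv)
  moreover have "p1 \<in> pdfa_states B"
    using assms(1) Cons.prems p1(1) by (auto simp: is_pdfa_def)
  ultimately show ?case using Cons by auto
qed simp


section \<open>Components with two states\<close>

context orbit_idem_perm
begin

text \<open>\<open>orient\<close> lists, up to exchanging \<open>x\<close> and \<open>y\<close>, a
  \<open>b\<close>-loop, a single \<open>b\<close>-edge, and a \<open>b\<close>-cycle with
  \<open>a\<close> undefined at one state. On the cycle, the target of \<open>a\<close> at
  \<open>x\<close> decides between even and odd gaps.\<close>

lemma two_state_oriented: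
  assumes "x \<noteq> y"
    and closed: "\<And>p c p'. \<lbrakk>p \<in> {x, y}; c \<in> {a, b}; pdfa_trans B p c = Some p'\<rbrakk> \<Longrightarrow> p' \<in> {x, y}"
    and xy: "\<exists>c\<in>{a, b}. pdfa_trans B x c = Some y" and yx: "\<exists>c\<in>{a, b}. pdfa_trans B y c = Some x"
    and m: "p \<in> {x, y}" "m \<in> lists {a, b}" "pdfa_run B p m = Some p'"
    and orient: "pdfa_trans B x b = Some x \<or> pdfa_trans B x b = Some y \<and> pdfa_trans B y b = None \<or>
      pdfa_trans B x b = Some y \<and> pdfa_trans B y b = Some x \<and> pdfa_trans B y a = None"
  shows "(\<exists>x'\<in>{x, y}. \<exists>m\<in>loops B x'. collapses A Q m) \<or> rigid m"
  using orient
proof (elim disjE conjE)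
  assume bx: "pdfa_trans B x b = Some x"
  then have ax: "pdfa_trans B x a = Some y" using xy \<open>x \<noteq> y\<close> by auto
  from yx obtain c where c: "c \<in> {a, b}" "pdfa_trans B y c = Some x" by auto
  have "\<exists>m\<in>loops B x. collapses A Q m"
    using bx ax c by (intro collapses_b_loop[of x c]) (auto simp: loops_def alphabet_B)
  then show ?thesis by blast
next
  assume b: "pdfa_trans B x b = Some y" "pdfa_trans B y b = None"
  moreover from this have "pdfa_trans B y a = Some x" using yx by auto
  moreover have "p' \<in> {x, y}" if "pdfa_trans B x a = Some p'" for p'
    using closed that by blast
  ultimately show ?thesis
    using collapses_or_rigid_single_b[of x y p m p'] \<open>x \<noteq> y\<close> m by blast
next
  assume b: "pdfa_trans B x b = Some y" "pdfa_trans B y b = Some x" and ay: "pdfa_trans B y a = None"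
  then have bb: "[b, b] \<in> loops B x" by (simp add: loops_def alphabet_B)
  have "pdfa_trans B x a = None \<or> pdfa_trans B x a = Some x \<or> pdfa_trans B x a = Some y"
    using closed[of x a] by (cases "pdfa_trans B x a") auto
  then show ?thesis
  proof (elim disjE)
    assume "pdfa_trans B x a = None"
    with ay have "p' \<in> {x, y} \<and> c \<noteq> a" if "p \<in> {x, y}" "c \<in> {a, b}" "pdfa_trans B p c = Some p'" for p c p'
      using closed[OF that] that by auto
    then have "rigid m" by (rule rigid_no_a[OF _ m])
    then show ?thesis ..
  next
    assume ax: "pdfa_trans B x a = Some x"
    show ?thesis
    proof (cases "odd N")
      case True
      then have "\<exists>m\<in>loops B x. collapses A Q m"
        using ax bb by (intro collapses_even_gap) (auto simp: loops_def alphabet_B)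
      then show ?thesis by blast
    next
      case False
      then show ?thesis using rigid_even_gap[OF b ax ay \<open>x \<noteq> y\<close> m] by simp
    qed
  next
    assume "pdfa_trans B x a = Some y"
    then have "\<exists>m\<in>loops B x. collapses A Q m"
      using b bb by (intro collapses_odd_gap) (auto simp: loops_def alphabet_B)
    then show ?thesis by blast
  qed
qed

text \<open>Besides the two orientations there remain a component without \<open>b\<close>, which is
  rigid, and one where both letters are defined everywhere. The latter can read \<open>w0\<close>
  itself and needs at most one more letter to close the loop.\<close>

lemma two_state:
  assumes "x \<noteq> y"
    and closed: "\<And>p c p'. \<lbrakk>p \<in> {x, y}; c \<in> {a, b}; pdfa_trans B p c = Some p'\<rbrakk> \<Longrightarrow> p' \<in> {x, y}"
    and xy: "\<exists>c\<in>{a, b}. pdfa_trans B x c = Some y" and yx: "\<exists>c\<in>{a, b}. pdfa_trans B y c = Some x"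
    and m: "p \<in> {x, y}" "m \<in> lists {a, b}" "pdfa_run B p m = Some p'"
  shows "(\<exists>x'\<in>{x, y}. \<exists>m\<in>loops B x'. collapses A Q m) \<or> rigid m"
proof -
  define oriented where "oriented x y \<longleftrightarrow>
      pdfa_trans B x b = Some x \<or> pdfa_trans B x b = Some y \<and> pdfa_trans B y b = None \<or>
      pdfa_trans B x b = Some y \<and> pdfa_trans B y b = Some x \<and> pdfa_trans B y a = None" for x y
  have b: "pdfa_trans B x b \<in> {None, Some x, Some y}" "pdfa_trans B y b \<in> {None, Some x, Some y}"
    using closed[of x b] closed[of y b] by (cases "pdfa_trans B x b"; cases "pdfa_trans B y b"; auto)+
  consider "oriented x y" | "oriented y x" | "pdfa_trans B x b = None" "pdfa_trans B y b = None"
    | "\<And>p c. p \<in> {x, y} \<Longrightarrow> c \<in> {a, b} \<Longrightarrow> pdfa_trans B p c \<noteq> None"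
    using b unfolding oriented_def by fastforce
  then show ?thesis
  proof cases
    case 1
    then show ?thesis
      using two_state_oriented[OF assms] by (simp add: oriented_def)
  next
    case 2
    have "(\<exists>x'\<in>{y, x}. \<exists>m\<in>loops B x'. collapses A Q m) \<or> rigid m"
      using 2 by (intro two_state_oriented[of y x p m p']) (use assms in \<open>auto simp: oriented_def\<close>)
    then show ?thesis by (simp add: insert_commute)
  next
    case 3
    then have "p' \<in> {x, y} \<and> c \<noteq> b" if "p \<in> {x, y}" "c \<in> {a, b}" "pdfa_trans B p c = Some p'" for p c p'
      using closed[OF that] that by auto
    then have "rigid m" by (rule rigid_no_b[OF _ m])
    then show ?thesis ..
  next
    case 4
    have total: "\<exists>p'\<in>{x, y}. pdfa_run B p w = Some p'" if "w \<in> lists {a, b}" "p \<in> {x, y}" for p w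
      using that
    proof (induction w arbitrary: p rule: list.induct)
      case (Cons c w)
      then obtain p1 where "pdfa_trans B p c = Some p1" "p1 \<in> {x, y}"
        using 4[of p c] closed[of p c] by auto
      then show ?case using Cons by auto
    qed simp
    obtain p1 where p1: "p1 \<in> {x, y}" "pdfa_run B x w0 = Some p1"
      using total[OF w0(1)] by blast
    obtain u where u: "u \<in> lists {a, b}" "pdfa_run B p1 u = Some x"
    proof (cases "p1 = x")
      case True
      then show ?thesis using that[of "[]"] by simp
    next
      case False
      then have "p1 = y" using p1 by simp
      moreover obtain c where "c \<in> {a, b}" "pdfa_trans B y c = Some x" using yx by auto
      ultimately show ?thesis using that[of "[c]"] by simp
    qed
    have "w0 @ u \<in> loops B x"
      using w0(1) u p1(2) by (simp add: loops_def alphabet_B pdfa_run_append)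
    then show ?thesis using collapses_append[OF w0(2)] by blast
  qed
qed

text \<open>Either both letters loop at \<open>p\<close>, so that \<open>w0\<close> is a loop, or
  one letter is blocked and the run uses only the other.\<close>

lemma single_state:
  assumes closed: "\<And>c p'. \<lbrakk>c \<in> {a, b}; pdfa_trans B p c = Some p'\<rbrakk> \<Longrightarrow> p' = p"
    and m: "m \<in> lists {a, b}" "pdfa_run B p m = Some p'"
  shows "(\<exists>m\<in>loops B p. collapses A Q m) \<or> (\<exists>c\<in>{a, b}. \<exists>i. m = replicate i c)"
proof (cases "\<forall>c\<in>{a, b}. pdfa_trans B p c = Some p")
  case True
  have "pdfa_run B p w = Some p" if "w \<in> lists {a, b}" for w
    using that by (induction w) (use True in auto)
  then have "w0 \<in> loops B p" using w0(1) by (simp add: loops_def alphabet_B)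
  then show ?thesis using w0(2) by blast
next
  case False
  then obtain c where c: "c \<in> {a, b}" "pdfa_trans B p c \<noteq> Some p" by blast
  then obtain c' where c': "c' \<in> {a, b}" "{a, b} = {c, c'}" by blast
  have "set m \<subseteq> {c'}"
    using m
  proof (induction m rule: list.induct)
    case (Cons l m)
    then obtain p1 where p1: "pdfa_trans B p l = Some p1" "pdfa_run B p1 m = Some p'"
      by (auto simp: bind_eq_Some_conv)
    then have "p1 = p" using closed[of l p1] Cons.prems by auto
    with p1 c have "l \<noteq> c" by auto
    then have "l = c'" using Cons.prems c'(2) by auto
    then show ?case using Cons p1 \<open>p1 = p\<close> by auto
  qed simp
  then have "m = replicate (length m) c'"
    by (intro replicate_eqI) auto
  then show ?thesis using c' by blast
qed

lemma three_drops_not_collapses: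
  assumes "drops 3 v"
  shows "\<not> collapses A Q v"
  using drops_not_collapses[OF assms, of Q] card_Q by simp

end

text \<open>The first transition of the run that leaves \<open>x\<close> can only lead to
  \<open>y\<close>.\<close>

lemma trans_on_cycle:
  assumes closed: "\<And>p c p'. \<lbrakk>p \<in> {x, y}; c \<in> S; pdfa_trans B p c = Some p'\<rbrakk> \<Longrightarrow> p' \<in> {x, y}"
    and "x \<noteq> y" "w \<in> lists S" "pdfa_run B x w = Some y"
  shows "\<exists>c\<in>S. pdfa_trans B x c = Some y"
  using assms(3,4)
proof (induction w rule: list.induct)
  case (Cons c w)
  then obtain p1 where p1: "pdfa_trans B x c = Some p1" "pdfa_run B p1 w = Some y"
    by (auto simp: bind_eq_Some_conv)
  then have "p1 \<in> {x, y}" using closed[of x c p1] Cons.prems by auto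
  then show ?case using p1 Cons by auto
qed (use \<open>x \<noteq> y\<close> in simp)


section \<open>Letters of a synchronizing automaton\<close>

lemma permutes_statesD:
  assumes "is_semi_automaton A" "permutes_states A c"
  shows "inj_on (\<lambda>q. sa_trans A q c) (sa_states A)"
proof -
  have "(\<lambda>q. sa_trans A q c) ` sa_states A = sa_states A"
    using assms(2) by (simp add: permutes_states_def sa_image_def)
  moreover have "finite (sa_states A)" using assms(1) by (simp add: is_semi_automaton_def)
  ultimately show ?thesis by (intro eq_card_imp_inj_on) auto
qed

text \<open>\<open>x0\<close> is the one state missing from the image; idempotence fixes every state
  in the image.\<close>

lemma simple_idempotentD:
  assumes "is_semi_automaton A" "c \<in> sa_alphabet A" "simple_idempotent A c"
  obtains x0 where "x0 \<in> sa_states A" "sa_trans A x0 c \<noteq> x0"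
    "\<And>q. q \<in> sa_states A \<Longrightarrow> q \<noteq> x0 \<Longrightarrow> sa_trans A q c = q"
proof -
  let ?I = "(\<lambda>q. sa_trans A q c) ` sa_states A"
  have fin: "finite (sa_states A)" and sub: "?I \<subseteq> sa_states A"
    using assms(1,2) by (auto simp: is_semi_automaton_def)
  have "card ?I + 1 = card (sa_states A)"
    and idem: "\<And>q. q \<in> sa_states A \<Longrightarrow> sa_trans A (sa_trans A q c) c = sa_trans A q c"
    using assms(3) by (auto simp: simple_idempotent_def sa_image_def)
  moreover have "card (sa_states A - ?I) = card (sa_states A) - card ?I"
    using fin sub by (simp add: card_Diff_subset finite_subset)
  ultimately have "card (sa_states A - ?I) = 1" by simp
  then obtain x0 where x0: "sa_states A - ?I = {x0}" by (auto simp: card_1_singleton_iff)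
  show ?thesis
  proof (rule that)
    show "x0 \<in> sa_states A" using x0 by auto
    then show "sa_trans A x0 c \<noteq> x0" using x0 by (metis DiffD2 imageI insertI1)
    fix q assume "q \<in> sa_states A" "q \<noteq> x0"
    then have "q \<in> ?I" using x0 by auto
    then show "sa_trans A q c = q" using idem by auto
  qed
qed

text \<open>If all letters were injective, nothing would merge; if none were, at most two states
  would move and the others would stay apart. So there is one letter of each kind, and these two
  exhaust the alphabet.\<close>

lemma sync_letters:
  assumes A: "is_semi_automaton A" "has_simple_idempotents A" and Sig: "card (sa_alphabet A) \<le> 2"
    and w: "w \<in> lists (sa_alphabet A)" "collapses A (sa_states A) w" and card: "10 \<le> card (sa_states A)"
  obtains a b x0 d where "sync_idem_perm A a b x0 d w"
proof -
  let ?Q = "sa_states A"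
  define inj where "inj c \<longleftrightarrow> inj_on (\<lambda>q. sa_trans A q c) ?Q" for c
  have fin: "finite ?Q" "finite (sa_alphabet A)" using A(1) by (auto simp: is_semi_automaton_def)
  have closed: "sa_trans A q c \<in> ?Q" if "q \<in> ?Q" "c \<in> sa_alphabet A" for q c
    using A(1) that by (auto simp: is_semi_automaton_def)
  have idem: "\<exists>x0. x0 \<in> ?Q \<and> sa_trans A x0 c \<noteq> x0 \<and> (\<forall>q\<in>?Q. q \<noteq> x0 \<longrightarrow> sa_trans A q c = q)"
    if "c \<in> sa_alphabet A" "\<not> inj c" for c
  proof -
    have "simple_idempotent A c"
      using A(2) that permutes_statesD[OF A(1)] by (auto simp: has_simple_idempotents_def inj_def)
    then show ?thesis by (meson simple_idempotentD[OF A(1) that(1)])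
  qed
  have no_fixed_pair: False if "F \<subseteq> ?Q" "2 \<le> card F" "\<And>c q. c \<in> sa_alphabet A \<Longrightarrow> q \<in> F \<Longrightarrow> sa_trans A q c = q" for F
  proof -
    have F: "sa_run A q v = q" if "q \<in> F" "v \<in> lists (sa_alphabet A)" for q v
      using that(2) by (induction v) (use that(1) \<open>\<And>c q. c \<in> sa_alphabet A \<Longrightarrow> q \<in> F \<Longrightarrow> sa_trans A q c = q\<close> in auto)
    have "\<not> card F \<le> Suc 0" using \<open>2 \<le> card F\<close> by simp
    then obtain q r where qr: "q \<in> F" "r \<in> F" "q \<noteq> r"
      using card_le_Suc0_iff_eq[of F] finite_subset[OF \<open>F \<subseteq> ?Q\<close> fin(1)] by blast
    then have "sa_run A q w = sa_run A r w"
      using \<open>F \<subseteq> ?Q\<close> by (intro collapsesD[OF w(2)]) auto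
    then show False
      using F[OF qr(1) w(1)] F[OF qr(2) w(1)] qr(3) by simp
  qed
  have "\<exists>a\<in>sa_alphabet A. \<not> inj a"
  proof (rule ccontr)
    assume *: "\<not> ?thesis"
    have "sa_run A q v \<noteq> sa_run A r v" if "v \<in> lists (sa_alphabet A)" "q \<in> ?Q" "r \<in> ?Q" "q \<noteq> r" for q r v
      using that
    proof (induction v arbitrary: q r rule: list.induct)
      case (Cons c v)
      then have "sa_trans A q c \<noteq> sa_trans A r c"
        using * by (auto simp: inj_def inj_on_def)
      then show ?case
        using Cons.IH[of "sa_trans A q c" "sa_trans A r c"] Cons.prems closed by auto
    qed simp
    moreover obtain q r where "q \<in> ?Q" "r \<in> ?Q" "q \<noteq> r"
      using card_le_Suc0_iff_eq[OF fin(1)] card by fastforce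
    ultimately show False using collapsesD[OF w(2)] w(1) by metis
  qed
  then obtain a where a: "a \<in> sa_alphabet A" "\<not> inj a" by blast
  have "\<exists>b\<in>sa_alphabet A. inj b"
  proof (rule ccontr)
    assume "\<not> ?thesis"
    with idem obtain f where f: "\<And>c. c \<in> sa_alphabet A \<Longrightarrow> f c \<in> ?Q \<and> (\<forall>q\<in>?Q. q \<noteq> f c \<longrightarrow> sa_trans A q c = q)"
      by metis
    have "card (f ` sa_alphabet A) \<le> 2"
      using card_image_le[OF fin(2), of f] Sig by simp
    then have "2 \<le> card (?Q - f ` sa_alphabet A)"
      using diff_card_le_card_Diff[of "f ` sa_alphabet A" ?Q] fin card by simp
    then show False
      by (rule no_fixed_pair[rotated]) (use f in auto)
  qed
  then obtain b where b: "b \<in> sa_alphabet A" "inj b" by blast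
  have "a \<noteq> b" using a b by auto
  then have "sa_alphabet A = {a, b}"
    using a b Sig fin(2) card_seteq[of "sa_alphabet A" "{a, b}"] by simp
  moreover obtain x0 where "x0 \<in> ?Q" "sa_trans A x0 a \<noteq> x0" "\<And>q. q \<in> ?Q \<Longrightarrow> q \<noteq> x0 \<Longrightarrow> sa_trans A q a = q"
    using idem[OF a] by blast
  ultimately have "sync_idem_perm A a b x0 (sa_trans A x0 a) w"
    using A(1) a b w card closed by unfold_locales (auto simp: inj_def)
  then show ?thesis by (rule that)
qed


section \<open>Locating a synchronizing loop\<close>

text \<open>If \<open>f\<close> does not reach \<open>s\<close>, the run visits at least two
  components, whose sizes add up to at most 3. Without a collapsing loop, single-state components
  contribute powers of a letter and two-state ones rigid words; together with the connecting letters
  these cannot collapse ten states.\<close>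

lemma sync_word_yields_loop:
  assumes B: "is_pdfa B" "card (pdfa_states B) \<le> 3" "card (pdfa_alphabet B) \<le> 2"
    and A: "is_semi_automaton A" "has_simple_idempotents A" "sa_alphabet A = pdfa_alphabet B"
    and card: "10 \<le> card (sa_states A)"
    and w: "w \<in> lists (pdfa_alphabet B)" "collapses A (sa_states A) w"
    and run: "pdfa_run B s w = Some f" and s: "s \<in> pdfa_states B"
  shows "\<exists>x\<in>pdfa_states B. reach B s x \<and> reach B x f \<and> (\<exists>m\<in>loops B x. collapses A (sa_states A) m)"
    (is ?goal)
proof (cases "reach B f s")
  case True
  then obtain v where v: "v \<in> lists (pdfa_alphabet B)" "pdfa_run B f v = Some s"
    by (auto simp: reach_def)
  then have "w @ v \<in> loops B s"
    using w(1) run by (simp add: loops_def pdfa_run_append)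
  then show ?thesis
    using s reachI[OF w(1) run] collapses_append[OF w(2)] by (metis reach_refl)
next
  case False
  let ?P = "pdfa_states B" and ?Q = "sa_states A"
  have fin: "finite ?P" using B(1) by (simp add: is_pdfa_def)
  obtain a b x0 d where "sync_idem_perm A a b x0 d w"
    by (rule sync_letters[of A w]) (use A B(3) card w in auto)
  then interpret sync_idem_perm A a b x0 d w .
  obtain N where N: "9 \<le> N" "\<And>q. q \<in> ?Q \<Longrightarrow> (\<beta> ^^ N) q = q"
    "\<And>i j. orb i = orb j \<longleftrightarrow> i mod N = j mod N"
    "?Q = range orb \<or> d \<notin> range orb \<and> \<beta> d = d \<and> ?Q = insert d (range orb)"
    using orbit_structure by blast
  interpret orbit_idem_perm A a b x0 d w N "intra B"
  proof unfold_locales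
    show "pdfa_alphabet (intra B) = {a, b}" using alphabet A(3) by simp
  qed (fact N)+
  have ab: "pdfa_alphabet B = {a, b}" using alphabet A(3) by simp
  define cls where "cls p = {q \<in> ?P. reach B p q \<and> reach B q p}" for p
  have goalI: ?goal if "x \<in> ?P" "reach B s x" "reach B x f" "\<exists>m\<in>loops (intra B) x. collapses A ?Q m" for x
    using that by (auto simp: loops_intra)
  have intra_cls: "p' \<in> cls p" if "p \<in> ?P" "c \<in> {a, b}" "pdfa_trans (intra B) p c = Some p'" for p c p'
  proof -
    have trans: "pdfa_trans B p c = Some p'" "reach B p' p" "c \<in> pdfa_alphabet B"
      using that ab by (simp_all add: intra_trans)
    then have "p' \<in> ?P" using that(1) B(1) unfolding is_pdfa_def by blast
    then show ?thesis using trans reach_step[OF trans(3,1)] by (simp add: cls_def)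
  qed
  have single: "?goal \<or> (\<exists>c\<in>{a, b}. \<exists>i. m = replicate i c)"
    if "p \<in> ?P" "cls p = {p}" "reach B s p" "reach B p f" "m \<in> lists {a, b}" "pdfa_run (intra B) p m = Some p'" for p m p'
  proof -
    have "(\<exists>m\<in>loops (intra B) p. collapses A ?Q m) \<or> (\<exists>c\<in>{a, b}. \<exists>i. m = replicate i c)"
      using intra_cls[of p] that by (intro single_state[of p m p']) auto
    then show ?thesis using goalI[of p] that by blast
  qed
  have double: "?goal \<or> rigid m"
    if p: "p \<in> ?P" "card (cls p) = 2" "reach B s p" "reach B p f" "m \<in> lists {a, b}" "pdfa_run (intra B) p m = Some p'" for p m p'
  proof -
    have "p \<in> cls p" using p by (simp add: cls_def)
    then obtain y where y: "cls p = {p, y}" "p \<noteq> y"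
      using p(2) by (auto simp: card_2_iff doubleton_eq_iff)
    then have yP: "y \<in> ?P" "reach B p y" "reach B y p" by (auto simp: cls_def)
    have closed: "r' \<in> {p, y}" if "r \<in> {p, y}" "c \<in> {a, b}" "pdfa_trans (intra B) r c = Some r'" for r c r'
    proof -
      have "r' \<in> cls r" using intra_cls[of r c r'] that p(1) yP(1) by auto
      then have "r' \<in> cls p" using that(1) yP reach_trans[of B] unfolding cls_def by blast
      then show ?thesis using y by simp
    qed
    have path: "\<exists>v\<in>lists {a, b}. pdfa_run (intra B) r v = Some r'" if "reach B r r'" "reach B r' r" for r r'
      using that run_intra ab unfolding reach_def[of B r r'] by metis
    have closed': "r' \<in> {y, p}" if "r \<in> {y, p}" "c \<in> {a, b}" "pdfa_trans (intra B) r c = Some r'" for r c r'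
      using closed[OF _ that(2,3)] that(1) by auto
    obtain u v where uv: "u \<in> lists {a, b}" "pdfa_run (intra B) p u = Some y"
        "v \<in> lists {a, b}" "pdfa_run (intra B) y v = Some p"
      using path[OF yP(2,3)] path[OF yP(3,2)] by blast
    have "\<exists>c\<in>{a, b}. pdfa_trans (intra B) p c = Some y"
      by (rule trans_on_cycle[OF closed y(2) uv(1,2)])
    moreover have "\<exists>c\<in>{a, b}. pdfa_trans (intra B) y c = Some p"
      by (rule trans_on_cycle[OF closed' y(2)[symmetric] uv(3,4)])
    ultimately have "(\<exists>x'\<in>{p, y}. \<exists>m\<in>loops (intra B) x'. collapses A ?Q m) \<or> rigid m"
      using closed y(2) p(5,6) by (intro two_state[of p y p m p']) auto
    moreover have "reach B s y" "reach B y f"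
      using yP p(3,4) reach_trans[of B] by blast+
    ultimately show ?thesis using goalI[of p] goalI[of y] p yP by blast
  qed
  have cls_self: "p \<in> cls p" if "p \<in> ?P" for p using that by (simp add: cls_def)
  have cls_sub: "cls p \<subseteq> ?P" for p by (auto simp: cls_def)
  have fin_cls: "finite (cls p)" for p using fin finite_subset[OF cls_sub] by blast
  have cls_pos: "1 \<le> card (cls p)" if "p \<in> ?P" for p
    using cls_self[OF that] fin_cls[of p] by (auto simp: Suc_le_eq card_gt_0_iff)
  have cls_1: "cls p = {p}" if "p \<in> ?P" "card (cls p) = 1" for p
    using that cls_self[of p] by (auto simp: card_1_singleton_iff)
  have disjoint: "cls p \<inter> cls q = {}" if "\<not> reach B q p" for p q
    using that reach_trans[of B] unfolding cls_def by blast
  from run_decompose[OF w(1) run] False obtain m l v p1 p2 where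
    dec: "w = m @ [l] @ v" "pdfa_run (intra B) s m = Some p1" "pdfa_trans B p1 l = Some p2"
      "\<not> reach B p2 p1" "pdfa_run B p2 v = Some f"
    using intra_run_reach(2)[OF w(1)] by blast
  have lists: "m \<in> lists {a, b}" "l \<in> {a, b}" "v \<in> lists {a, b}" using w(1) dec(1) ab by auto
  have p1: "reach B s p1" "reach B p1 s" using intra_run_reach[of m B s p1] dec(2) lists ab by auto
  have p12: "reach B p1 p2" using reach_step[of l B] dec(3) lists ab by auto
  have p2f: "reach B p2 f" using reachI[of v B] dec(5) lists ab by auto
  have sp2: "reach B s p2" and p2s: "\<not> reach B p2 s" and sf: "reach B s f"
    using p1 p12 p2f dec(4) reach_trans[of B] by blast+
  have p2P: "p2 \<in> ?P"
    using run_in_states[OF B(1) s, of "m @ [l]" p2] intra_run[OF dec(2)] dec(3) lists ab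
    by (simp add: pdfa_run_append)
  have le3: "card X \<le> 3" if "X \<subseteq> ?P" for X
    using card_mono[OF fin that] B(2) by simp
  have "cls s \<inter> cls p2 = {}" using disjoint[OF p2s] .
  then have sum2: "card (cls s) + card (cls p2) \<le> 3"
    using le3[of "cls s \<union> cls p2"] cls_sub by (simp add: card_Un_disjoint fin_cls)
  show ?thesis
  proof (cases "pdfa_run (intra B) p2 v = Some f")
    case True
    consider "card (cls s) = 1" "card (cls p2) = 1" | "card (cls s) = 1" "card (cls p2) = 2"
      | "card (cls s) = 2" "card (cls p2) = 1"
      using sum2 cls_pos[OF s] cls_pos[OF p2P] by linarith
    then show ?thesis
    proof cases
      case 1
      show ?thesis
      proof (rule ccontr)
        assume "\<not> ?goal"
        then obtain c i c' i' where eq: "m = replicate i c" "c \<in> {a, b}" "v = replicate i' c'" "c' \<in> {a, b}"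
          using single[OF s cls_1[OF s 1(1)] reach_refl sf lists(1) dec(2)]
            single[OF p2P cls_1[OF p2P 1(2)] sp2 p2f lists(3) True] by blast
        \<comment> \<open>Two powers and one connecting letter.\<close>
        have "drops (1 + (1 + 1)) (m @ [l] @ v)"
          unfolding eq using eq lists by (intro drops_append drops_power drops_single) auto
        then have "drops 3 w" unfolding dec(1) by (simp add: eval_nat_numeral)
        then show False using three_drops_not_collapses w(2) by blast
      qed
    next
      case 2
      show ?thesis
      proof (rule ccontr)
        assume "\<not> ?goal"
        then obtain c i where "m = replicate i c" "c \<in> {a, b}" "rigid v"
          using single[OF s cls_1[OF s 2(1)] reach_refl sf lists(1) dec(2)]
            double[OF p2P 2(2) sp2 p2f lists(3) True] by blast
        then show False using w(2) dec(1) lists(2) by (auto simp: rigid_def)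
      qed
    next
      case 3
      show ?thesis
      proof (rule ccontr)
        assume "\<not> ?goal"
        then obtain c i where "v = replicate i c" "c \<in> {a, b}" "rigid m"
          using single[OF p2P cls_1[OF p2P 3(2)] sp2 p2f lists(3) True]
            double[OF s 3(1) reach_refl sf lists(1) dec(2)] by blast
        then show False using w(2) dec(1) lists(2) by (auto simp: rigid_def)
      qed
    qed
  next
    case False
    then obtain m' l' v' p3 p4 where
      dec': "v = m' @ [l'] @ v'" "pdfa_run (intra B) p2 m' = Some p3" "pdfa_trans B p3 l' = Some p4"
        "\<not> reach B p4 p3" "pdfa_run B p4 v' = Some f"
      using run_decompose[of v B p2 f] dec(5) lists(3) ab by blast
    have lists': "m' \<in> lists {a, b}" "l' \<in> {a, b}" "v' \<in> lists {a, b}" using lists(3) dec'(1) by auto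
    have p3: "reach B p2 p3" "reach B p3 p2" using intra_run_reach[of m' B p2 p3] dec'(2) lists' ab by auto
    have p34: "reach B p3 p4" using reach_step[of l' B] dec'(3) lists' ab by auto
    have p4f: "reach B p4 f" using reachI[of v' B] dec'(5) lists' ab by auto
    have sp4: "reach B s p4" and p4s: "\<not> reach B p4 s" and p4p2: "\<not> reach B p4 p2"
      using p3 p34 p4f sp2 p2s dec'(4) reach_trans[of B] by blast+
    have p4P: "p4 \<in> ?P"
      using run_in_states[OF B(1) p2P, of "m' @ [l']" p4] intra_run[OF dec'(2)] dec'(3) lists' ab
      by (simp add: pdfa_run_append)
    have disj: "cls s \<inter> cls p2 = {}" "(cls s \<union> cls p2) \<inter> cls p4 = {}"
      using disjoint[OF p2s] disjoint[OF p4s] disjoint[OF p4p2] by auto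
    have "card (cls s \<union> cls p2 \<union> cls p4) \<le> 3"
      using cls_sub by (intro le3) auto
    then have "card (cls s) + card (cls p2) + card (cls p4) \<le> 3"
      using disj by (simp add: card_Un_disjoint fin_cls)
    then have ones: "card (cls s) = 1" "card (cls p2) = 1" "card (cls p4) = 1"
      using cls_pos[OF s] cls_pos[OF p2P] cls_pos[OF p4P] by linarith+
    have all: "?P = cls s \<union> cls p2 \<union> cls p4"
    proof (rule sym, rule card_seteq[OF fin])
      show "card ?P \<le> card (cls s \<union> cls p2 \<union> cls p4)"
        using disj ones B(2) by (simp add: card_Un_disjoint fin_cls)
    qed (use cls_sub in auto)
    \<comment> \<open>Three single-state components exhaust the states of \<open>B\<close>, so
      leaving the third would mean a return to an earlier one.\<close>
    have run4: "pdfa_run (intra B) p4 v' = Some f"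
    proof (rule ccontr)
      assume "pdfa_run (intra B) p4 v' \<noteq> Some f"
      then obtain m'' l'' v'' p5 p6 where
        dec'': "v' = m'' @ [l''] @ v''" "pdfa_run (intra B) p4 m'' = Some p5" "pdfa_trans B p5 l'' = Some p6"
          "\<not> reach B p6 p5" "pdfa_run B p6 v'' = Some f"
        using run_decompose[of v' B p4 f] dec'(5) lists'(3) ab by blast
      have lists'': "m'' \<in> lists {a, b}" "l'' \<in> {a, b}" using lists'(3) dec''(1) by auto
      have p5: "reach B p4 p5" "reach B p5 p4" using intra_run_reach[of m'' B p4 p5] dec''(2) lists'' ab by auto
      have p56: "reach B p5 p6" using reach_step[of l'' B] dec''(3) lists'' ab by auto
      have "p6 \<in> ?P"
        using run_in_states[OF B(1) p4P, of "m'' @ [l'']" p6] intra_run[OF dec''(2)] dec''(3) lists'' ab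
        by (simp add: pdfa_run_append)
      then have "reach B p6 s \<or> reach B p6 p2 \<or> reach B p6 p4"
        unfolding all by (auto simp: cls_def)
      moreover have "reach B p4 p6" "\<not> reach B p6 p4" using p5 p56 dec''(4) reach_trans[of B] by blast+
      ultimately show False using p4s p4p2 reach_trans[of B] by blast
    qed
    show ?thesis
    proof (rule ccontr)
      assume "\<not> ?goal"
      then obtain c i c' i' c'' i'' where eq: "m = replicate i c" "c \<in> {a, b}"
          "m' = replicate i' c'" "c' \<in> {a, b}" "v' = replicate i'' c''" "c'' \<in> {a, b}"
        using single[OF s cls_1[OF s ones(1)] reach_refl sf lists(1) dec(2)]
          single[OF p2P cls_1[OF p2P ones(2)] sp2 p2f lists'(1) dec'(2)]
          single[OF p4P cls_1[OF p4P ones(3)] sp4 p4f lists'(3) run4] by blast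
      \<comment> \<open>Three powers and two connecting letters.\<close>
      have "drops (1 + (1 + (1 + (1 + 1)))) (m @ [l] @ m' @ [l'] @ v')"
        unfolding eq using eq lists lists' by (intro drops_append drops_power drops_single) auto
      then have "drops 5 w" unfolding dec(1) dec'(1) by (simp add: eval_nat_numeral)
      then show False
        using drops_not_collapses[of 5 w ?Q] w(2) card by simp
    qed
  qed
qed


section \<open>Cost of structured programs\<close>

declare One_nat_def [simp del]

text \<open>A total-correctness triple with postcondition \<open>P\<close>. The time is only bounded
  from above, so that branches of different cost can share one bound.\<close>

definition runs :: "ram_com \<Rightarrow> ram_state \<Rightarrow> nat \<Rightarrow> (ram_state \<Rightarrow> bool) \<Rightarrow> bool" where
  "runs c s T P \<longleftrightarrow> (\<exists>t s'. ram_exec c s t s' \<and> t \<le> T \<and> P s')"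

lemma runs_mono: "runs c s T P \<Longrightarrow> T \<le> T' \<Longrightarrow> (\<And>s'. P s' \<Longrightarrow> P' s') \<Longrightarrow> runs c s T' P'"
  unfolding runs_def by (meson order_trans)

lemma runs_Skip: "P s \<Longrightarrow> runs RSkip s 1 P"
  unfolding runs_def using ram_exec.Skip by blast

lemma runs_Const: "P (r(x := k), m) \<Longrightarrow> runs (RConst x k) (r, m) 1 P"
  unfolding runs_def using ram_exec.Const by blast

lemma runs_Add: "P (r(x := r y + r z), m) \<Longrightarrow> runs (RAdd x y z) (r, m) 1 P"
  unfolding runs_def using ram_exec.Add by blast

lemma runs_Sub: "P (r(x := r y - r z), m) \<Longrightarrow> runs (RSub x y z) (r, m) 1 P"
  unfolding runs_def using ram_exec.Sub by blast

lemma runs_Load: "P (r(x := m (r y)), m) \<Longrightarrow> runs (RLoad x y) (r, m) 1 P"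
  unfolding runs_def using ram_exec.Load by blast

lemma runs_Store: "P (r, m(r x := r y)) \<Longrightarrow> runs (RStore x y) (r, m) 1 P"
  unfolding runs_def using ram_exec.Store by blast

lemma runs_Seq:
  assumes "runs c1 s T1 (\<lambda>s'. runs c2 s' T2 P)"
  shows "runs (RSeq c1 c2) s (T1 + T2) P"
  using assms unfolding runs_def by (meson ram_exec.Seq add_mono)

lemma runs_If:
  assumes "r x \<noteq> 0 \<Longrightarrow> runs c1 (r, m) T P" and "r x = 0 \<Longrightarrow> runs c2 (r, m) T P"
  shows "runs (RIf x c1 c2) (r, m) (T + 1) P"
proof (cases "r x = 0")
  case True
  with assms(2) obtain t s' where "ram_exec c2 (r, m) t s'" "t \<le> T" "P s'"
    by (auto simp: runs_def)
  with True show ?thesis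
    unfolding runs_def by (intro exI[of _ "t + 1"] exI[of _ s']) (auto intro: ram_exec.IfFalse[of "(r, m)"])
next
  case False
  with assms(1) obtain t s' where "ram_exec c1 (r, m) t s'" "t \<le> T" "P s'"
    by (auto simp: runs_def)
  with False show ?thesis
    unfolding runs_def by (intro exI[of _ "t + 1"] exI[of _ s']) (auto intro: ram_exec.IfTrue)
qed

text \<open>\<open>J\<close> is indexed by the number of remaining rounds. A round costs two units
  besides its body, for the test and the decrement; the decrement comes first and relies on register
  2 holding 1.\<close>

lemma runs_while_count:
  assumes step: "\<And>i r m. \<lbrakk>i < N; r k = Suc i; J (Suc i) (r, m)\<rbrakk> \<Longrightarrow>
      r 2 = 1 \<and> runs c (r(k := i), m) T (\<lambda>s'. fst s' k = i \<and> J i s')"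
    and "fst s k = N" "J N s"
  shows "runs (RWhile k (RSeq (RSub k k 2) c)) s (N * (T + 2) + 1) (\<lambda>s'. fst s' k = 0 \<and> J 0 s')"
  using assms
proof (induction N arbitrary: s)
  case 0
  then show ?case
    unfolding runs_def by (metis WhileFalse le_refl mult_0 add_0)
next
  case (Suc N)
  obtain r m where s: "s = (r, m)" by fastforce
  from Suc.prems have "r 2 = 1 \<and> runs c (r(k := N), m) T (\<lambda>s'. fst s' k = N \<and> J N s')"
    by (intro Suc.prems(1)) (simp_all add: s)
  then obtain t s' where t: "r 2 = 1" "ram_exec c (r(k := N), m) t s'" "t \<le> T" "fst s' k = N" "J N s'"
    by (auto simp: runs_def)
  have "runs (RWhile k (RSeq (RSub k k 2) c)) s' (N * (T + 2) + 1) (\<lambda>s'. fst s' k = 0 \<and> J 0 s')"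
    by (intro Suc.IH Suc.prems(1)) (simp_all add: t)
  then obtain t' s'' where t': "ram_exec (RWhile k (RSeq (RSub k k 2) c)) s' t' s''"
      "t' \<le> N * (T + 2) + 1" "fst s'' k = 0" "J 0 s''"
    by (auto simp: runs_def)
  have "ram_exec (RSub k k 2) s 1 (r(k := N), m)"
    using ram_exec.Sub[of k k 2 r m] t(1) Suc.prems(2) by (simp add: s)
  then have "ram_exec (RSeq (RSub k k 2) c) s (1 + t) s'"
    using t(2) by (rule ram_exec.Seq)
  then have "ram_exec (RWhile k (RSeq (RSub k k 2) c)) s (1 + t + t' + 1) s''"
    using t'(1) Suc.prems(2) by (intro ram_exec.WhileTrue) auto
  moreover have "1 + t + t' + 1 \<le> Suc N * (T + 2) + 1"
    using t(3) t'(2) by simp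
  ultimately show ?case
    unfolding runs_def using t' by blast
qed

text \<open>By convention register 2 holds 1 and register 3 holds 0. The loop counts down, and its counter
  must not be modified by the body.\<close>

definition FOR :: "nat \<Rightarrow> nat \<Rightarrow> ram_com \<Rightarrow> ram_com" where
  "FOR k x c = RSeq (RAdd k x 3) (RWhile k (RSeq (RSub k k 2) c))"

lemma runs_FOR:
  assumes "r 3 = 0" "r x = N" "J N (r(k := N), m)"
    and "\<And>i r m. \<lbrakk>i < N; r k = Suc i; J (Suc i) (r, m)\<rbrakk> \<Longrightarrow>
      r 2 = 1 \<and> runs c (r(k := i), m) T (\<lambda>s'. fst s' k = i \<and> J i s')"
    and "\<And>s'. fst s' k = 0 \<Longrightarrow> J 0 s' \<Longrightarrow> P s'"
  shows "runs (FOR k x c) (r, m) (N * (T + 2) + 2) P"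
proof -
  have "runs (RWhile k (RSeq (RSub k k 2) c)) (r(k := N), m) (N * (T + 2) + 1)
      (\<lambda>s'. fst s' k = 0 \<and> J 0 s')"
    using assms(3,4) by (intro runs_while_count) auto
  then have "runs (RWhile k (RSeq (RSub k k 2) c)) (r(k := N), m) (N * (T + 2) + 1) P"
    by (rule runs_mono) (use assms(5) in auto)
  then have "runs (FOR k x c) (r, m) (1 + (N * (T + 2) + 1)) P"
    unfolding FOR_def using assms(1,2) by (intro runs_Seq runs_Add) simp
  then show ?thesis by (rule runs_mono) auto
qed

fun seqs :: "ram_com list \<Rightarrow> ram_com" where
  "seqs [] = RSkip"
| "seqs (c # cs) = RSeq c (seqs cs)"

lemma runs_seqs_Nil: "P s \<Longrightarrow> runs (seqs []) s 1 P"
  by (simp add: runs_Skip)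

lemma runs_seqs_Cons: "runs c s T1 (\<lambda>s'. runs (seqs cs) s' T2 P) \<Longrightarrow> runs (seqs (c # cs)) s (T1 + T2) P"
  by (simp add: runs_Seq)

text \<open>Repeated addition at a cost linear in the value of register \<open>x\<close>. This is
  affordable because all first factors used below are polynomially bounded in the number of
  states.\<close>

definition MUL :: "nat \<Rightarrow> nat \<Rightarrow> nat \<Rightarrow> nat \<Rightarrow> ram_com" where
  "MUL k z x y = RSeq (RConst z 0) (FOR k x (RAdd z z y))"

lemma runs_MUL:
  assumes "r 2 = 1" "r 3 = 0" "distinct [2, 3, k, z, x]" "y \<noteq> z" "y \<noteq> k"
    and "P (r(z := r x * r y, k := 0), m)"
  shows "runs (MUL k z x y) (r, m) (r x * 3 + 3) P"
proof -
  have "runs (FOR k x (RAdd z z y)) (r(z := 0), m) (r x * (1 + 2) + 2) P"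
  proof (rule runs_FOR[where J = "\<lambda>i s. s = (r(z := (r x - i) * r y, k := i), m)"])
    fix i r' m' assume i: "i < r x" and J: "(r', m') = (r(z := (r x - Suc i) * r y, k := Suc i), m)"
    have "r x - i = Suc (r x - Suc i)" using i by simp
    then have "(r x - i) * r y = (r x - Suc i) * r y + r y" by simp
    moreover from J have "r'(k := i) = r(z := (r x - Suc i) * r y, k := i)" "m' = m" "r' 2 = r 2"
      using assms by (auto simp: fun_eq_iff)
    ultimately have r': "r'(k := i) = (r(z := (r x - Suc i) * r y))(k := i)" "m' = m" "r' 2 = 1"
        "(r x - i) * r y = (r x - Suc i) * r y + r y"
      using assms by auto
    show "r' 2 = 1 \<and> runs (RAdd z z y) (r'(k := i), m') 1
        (\<lambda>s'. fst s' k = i \<and> s' = (r(z := (r x - i) * r y, k := i), m))"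
      unfolding r' using assms by (auto intro!: runs_Add simp: fun_upd_twist)
  qed (use assms in \<open>auto simp: fun_eq_iff\<close>)
  then have "runs (MUL k z x y) (r, m) (1 + (r x * (1 + 2) + 2)) P"
    unfolding MUL_def by (intro runs_Seq runs_Const)
  then show ?thesis by (rule runs_mono) auto
qed

lemma runs_MUL_le:
  assumes "P (r(z := r x * r y, k := 0), m)" "r 2 = 1" "r 3 = 0" "distinct [2, 3, k, z, x]"
    "y \<noteq> z" "y \<noteq> k" "r x * 3 + 3 \<le> T"
  shows "runs (MUL k z x y) (r, m) T P"
  using runs_mono[OF runs_MUL[of r k z x y P m] assms(7)] assms by simp


section \<open>Deciding mergeability of all pairs\<close>

text \<open>\<open>D\<close> accumulates the list elements treated so far; being a set, it is
  insensitive to repetitions.\<close>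

lemma runs_seqs_map:
  assumes step: "\<And>x D s. x \<in> set xs \<Longrightarrow> J D s \<Longrightarrow> runs (f x) s T (J (insert x D))" and "J D s"
  shows "runs (seqs (map f xs)) s (length xs * T + 1) (J (D \<union> set xs))"
  using assms
proof (induction xs arbitrary: D s)
  case Nil
  then show ?case by (auto intro: runs_Skip)
next
  case (Cons x xs)
  have "runs (seqs (map f (x # xs))) s (T + (length xs * T + 1)) (J (D \<union> set (x # xs)))"
    unfolding list.map
  proof (rule runs_seqs_Cons, rule runs_mono[OF Cons.prems(1)[of x D s] order_refl])
    fix s' assume "J (insert x D) s'"
    then have "runs (seqs (map f xs)) s' (length xs * T + 1) (J (insert x D \<union> set xs))"
      using Cons.prems(1) by (intro Cons.IH) simp_all
    then show "runs (seqs (map f xs)) s' (length xs * T + 1) (J (D \<union> set (x # xs)))"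
      by simp
  qed (use Cons.prems(2) in simp_all)
  then show ?case by (rule runs_mono) auto
qed

text \<open>The instance of the pair graph problem: \<open>E\<close> lists the labelled edges and \<open>S\<close>
  the start vertices of a graph on \<open>{..<K}\<close>, and \<open>\<delta>\<close> is the transition table with
  two columns. The cell at \<open>adr v q r\<close> is nonzero if the pair \<open>q\<close>, \<open>r\<close> is known
  to be mergeable along a path from \<open>v\<close>.\<close>

locale pair_graph =
  fixes K :: nat and E :: "(nat \<times> nat \<times> nat) list" and S :: "nat list"
    and L n :: nat and inp :: "nat \<Rightarrow> nat" and \<delta> :: "nat \<Rightarrow> nat \<Rightarrow> nat"
  assumes E: "\<And>v j v'. (v, j, v') \<in> set E \<Longrightarrow> v < K \<and> j < 2 \<and> v' < K"
    and S: "\<And>v. v \<in> set S \<Longrightarrow> v < K"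
    and L: "L = 1 + 2 * n"
    and \<delta>: "\<And>q j. q < n \<Longrightarrow> j < 2 \<Longrightarrow> inp (1 + 2 * q + j) = \<delta> q j \<and> \<delta> q j < n"
begin

text \<open>A three-dimensional table in row-major order, placed right behind the input so that
  marking never overwrites the transition table.\<close>

definition adr :: "nat \<Rightarrow> nat \<Rightarrow> nat \<Rightarrow> nat" where
  "adr v q r = L + ((v * n + q) * n + r)"

lemma adr_eq_iff:
  assumes "q < n" "r < n" "q' < n" "r' < n"
  shows "adr v q r = adr v' q' r' \<longleftrightarrow> v = v' \<and> q = q' \<and> r = r'"
proof -
  have *: "x * n + y = x' * n + y' \<longleftrightarrow> x = x' \<and> y = y'" if "y < n" "y' < n" for x y x' y'
  proof
    assume eq: "x * n + y = x' * n + y'"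
    have "(x * n + y) div n = x" "(x' * n + y') div n = x'" using that by auto
    with eq have "x = x'" by simp
    with eq show "x = x' \<and> y = y'" by simp
  qed simp
  show ?thesis
    using assms by (simp add: adr_def * del: mult_eq_if)
qed

definition marks :: "(nat \<Rightarrow> nat) \<Rightarrow> (nat \<times> nat \<times> nat) set" where
  "marks m = {(v, q, r). v < K \<and> q < n \<and> r < n \<and> m (adr v q r) \<noteq> 0}"

definition steps :: "((nat \<times> nat \<times> nat) \<times> nat \<times> nat \<times> nat) set" where
  "steps = {((v, q, r), (v', \<delta> q j, \<delta> r j)) | v q r j v'. (v, j, v') \<in> set E \<and> q < n \<and> r < n}"

text \<open>Backward reachability from the diagonal: a path to a diagonal entry spells a word that
  merges the pair.\<close>

definition good :: "(nat \<times> nat \<times> nat) set" where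
  "good = {x. \<exists>v s. (x, (v, s, s)) \<in> steps\<^sup>*}"

definition regs_ok :: "(nat \<Rightarrow> nat) \<Rightarrow> bool" where
  "regs_ok r \<longleftrightarrow> r 0 = L \<and> r 2 = 1 \<and> r 3 = 0 \<and> r 4 = n"

definition input :: "(nat \<Rightarrow> nat) \<Rightarrow> bool" where
  "input m \<longleftrightarrow> (\<forall>i<L. m i = inp i)"

text \<open>Registers from 20 on are reserved for the outer level: round counter, number of rounds,
  flag of the current test, and answer. The smaller ones not fixed by \<open>regs_ok\<close> are
  scratch.\<close>

definition frame :: "(nat \<Rightarrow> nat) \<Rightarrow> (nat \<Rightarrow> nat) \<Rightarrow> bool" where
  "frame r r' \<longleftrightarrow> regs_ok r' \<and> (\<forall>x\<ge>20. r' x = r x)"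

lemma frame_trans: "frame r r' \<Longrightarrow> frame r' r'' \<Longrightarrow> frame r r''"
  by (simp add: frame_def)

lemma frame_upd: "frame r r' \<Longrightarrow> x < 20 \<Longrightarrow> x \<notin> {0, 2, 3, 4} \<Longrightarrow> frame r (r'(x := k))"
  by (auto simp: frame_def regs_ok_def)

lemma input_store: "input m \<Longrightarrow> input (m(adr v q r := k))"
  by (simp add: input_def adr_def)

lemma marks_store:
  assumes "v < K" "q < n" "r < n"
  shows "marks (m(adr v q r := 1)) = insert (v, q, r) (marks m)"
  using assms by (auto simp: marks_def adr_eq_iff)

text \<open>Horner evaluation of the address into register 12; \<open>a\<close> and \<open>b\<close>
  are here the numbers of the registers that hold the pair.\<close>

definition IDX :: "nat \<Rightarrow> nat \<Rightarrow> nat \<Rightarrow> ram_com" where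
  "IDX v a b = seqs [RConst 10 v, MUL 7 11 10 4, RAdd 11 11 a, MUL 7 12 11 4, RAdd 12 12 b, RAdd 12 12 0]"

definition TI :: nat where "TI = 3 * K + 3 * (K * n + n) + 20"

lemma runs_IDX:
  assumes "regs_ok r" "v < K" "r a < n" "a \<notin> {7, 10, 11, 12}" "b \<notin> {7, 10, 11, 12}"
    and P: "P (r(10 := v, 11 := v * n + r a, 12 := adr v (r a) (r b), 7 := 0), m)"
  shows "runs (IDX v a b) (r, m) TI P"
proof -
  have r: "r 2 = 1" "r 3 = 0" "r 4 = n" "r 0 = L" using assms(1) by (auto simp: regs_ok_def)
  have "runs (IDX v a b) (r, m) (1 + ((v * 3 + 3) + (1 + (((v * n + r a) * 3 + 3) + (1 + (1 + 1)))))) P"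
    unfolding IDX_def
    apply (rule runs_seqs_Cons, rule runs_Const)
    apply (rule runs_seqs_Cons, rule runs_MUL_le)
          defer apply (simp_all add: r)[6]
    apply (rule runs_seqs_Cons, rule runs_Add)
    apply (rule runs_seqs_Cons, rule runs_MUL_le)
          defer apply (use assms(4) in \<open>simp_all add: r\<close>)[6]
    apply (rule runs_seqs_Cons, rule runs_Add)
    apply (rule runs_seqs_Cons, rule runs_Add)
    apply (rule runs_seqs_Nil)
    using P assms(4,5) apply (simp add: r adr_def algebra_simps fun_upd_twist)
    done
  then show ?thesis
  proof (rule runs_mono)
    define z Z where "z = v * n" and "Z = K * n"
    have "z \<le> Z" unfolding z_def Z_def using assms(2) by (intro mult_le_mono1) simp
    with assms(2,3) show "1 + ((v * 3 + 3) + (1 + (((v * n + r a) * 3 + 3) + (1 + (1 + 1))))) \<le> TI"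
      unfolding TI_def z_def[symmetric] Z_def[symmetric] by (simp add: One_nat_def)
  qed
qed

text \<open>Registers 5 and 6 hold the pair, 14 and 15 receive its successors. Doubling a state and
  adding \<open>1 + j\<close> addresses its table entry: rows have two columns and follow the
  leading number of states.\<close>

definition BODY :: "nat \<times> nat \<times> nat \<Rightarrow> ram_com" where
  "BODY e = (case e of (v, j, v') \<Rightarrow>
     seqs [RConst 13 (1 + j), RAdd 14 5 5, RAdd 14 14 13, RLoad 14 14,
       RAdd 15 6 6, RAdd 15 15 13, RLoad 15 15, IDX v' 14 15, RLoad 16 12,
       RIf 16 (seqs [IDX v 5 6, RStore 12 2]) RSkip])"

definition TB :: nat where "TB = 2 * TI + 20"

lemma runs_BODY:
  assumes e: "(v, j, v') \<in> set E" and regs_ok: "regs_ok r" and m: "input m"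
    and q: "r 5 < n" "r 6 < n"
    and P: "\<And>r'. \<lbrakk>frame r r'; r' 5 = r 5; r' 6 = r 6\<rbrakk> \<Longrightarrow>
      P (r', if (v', \<delta> (r 5) j, \<delta> (r 6) j) \<in> marks m then m(adr v (r 5) (r 6) := 1) else m)"
  shows "runs (BODY (v, j, v')) (r, m) TB P"
proof -
  have r: "r 2 = 1" "r 3 = 0" "r 4 = n" "r 0 = L" using regs_ok by (auto simp: regs_ok_def)
  have e': "v < K" "j < 2" "v' < K" using E[OF e] by auto
  have \<delta>': "m (q + q + (1 + j)) = \<delta> q j" "\<delta> q j < n" if "q < n" for q
  proof -
    have "1 + 2 * q + j < L" using that e'(2) L by simp
    moreover have eq: "q + q + (1 + j) = 1 + 2 * q + j" by simp
    ultimately show "m (q + q + (1 + j)) = \<delta> q j" "\<delta> q j < n"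
      using \<delta>[OF that e'(2)] m unfolding input_def eq by auto
  qed
  let ?q = "r 5" and ?r = "r 6"
  have branch: "runs (RIf 16 (seqs [IDX v 5 6, RStore 12 2]) RSkip) (r2, m) (TI + (1 + 1) + 1) P"
    if fr: "frame r r2" and r2: "r2 5 = r 5" "r2 6 = r 6" "r2 16 = m (adr v' (\<delta> ?q j) (\<delta> ?r j))" for r2
  proof -
    have mark: "(v', \<delta> ?q j, \<delta> ?r j) \<in> marks m \<longleftrightarrow> r2 16 \<noteq> 0"
      using e' \<delta>' q r2 by (simp add: marks_def)
    have r2c: "regs_ok r2" "r2 2 = 1" using fr by (simp_all add: frame_def regs_ok_def)
    show ?thesis
    proof (rule runs_If)
      assume nz: "r2 16 \<noteq> 0"
      show "runs (seqs [IDX v 5 6, RStore 12 2]) (r2, m) (TI + (1 + 1)) P"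
      proof (rule runs_seqs_Cons, rule runs_IDX)
        let ?r3 = "r2(10 := v, 11 := v * n + r2 5, 12 := adr v (r2 5) (r2 6), 7 := 0)"
        have "frame r ?r3" by (intro frame_upd fr) simp_all
        then have "P (?r3, m(adr v ?q ?r := 1))"
          using P[of ?r3] nz mark r2 by simp
        then show "runs (seqs [RStore 12 2]) (?r3, m) (1 + 1) P"
          by (intro runs_seqs_Cons runs_Store runs_seqs_Nil) (simp add: r2 r2c)
      qed (use r2c e' q r2 in simp_all)
    next
      assume z: "r2 16 = 0"
      have "P (r2, m)" using P[OF fr r2(1,2)] z mark by simp
      then show "runs RSkip (r2, m) (TI + (1 + 1)) P"
        by (intro runs_mono[OF runs_Skip]) simp_all
    qed
  qed
  have "runs (BODY (v, j, v')) (r, m) (1 + (1 + (1 + (1 + (1 + (1 + (1 + (TI + (1 + ((TI + (1 + 1) + 1) + 1)))))))))) P"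
    unfolding BODY_def prod.case
    apply (rule runs_seqs_Cons, rule runs_Const)
    apply (rule runs_seqs_Cons, rule runs_Add)
    apply (rule runs_seqs_Cons, rule runs_Add)
    apply (rule runs_seqs_Cons, rule runs_Load)
    apply (rule runs_seqs_Cons, rule runs_Add)
    apply (rule runs_seqs_Cons, rule runs_Add)
    apply (rule runs_seqs_Cons, rule runs_Load)
    apply (rule runs_seqs_Cons, rule runs_IDX)
         apply (use regs_ok in \<open>simp add: regs_ok_def\<close>)
        apply (rule e')
       apply (use \<delta>'[OF q(1)] in simp)
      apply simp
     apply simp
    apply (rule runs_seqs_Cons, rule runs_Load)
    apply (rule runs_seqs_Cons)
    apply (rule runs_mono[OF branch order_refl])
        apply (intro frame_upd; simp add: frame_def regs_ok)
       apply simp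
      apply simp
     apply (use \<delta>'(1)[OF q(1)] \<delta>'(1)[OF q(2)] in simp)
    apply (erule runs_seqs_Nil)
    done
  then show ?thesis by (rule runs_mono) (simp_all add: TB_def)
qed

text \<open>\<open>M\<close> is the set of marks before the round, and \<open>D\<close> contains the pairs of an
  edge and a pair of states that were already processed in it.\<close>

definition progress ::
    "(nat \<Rightarrow> nat) \<Rightarrow> (nat \<times> nat \<times> nat) set \<Rightarrow> ((nat \<times> nat \<times> nat) \<times> nat \<times> nat) set \<Rightarrow> ram_state \<Rightarrow> bool" where
  "progress r0 M D s \<longleftrightarrow> (case s of (r, m) \<Rightarrow> frame r0 r \<and> input m \<and> M \<subseteq> marks m \<and> marks m \<subseteq> good \<and>
     (\<forall>((v, j, v'), q, r)\<in>D. (v', \<delta> q j, \<delta> r j) \<in> M \<longrightarrow> (v, q, r) \<in> marks m))"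

lemma progress_mono: "progress r0 M D s \<Longrightarrow> D' \<subseteq> D \<Longrightarrow> progress r0 M D' s"
  unfolding progress_def by blast

lemma progress_upd: "progress r0 M D (r, m) \<Longrightarrow> x < 20 \<Longrightarrow> x \<notin> {0, 2, 3, 4} \<Longrightarrow> progress r0 M D (r(x := k), m)"
  unfolding progress_def using frame_upd by fastforce

lemma good_step: "(v, j, v') \<in> set E \<Longrightarrow> q < n \<Longrightarrow> r < n \<Longrightarrow> (v', \<delta> q j, \<delta> r j) \<in> good \<Longrightarrow> (v, q, r) \<in> good"
  unfolding good_def steps_def by (blast intro: converse_rtrancl_into_rtrancl)

definition EDGE :: "nat \<times> nat \<times> nat \<Rightarrow> ram_com" where
  "EDGE e = FOR 5 4 (FOR 6 4 (BODY e))"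

definition TE :: nat where "TE = n * (n * (TB + 2) + 2 + 2) + 2"

lemma runs_EDGE:
  assumes e: "e \<in> set E" and s: "progress r0 M D s"
  shows "runs (EDGE e) s TE (progress r0 M (D \<union> {e} \<times> ({..<n} \<times> {..<n})))"
proof -
  obtain v j v' where e_eq: "e = (v, j, v')" by (cases e)
  obtain r m where s_eq: "s = (r, m)" by fastforce
  have const: "r 2 = 1" "r 3 = 0" "r 4 = n" if "progress r0 M D (r, m)" for D r m
    using that by (auto simp: progress_def frame_def regs_ok_def)
  \<comment> \<open>The loops count down, so the processed indices form upper segments.\<close>
  let ?Do = "\<lambda>i. D \<union> {e} \<times> ({i..<n} \<times> {..<n})"
  let ?Di = "\<lambda>q i. ?Do (Suc q) \<union> {e} \<times> ({q} \<times> {i..<n})"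
  show ?thesis
    unfolding EDGE_def TE_def s_eq
  proof (rule runs_FOR[where J = "\<lambda>i. progress r0 M (?Do i)"])
    show "progress r0 M (?Do n) (r(5 := n), m)"
      using s by (intro progress_upd) (simp_all add: s_eq)
    show "r 3 = 0" "r 4 = n" using const s s_eq by auto
    fix q r m assume q: "q < n" "r 5 = Suc q" and J: "progress r0 M (?Do (Suc q)) (r, m)"
    note c = const[OF J]
    have "runs (FOR 6 4 (BODY e)) (r(5 := q), m) (n * (TB + 2) + 2)
        (\<lambda>s'. fst s' 5 = q \<and> progress r0 M (?Do q) s')"
    proof (rule runs_FOR[where J = "\<lambda>i s. fst s 5 = q \<and> progress r0 M (?Di q i) s"])
      show "(r(5 := q)) 3 = 0" "(r(5 := q)) 4 = n" using c by auto
      have "progress r0 M (?Do (Suc q)) (r(5 := q, 6 := n), m)"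
        using J by (intro progress_upd) simp_all
      then show "fst (r(5 := q, 6 := n), m) 5 = q \<and> progress r0 M (?Di q n) (r(5 := q, 6 := n), m)"
        by simp
      show "fst s' 5 = q \<and> progress r0 M (?Do q) s'" if "fst s' 5 = q \<and> progress r0 M (?Di q 0) s'" for s'
      proof -
        have "?Do q \<subseteq> ?Di q 0" by (auto simp: Suc_le_eq)
        then show ?thesis using that progress_mono by blast
      qed
      fix i r m assume i: "i < n" "r 6 = Suc i" and J: "fst (r, m) 5 = q \<and> progress r0 M (?Di q (Suc i)) (r, m)"
      then have J': "progress r0 M (?Di q (Suc i)) (r(6 := i), m)" by (intro progress_upd) simp_all
      show "r 2 = 1 \<and> runs (BODY e) (r(6 := i), m) TB
          (\<lambda>s'. fst s' 6 = i \<and> (fst s' 5 = q \<and> progress r0 M (?Di q i) s'))"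
      proof
        show "r 2 = 1" using J const by blast
        show "runs (BODY e) (r(6 := i), m) TB
            (\<lambda>s'. fst s' 6 = i \<and> (fst s' 5 = q \<and> progress r0 M (?Di q i) s'))"
          unfolding e_eq
        proof (rule runs_BODY, goal_cases)
          case (6 r')
          let ?m' = "if (v', \<delta> q j, \<delta> i j) \<in> marks m then m(adr v q i := 1) else m"
          have K: "v < K" using E e e_eq by auto
          have marks': "marks ?m' = (if (v', \<delta> q j, \<delta> i j) \<in> marks m then insert (v, q, i) (marks m) else marks m)"
            using marks_store[OF K q(1) i(1)] by simp
          note J'' = J'[unfolded progress_def prod.case]
          from J'' have old: "frame r0 (r(6 := i))" "input m" "M \<subseteq> marks m" "marks m \<subseteq> good"
            by blast+
          have closed: "(v1, q1, i1) \<in> marks m"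
            if "((v1, j1, v1'), q1, i1) \<in> ?Di q (Suc i)" "(v1', \<delta> q1 j1, \<delta> i1 j1) \<in> M" for v1 j1 v1' q1 i1
            using J''[THEN conjunct2, THEN conjunct2, THEN conjunct2, THEN conjunct2, THEN bspec, OF that(1)] that(2)
            by simp
          have "progress r0 M (?Di q i) (r', ?m')"
            unfolding progress_def prod.case
          proof (intro conjI)
            show "frame r0 r'" using old(1) 6(1) by (rule frame_trans)
            show "input ?m'" using old(2) input_store by auto
            show "M \<subseteq> marks ?m'" using old(3) unfolding marks' by auto
            show "marks ?m' \<subseteq> good"
              using old(4) good_step[OF e[unfolded e_eq] q(1) i(1)] unfolding marks' by auto
            show "\<forall>((v, j, v'), q, r)\<in>?Di q i. (v', \<delta> q j, \<delta> r j) \<in> M \<longrightarrow> (v, q, r) \<in> marks ?m'"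
            proof clarify
              fix v1 j1 v1' q1 i1
              assume in_D: "((v1, j1, v1'), q1, i1) \<in> ?Di q i" and M: "(v1', \<delta> q1 j1, \<delta> i1 j1) \<in> M"
              show "(v1, q1, i1) \<in> marks ?m'"
              proof (cases "((v1, j1, v1'), q1, i1) \<in> ?Di q (Suc i)")
                case True
                then show ?thesis using closed[OF True M] unfolding marks' by auto
              next
                case False
                then have "(v1, j1, v1') = (v, j, v') \<and> q1 = q \<and> i1 = i"
                  using in_D e_eq by auto
                then show ?thesis using M old(3) unfolding marks' by auto
              qed
            qed
          qed
          moreover have "r' 5 = q" "r' 6 = i" using 6 J by auto
          ultimately show ?case
            using J by (cases "(v', \<delta> q j, \<delta> i j) \<in> marks m") (simp_all add: e_eq)
        qed (use e e_eq J' J q i in \<open>auto simp: progress_def frame_def\<close>)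
      qed
    qed
    then show "r 2 = 1 \<and> runs (FOR 6 4 (BODY e)) (r(5 := q), m) (n * (TB + 2) + 2)
        (\<lambda>s'. fst s' 5 = q \<and> progress r0 M (?Do q) s')"
      using c by simp
  next
    fix s' assume "progress r0 M (?Do 0) s'"
    then show "progress r0 M (D \<union> {e} \<times> ({..<n} \<times> {..<n})) s'"
      by (rule progress_mono) auto
  qed
qed

definition ROUND :: ram_com where "ROUND = seqs (map EDGE E)"

text \<open>Marks are updated in place, so a round may already profit from its own marks.
  Completeness is therefore claimed relative to the marks before the round, while soundness is the
  invariant that marks stay inside \<open>good\<close>.\<close>

lemma runs_ROUND:
  assumes "regs_ok r" "input m" "marks m \<subseteq> good"
  shows "runs ROUND (r, m) (length E * TE + 1) (\<lambda>(r', m'). frame r r' \<and> input m' \<and>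
    marks m \<subseteq> marks m' \<and> marks m' \<subseteq> good \<and> (\<forall>(x, y)\<in>steps. y \<in> marks m \<longrightarrow> x \<in> marks m'))"
proof -
  have "runs ROUND (r, m) (length E * TE + 1)
      (\<lambda>s'. progress r (marks m) (({} \<union> set E) \<times> ({..<n} \<times> {..<n})) s')"
    unfolding ROUND_def
  proof (rule runs_seqs_map)
    show "progress r (marks m) ({} \<times> {..<n} \<times> {..<n}) (r, m)"
      using assms by (simp add: progress_def frame_def)
    fix e D s assume "e \<in> set E" "progress r (marks m) (D \<times> {..<n} \<times> {..<n}) s"
    then show "runs (EDGE e) s TE (progress r (marks m) (insert e D \<times> {..<n} \<times> {..<n}))"
      using runs_EDGE[of e r "marks m" "D \<times> {..<n} \<times> {..<n}" s]
      by (simp add: Sigma_Un_distrib1[symmetric] Un_commute flip: insert_is_Un)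
  qed
  then show ?thesis
    by (rule runs_mono) (fastforce simp: progress_def steps_def)+
qed

lemma frame_regs_ok: "frame r r' \<Longrightarrow> regs_ok r'"
  by (simp add: frame_def)

lemma regs_okD: "regs_ok r \<Longrightarrow> r 0 = L \<and> r 2 = 1 \<and> r 3 = 0 \<and> r 4 = n"
  by (simp add: regs_ok_def)

section \<open>Initial marks, the number of rounds, and the final test\<close>

definition diag :: "nat set \<Rightarrow> (nat \<times> nat \<times> nat) set" where
  "diag V = {(v, q, q) | v q. v \<in> V \<and> q < n}"

definition INIT :: "nat \<Rightarrow> ram_com" where
  "INIT v = FOR 5 4 (seqs [IDX v 5 5, RStore 12 2])"

lemma runs_INIT:
  assumes v: "v < K" and r: "regs_ok r" and m: "input m" "marks m = diag V"
  shows "runs (INIT v) (r, m) (n * (TI + (1 + 1) + 2) + 2)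
    (\<lambda>(r', m'). frame r r' \<and> input m' \<and> marks m' = diag (insert v V))"
proof -
  define part where "part i = {(v, q, q) | q. i \<le> q \<and> q < n}" for i
  have part: "part n = {}" "diag (insert v V) = diag V \<union> part 0"
    "\<And>i. i < n \<Longrightarrow> part i = insert (v, i, i) (part (Suc i))"
    by (auto simp: part_def diag_def Suc_le_eq le_less)
  show ?thesis
    unfolding INIT_def
  proof (rule runs_FOR[where J = "\<lambda>i (r', m'). frame r r' \<and> input m' \<and>
        marks m' = diag V \<union> part i"])
    show "r 3 = 0" "r 4 = n" using regs_okD[OF r] by auto
    have "frame r (r(5 := n))" by (intro frame_upd) (simp_all add: frame_def r)
    then show "case (r(5 := n), m) of (r', m') \<Rightarrow> frame r r' \<and> input m' \<and>
        marks m' = diag V \<union> part n"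
      using m \<open>frame r (r(5 := n))\<close> by (simp add: part)
    show "case s' of (r', m') \<Rightarrow> frame r r' \<and> input m' \<and> marks m' = diag (insert v V)"
      if "case s' of (r', m') \<Rightarrow> frame r r' \<and> input m' \<and> marks m' = diag V \<union> part 0" for s'
      using that by (simp add: part)
    fix i r1 m1 assume i: "i < n" and "case (r1, m1) of (r', m') \<Rightarrow> frame r r' \<and> input m' \<and>
        marks m' = diag V \<union> part (Suc i)"
    then have J: "frame r r1" "input m1" "marks m1 = diag V \<union> part (Suc i)"
      by auto
    let ?r2 = "r1(5 := i, 10 := v, 11 := v * n + i, 12 := adr v i i, 7 := 0)"
    have fr: "frame r (r1(5 := i))" "frame r ?r2" by (intro frame_upd J(1); simp)+
    have c: "regs_ok (r1(5 := i))" using frame_regs_ok[OF fr(1)] .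
    have "insert (v, i, i) (marks m1) = diag V \<union> part i"
      unfolding J(3) part(3)[OF i] by simp
    then have final: "frame r ?r2" "input (m1(adr v i i := 1))"
        "marks (m1(adr v i i := 1)) = diag V \<union> part i"
      using fr J v i by (simp_all add: marks_store input_store)
    have "runs (seqs [IDX v 5 5, RStore 12 2]) (r1(5 := i), m1) (TI + (1 + 1))
        (\<lambda>s'. fst s' 5 = i \<and> (case s' of (r', m') \<Rightarrow> frame r r' \<and> input m' \<and>
           marks m' = diag V \<union> part i))"
      apply (rule runs_seqs_Cons, rule runs_IDX[OF c v])
         apply (use i in simp_all)[3]
      apply (rule runs_seqs_Cons, rule runs_Store)
      apply (rule runs_seqs_Nil)
      using final regs_okD[OF frame_regs_ok[OF J(1)]] by simp
    then show "r1 2 = 1 \<and> runs (seqs [IDX v 5 5, RStore 12 2]) (r1(5 := i), m1) (TI + (1 + 1))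
        (\<lambda>s'. fst s' 5 = i \<and> (case s' of (r', m') \<Rightarrow> frame r r' \<and> input m' \<and>
           marks m' = diag V \<union> part i))"
      using regs_okD[OF frame_regs_ok[OF J(1)]] by simp
  qed
qed

definition near :: "nat \<Rightarrow> (nat \<times> nat \<times> nat) set" where
  "near t = {x. \<exists>k\<le>t. \<exists>y\<in>diag {..<K}. (x, y) \<in> steps ^^ k}"

text \<open>One round absorbs one more layer of the backward search: the first step of a path of
  length at most \<open>t + 1\<close> leads into \<open>near t\<close>.\<close>

lemma near_Suc:
  assumes "near t \<subseteq> M" "M \<subseteq> M'" "\<forall>(x, y)\<in>steps. y \<in> M \<longrightarrow> x \<in> M'"
  shows "near (Suc t) \<subseteq> M'"
proof
  fix x assume "x \<in> near (Suc t)"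
  then obtain k y where k: "k \<le> Suc t" "y \<in> diag {..<K}" "(x, y) \<in> steps ^^ k"
    by (auto simp: near_def)
  show "x \<in> M'"
  proof (cases k)
    case 0
    with k have "x \<in> near t" unfolding near_def by blast
    then show ?thesis using assms by blast
  next
    case (Suc k')
    with k(3) obtain z where z: "(x, z) \<in> steps" "(z, y) \<in> steps ^^ k'"
      using relpow_Suc_D2 by metis
    then have "z \<in> near t" using k Suc unfolding near_def by auto
    then show ?thesis using z assms by blast
  qed
qed

lemma card_steps: "finite steps \<and> card steps \<le> length E * n * n"
proof -
  have steps: "steps = (\<lambda>((v, j, v'), q, r). ((v, q, r), (v', \<delta> q j, \<delta> r j))) ` (set E \<times> {..<n} \<times> {..<n})"
    unfolding steps_def by force
  have "card steps \<le> card (set E \<times> {..<n} \<times> {..<n})"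
    unfolding steps by (intro card_image_le) simp
  also have "\<dots> \<le> length E * n * n"
    by (simp add: card_cartesian_product card_length)
  finally show ?thesis by (simp add: steps)
qed

lemma steps_closed:
  assumes "(x, y) \<in> steps\<^sup>*" "x \<in> {..<K} \<times> {..<n} \<times> {..<n}"
  shows "y \<in> {..<K} \<times> {..<n} \<times> {..<n}"
  using assms
proof (induction rule: rtrancl_induct)
  case (step y z)
  from step.hyps(2) obtain v q r j v' where
    yz: "y = (v, q, r)" "z = (v', \<delta> q j, \<delta> r j)" "(v, j, v') \<in> set E" "q < n" "r < n"
    by (auto simp: steps_def)
  then show ?case using E[OF yz(3)] \<delta>[of q j] \<delta>[of r j] by auto
qed

text \<open>Reachability in a finite relation needs no more steps than the relation has pairs; this
  is the origin of \<open>length E * n * n\<close> as the number of rounds.\<close>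

lemma good_near:
  assumes "x \<in> good" "x \<in> {..<K} \<times> {..<n} \<times> {..<n}"
  shows "x \<in> near (length E * n * n)"
proof -
  obtain v s where vs: "(x, (v, s, s)) \<in> steps\<^sup>*"
    using assms(1) by (auto simp: good_def)
  then have "(v, s, s) \<in> diag {..<K}"
    using steps_closed[OF vs assms(2)] by (auto simp: diag_def)
  moreover obtain k where "k \<le> card steps" "(x, (v, s, s)) \<in> steps ^^ k"
    using vs rtrancl_finite_eq_relpow[of steps] card_steps by auto
  moreover from this have "k \<le> length E * n * n" using card_steps by simp
  ultimately show ?thesis
    unfolding near_def by blast
qed

text \<open>Every unmarked pair clears register 22; adding it to register 23 accumulates the
  disjunction over the tested vertices.\<close>

definition TEST :: "nat \<Rightarrow> ram_com" where
  "TEST v = seqs [RConst 22 1,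
     FOR 5 4 (FOR 6 4 (seqs [IDX v 5 6, RLoad 16 12, RIf 16 RSkip (RConst 22 0)])), RAdd 23 23 22]"

definition TT :: nat where
  "TT = 1 + ((n * (n * (TI + (1 + (1 + 1 + 1)) + 2) + 2 + 2) + 2) + (1 + 1))"

lemma runs_TEST:
  assumes v: "v < K" and r: "regs_ok r"
    and P: "\<And>r'. regs_ok r' \<Longrightarrow> r' 23 \<noteq> 0 \<longleftrightarrow> r 23 \<noteq> 0 \<or> (\<forall>q<n. \<forall>r<n. (v, q, r) \<in> marks m) \<Longrightarrow> P (r', m)"
  shows "runs (TEST v) (r, m) TT P"
proof -
  define ok where "ok D \<longleftrightarrow> (\<forall>(q, r)\<in>D. (v, q, r) \<in> marks m)" for D
  define J where "J D s \<longleftrightarrow> snd s = m \<and> regs_ok (fst s) \<and> fst s 23 = r 23 \<and> (fst s 22 \<noteq> 0 \<longleftrightarrow> ok D)"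
    for D and s :: ram_state
  have J_upd: "J D (r'(x := k), m')" if "J D (r', m')" "x \<notin> {0, 2, 3, 4, 22, 23}" for D r' m' x k
    using that by (auto simp: J_def regs_ok_def)
  have J_const: "r' 2 = 1 \<and> r' 3 = 0 \<and> r' 4 = n" if "J D (r', m')" for D r' m'
    using that by (auto simp: J_def regs_ok_def)
  let ?Di = "\<lambda>q i. {Suc q..<n} \<times> {..<n} \<union> {q} \<times> {i..<n}"
  have body: "runs (seqs [IDX v 5 6, RLoad 16 12, RIf 16 RSkip (RConst 22 0)]) (r1(6 := i), m1)
      (TI + (1 + (1 + 1 + 1))) (\<lambda>s'. fst s' 6 = i \<and> (fst s' 5 = q \<and> J (?Di q i) s'))"
    if q: "q < n" and i: "i < n" and J1: "r1 5 = q" "J (?Di q (Suc i)) (r1, m1)" for q i r1 m1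
  proof -
    have m1: "m1 = m" and c: "regs_ok (r1(6 := i))" using J1(2) by (auto simp: J_def regs_ok_def)
    let ?r2 = "r1(6 := i, 10 := v, 11 := v * n + q, 12 := adr v q i, 7 := 0, 16 := m (adr v q i))"
    have J2: "J (?Di q (Suc i)) (?r2, m)"
      using J1 unfolding m1 by (intro J_upd) simp_all
    have mem: "(v, q, i) \<in> marks m \<longleftrightarrow> m (adr v q i) \<noteq> 0" using v q i by (simp add: marks_def)
    have "?Di q i = insert (q, i) (?Di q (Suc i))" using i by auto
    then have ok: "ok (?Di q i) \<longleftrightarrow> m (adr v q i) \<noteq> 0 \<and> ok (?Di q (Suc i))"
      unfolding ok_def mem[symmetric] by simp
    show ?thesis
      apply (rule runs_seqs_Cons, rule runs_IDX[OF c v])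
         apply (use q J1 in simp_all)[3]
      apply (rule runs_seqs_Cons, rule runs_Load)
      apply (rule runs_seqs_Cons, rule runs_If)
       apply (rule runs_Skip, rule runs_seqs_Nil)
       apply (use J2 J1 ok in \<open>simp add: J_def\<close>)
      apply (rule runs_Const, rule runs_seqs_Nil)
      apply (use J2 J1 ok in \<open>simp add: J_def regs_ok_def\<close>)
      done
  qed
  have loops: "runs (FOR 5 4 (FOR 6 4 (seqs [IDX v 5 6, RLoad 16 12, RIf 16 RSkip (RConst 22 0)])))
      (r(22 := 1), m) (n * (n * (TI + (1 + (1 + 1 + 1)) + 2) + 2 + 2) + 2) (J ({..<n} \<times> {..<n}))"
  proof (rule runs_FOR[where J = "\<lambda>i. J ({i..<n} \<times> {..<n})"])
    show "(r(22 := 1)) 3 = 0" "(r(22 := 1)) 4 = n" using regs_okD[OF r] by auto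
    show "J ({n..<n} \<times> {..<n}) (r(22 := 1, 5 := n), m)"
      using r by (simp add: J_def ok_def regs_ok_def)
    show "J ({..<n} \<times> {..<n}) s'" if "J ({0..<n} \<times> {..<n}) s'" for s'
      using that by (simp add: atLeast0LessThan)
    fix q r1 m1 assume q: "q < n" and J1: "J ({Suc q..<n} \<times> {..<n}) (r1, m1)"
    have "runs (FOR 6 4 (seqs [IDX v 5 6, RLoad 16 12, RIf 16 RSkip (RConst 22 0)])) (r1(5 := q), m1)
        (n * (TI + (1 + (1 + 1 + 1)) + 2) + 2) (\<lambda>s'. fst s' 5 = q \<and> J ({q..<n} \<times> {..<n}) s')"
    proof (rule runs_FOR[where J = "\<lambda>i s. fst s 5 = q \<and> J (?Di q i) s"])
      show "(r1(5 := q)) 3 = 0" "(r1(5 := q)) 4 = n" using J_const[OF J1] by auto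
      have "J ({Suc q..<n} \<times> {..<n}) (r1(5 := q, 6 := n), m1)"
        by (intro J_upd J1) simp_all
      then show "fst (r1(5 := q, 6 := n), m1) 5 = q \<and> J (?Di q n) (r1(5 := q, 6 := n), m1)" by simp
      show "fst s' 5 = q \<and> J ({q..<n} \<times> {..<n}) s'" if "fst s' 5 = q \<and> J (?Di q 0) s'" for s'
      proof -
        have "?Di q 0 = {q..<n} \<times> {..<n}" using q by auto
        with that show ?thesis by simp
      qed
      fix i r2 m2 assume i: "i < n" and J2: "fst (r2, m2) 5 = q \<and> J (?Di q (Suc i)) (r2, m2)"
      show "r2 2 = 1 \<and> runs (seqs [IDX v 5 6, RLoad 16 12, RIf 16 RSkip (RConst 22 0)]) (r2(6 := i), m2)
          (TI + (1 + (1 + 1 + 1))) (\<lambda>s'. fst s' 6 = i \<and> (fst s' 5 = q \<and> J (?Di q i) s'))"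
      proof -
        from J2 have J2': "r2 5 = q" "J (?Di q (Suc i)) (r2, m2)" by simp_all
        show ?thesis using body[OF q i J2'] J_const[OF J2'(2)] by simp
      qed
    qed
    then show "r1 2 = 1 \<and> runs (FOR 6 4 (seqs [IDX v 5 6, RLoad 16 12, RIf 16 RSkip (RConst 22 0)])) (r1(5 := q), m1)
        (n * (TI + (1 + (1 + 1 + 1)) + 2) + 2) (\<lambda>s'. fst s' 5 = q \<and> J ({q..<n} \<times> {..<n}) s')"
      using J_const[OF J1] by simp
  qed
  show ?thesis
    unfolding TEST_def TT_def
  proof (rule runs_seqs_Cons, rule runs_Const, rule runs_seqs_Cons, rule runs_mono[OF loops order_refl])
    fix s' assume J': "J ({..<n} \<times> {..<n}) s'"
    obtain r' where s': "s' = (r', m)" using J' by (cases s') (auto simp: J_def)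
    have "P (r'(23 := r' 23 + r' 22), m)"
      using J' by (intro P) (auto simp: s' J_def regs_ok_def ok_def)
    then show "runs (seqs [RAdd 23 23 22]) s' (1 + 1) P"
      unfolding s' by (intro runs_seqs_Cons runs_Add runs_seqs_Nil)
  qed
qed

definition PAIRS :: ram_com where
  "PAIRS = seqs [seqs (map INIT [0..<K]), RConst 10 (length E), MUL 7 11 10 4, MUL 7 21 11 4,
     FOR 20 21 ROUND, seqs (map TEST S), RAdd 0 23 3]"

definition TPAIRS :: nat where
  "TPAIRS = (K * (n * (TI + (1 + 1) + 2) + 2) + 1) + (1 + ((length E * 3 + 3) + ((length E * n * 3 + 3) +
     ((length E * n * n * ((length E * TE + 1) + 2) + 2) + ((length S * TT + 1) + (1 + 1))))))"

lemma runs_PAIRS: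
  assumes r: "regs_ok r" "r 23 = 0" and m: "input m" "marks m = {}"
  shows "runs PAIRS (r, m) TPAIRS (\<lambda>(r', m'). r' 0 \<noteq> 0 \<longleftrightarrow> (\<exists>v\<in>set S. \<forall>q<n. \<forall>r<n. (v, q, r) \<in> good))"
    (is "runs _ _ _ ?P")
proof -
  let ?R = "length E * n * n"
  have init: "runs (seqs (map INIT [0..<K])) (r, m) (K * (n * (TI + (1 + 1) + 2) + 2) + 1)
      (\<lambda>(r', m'). frame r r' \<and> input m' \<and> marks m' = diag {..<K})"
  proof -
    have "runs (seqs (map INIT [0..<K])) (r, m) (length [0..<K] * (n * (TI + (1 + 1) + 2) + 2) + 1)
      ((\<lambda>V (r', m'). frame r r' \<and> input m' \<and> marks m' = diag V) ({} \<union> set [0..<K]))"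
    proof (rule runs_seqs_map)
      show "case (r, m) of (r', m') \<Rightarrow> frame r r' \<and> input m' \<and> marks m' = diag {}"
        using r m by (simp add: frame_def diag_def)
      fix v V s assume v: "v \<in> set [0..<K]"
        and "case s of (r', m') \<Rightarrow> frame r r' \<and> input m' \<and> marks m' = diag V"
      then obtain r1 m1 where J: "s = (r1, m1)" "frame r r1" "input m1" "marks m1 = diag V" by auto
      have "runs (INIT v) (r1, m1) (n * (TI + (1 + 1) + 2) + 2)
          (\<lambda>(r', m'). frame r1 r' \<and> input m' \<and> marks m' = diag (insert v V))"
        using v J frame_regs_ok by (intro runs_INIT) auto
      then show "runs (INIT v) s (n * (TI + (1 + 1) + 2) + 2)
          (\<lambda>(r', m'). frame r r' \<and> input m' \<and> marks m' = diag (insert v V))"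
        unfolding J(1) by (rule runs_mono) (auto intro: frame_trans[OF J(2)])
    qed
    then show ?thesis by (simp add: atLeast0LessThan)
  qed
  have diag_good: "diag {..<K} \<subseteq> good" by (auto simp: diag_def good_def)
  \<comment> \<open>With \<open>i\<close> rounds to go, everything at distance at most
    \<open>?R - i\<close> from the diagonal is marked.\<close>
  have rounds: "runs (FOR 20 21 ROUND) (r1, m1) (?R * ((length E * TE + 1) + 2) + 2)
      (\<lambda>(r', m'). regs_ok r' \<and> r' 23 = 0 \<and> marks m' \<subseteq> good \<and> near ?R \<subseteq> marks m')"
    if r1: "regs_ok r1" "r1 21 = ?R" "r1 23 = 0" and m1: "input m1" "marks m1 = diag {..<K}" for r1 m1
  proof (rule runs_FOR[where J = "\<lambda>i (r', m'). regs_ok r' \<and> r' 23 = 0 \<and> input m' \<and> marks m' \<subseteq> good \<and>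
        near (?R - i) \<subseteq> marks m'"])
    show "r1 3 = 0" "r1 21 = ?R" using regs_okD[OF r1(1)] r1 by auto
    show "case (r1(20 := ?R), m1) of (r', m') \<Rightarrow> regs_ok r' \<and> r' 23 = 0 \<and> input m' \<and>
        marks m' \<subseteq> good \<and> near (?R - ?R) \<subseteq> marks m'"
      using r1 m1 diag_good by (auto simp: near_def regs_ok_def)
    fix i r2 m2 assume i: "i < ?R" and "case (r2, m2) of (r', m') \<Rightarrow> regs_ok r' \<and> r' 23 = 0 \<and> input m' \<and>
        marks m' \<subseteq> good \<and> near (?R - Suc i) \<subseteq> marks m'"
    then have J: "regs_ok r2" "r2 23 = 0" "input m2" "marks m2 \<subseteq> good" "near (?R - Suc i) \<subseteq> marks m2"
      by auto
    have c: "regs_ok (r2(20 := i))" using J(1) by (simp add: regs_ok_def)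
    have R: "?R - i = Suc (?R - Suc i)" using i by simp
    have "runs ROUND (r2(20 := i), m2) (length E * TE + 1) (\<lambda>s'. fst s' 20 = i \<and>
        (case s' of (r', m') \<Rightarrow> regs_ok r' \<and> r' 23 = 0 \<and> input m' \<and> marks m' \<subseteq> good \<and> near (?R - i) \<subseteq> marks m'))"
      by (rule runs_mono[OF runs_ROUND[OF c J(3,4)]])
        (use near_Suc[OF J(5)] J(2) in \<open>auto simp: frame_def R\<close>)
    then show "r2 2 = 1 \<and> runs ROUND (r2(20 := i), m2) (length E * TE + 1) (\<lambda>s'. fst s' 20 = i \<and>
        (case s' of (r', m') \<Rightarrow> regs_ok r' \<and> r' 23 = 0 \<and> input m' \<and> marks m' \<subseteq> good \<and> near (?R - i) \<subseteq> marks m'))"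
      using regs_okD[OF J(1)] by simp
  qed auto
  have test: "runs (seqs (map TEST S)) (r1, m1) (length S * TT + 1)
      (\<lambda>(r', m'). regs_ok r' \<and> (r' 23 \<noteq> 0 \<longleftrightarrow> (\<exists>v\<in>set S. \<forall>q<n. \<forall>r<n. (v, q, r) \<in> marks m1)))"
    if r1: "regs_ok r1" "r1 23 = 0" for r1 m1
  proof -
    have "runs (seqs (map TEST S)) (r1, m1) (length S * TT + 1)
      ((\<lambda>V (r', m'). m' = m1 \<and> regs_ok r' \<and> (r' 23 \<noteq> 0 \<longleftrightarrow> (\<exists>v\<in>V. \<forall>q<n. \<forall>r<n. (v, q, r) \<in> marks m1)))
        ({} \<union> set S))"
    proof (rule runs_seqs_map)
      fix v V s assume v: "v \<in> set S" and "case s of (r', m') \<Rightarrow> m' = m1 \<and> regs_ok r' \<and>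
          (r' 23 \<noteq> 0 \<longleftrightarrow> (\<exists>v\<in>V. \<forall>q<n. \<forall>r<n. (v, q, r) \<in> marks m1))"
      then obtain r2 where J: "s = (r2, m1)" "regs_ok r2"
        "r2 23 \<noteq> 0 \<longleftrightarrow> (\<exists>v\<in>V. \<forall>q<n. \<forall>r<n. (v, q, r) \<in> marks m1)" by auto
      show "runs (TEST v) s TT (\<lambda>(r', m'). m' = m1 \<and> regs_ok r' \<and>
          (r' 23 \<noteq> 0 \<longleftrightarrow> (\<exists>v\<in>insert v V. \<forall>q<n. \<forall>r<n. (v, q, r) \<in> marks m1)))"
        unfolding J(1) by (rule runs_TEST[OF S[OF v] J(2)]) (use J(3) in auto)
    qed (use r1 in auto)
    then show ?thesis by (rule runs_mono) auto
  qed
  show ?thesis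
    unfolding PAIRS_def TPAIRS_def
  proof (rule runs_seqs_Cons, rule runs_mono[OF init order_refl])
    fix s' :: ram_state assume "case s' of (r', m') \<Rightarrow> frame r r' \<and> input m' \<and> marks m' = diag {..<K}"
    then obtain r1 m1 where s': "s' = (r1, m1)" and J1: "frame r r1" "input m1" "marks m1 = diag {..<K}" by auto
    have c1: "regs_ok r1" "r1 23 = 0" using J1(1) r(2) by (auto simp: frame_def)
    note c1' = regs_okD[OF c1(1)]
    let ?r2 = "r1(10 := length E, 11 := length E * n, 7 := 0, 21 := ?R, 7 := 0)"
    have last: "runs (seqs [FOR 20 21 ROUND, seqs (map TEST S), RAdd 0 23 3]) (?r2, m1)
        ((?R * ((length E * TE + 1) + 2) + 2) + ((length S * TT + 1) + (1 + 1))) ?P"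
    proof (rule runs_seqs_Cons, rule runs_mono[OF rounds order_refl])
      show "regs_ok ?r2" "?r2 21 = ?R" "?r2 23 = 0" using c1 by (simp_all add: regs_ok_def)
      fix s2 :: ram_state assume "case s2 of (r', m') \<Rightarrow> regs_ok r' \<and> r' 23 = 0 \<and> marks m' \<subseteq> good \<and> near ?R \<subseteq> marks m'"
      then obtain r3 m3 where s2: "s2 = (r3, m3)" and J3: "regs_ok r3" "r3 23 = 0" "marks m3 \<subseteq> good" "near ?R \<subseteq> marks m3"
        by auto
      have marks: "(v, q, r) \<in> marks m3 \<longleftrightarrow> (v, q, r) \<in> good" if "v \<in> set S" "q < n" "r < n" for v q r
        using J3(3,4) good_near[of "(v, q, r)"] S[OF that(1)] that by auto
      show "runs (seqs [seqs (map TEST S), RAdd 0 23 3]) s2 ((length S * TT + 1) + (1 + 1)) ?P"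
        unfolding s2
      proof (rule runs_seqs_Cons, rule runs_mono[OF test[OF J3(1,2)] order_refl])
        fix s4 :: ram_state assume "case s4 of (r', m') \<Rightarrow> regs_ok r' \<and>
          (r' 23 \<noteq> 0 \<longleftrightarrow> (\<exists>v\<in>set S. \<forall>q<n. \<forall>r<n. (v, q, r) \<in> marks m3))"
        then obtain r5 m5 where s4: "s4 = (r5, m5)" and J5: "regs_ok r5"
          "r5 23 \<noteq> 0 \<longleftrightarrow> (\<exists>v\<in>set S. \<forall>q<n. \<forall>r<n. (v, q, r) \<in> marks m3)" by auto
        show "runs (seqs [RAdd 0 23 3]) s4 (1 + 1) ?P"
          unfolding s4 apply (rule runs_seqs_Cons, rule runs_Add, rule runs_seqs_Nil)
          using J5 regs_okD[OF J5(1)] marks by simp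
      qed
    qed (use J1 in simp_all)
    show "runs (seqs [RConst 10 (length E), MUL 7 11 10 4, MUL 7 21 11 4, FOR 20 21 ROUND, seqs (map TEST S), RAdd 0 23 3]) s'
      (1 + ((length E * 3 + 3) + ((length E * n * 3 + 3) +
       ((?R * ((length E * TE + 1) + 2) + 2) + ((length S * TT + 1) + (1 + 1)))))) ?P"
      unfolding s'
      apply (rule runs_seqs_Cons, rule runs_Const)
      apply (rule runs_seqs_Cons, rule runs_MUL_le)
            defer apply (use c1' in simp_all)[6]
      apply (rule runs_seqs_Cons, rule runs_MUL_le)
            defer apply (use c1' in simp_all)[6]
      apply (use last c1' in \<open>simp add: fun_upd_twist\<close>)
      done
  qed
qed

end


section \<open>Deciding the problem\<close>

text \<open>Equality is tested by truncated subtraction in both directions, as the differences add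
  up to zero only for equal numbers. A mismatch skips the rest, so only a full match sets register
  23.\<close>

fun MATCH_FROM :: "nat \<Rightarrow> nat list \<Rightarrow> ram_com" where
  "MATCH_FROM i [] = RConst 23 1"
| "MATCH_FROM i (y # ys) = seqs [RConst 8 i, RLoad 8 8, RConst 9 y, RSub 10 8 9, RSub 11 9 8,
     RAdd 10 10 11, RIf 10 RSkip (MATCH_FROM (Suc i) ys)]"

lemma runs_MATCH_FROM:
  assumes "\<And>r'. \<lbrakk>\<And>x. x \<notin> {8, 9, 10, 11, 23} \<Longrightarrow> r' x = r x;
      r' 23 = (if \<forall>k<length ys. m (i + k) = ys ! k then 1 else r 23)\<rbrakk> \<Longrightarrow> P (r', m)"
  shows "runs (MATCH_FROM i ys) (r, m) (9 * length ys + 1) P"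
  using assms
proof (induction ys arbitrary: i r)
  case Nil
  have "P (r(23 := 1), m)" by (rule Nil) auto
  then show ?case by (simp add: runs_Const)
next
  case (Cons y ys)
  have all: "(\<forall>k<length (y # ys). m (i + k) = (y # ys) ! k) \<longleftrightarrow>
      m i = y \<and> (\<forall>k<length ys. m (Suc i + k) = ys ! k)"
    by (auto simp: less_Suc_eq_0_disj)
  let ?r = "r(8 := m i, 9 := y, 10 := (m i - y) + (y - m i), 11 := y - m i)"
  have "runs (RIf 10 RSkip (MATCH_FROM (Suc i) ys)) (?r, m) (9 * length ys + 1 + 1) P"
  proof (rule runs_If)
    assume "?r 10 \<noteq> 0"
    then have "m i \<noteq> y" by auto
    then have "P (?r, m)" by (intro Cons.prems) (auto simp: all)
    then show "runs RSkip (?r, m) (9 * length ys + 1) P"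
      by (intro runs_mono[OF runs_Skip]) simp_all
  next
    assume "?r 10 = 0"
    then have "m i = y" by simp
    then have "(\<forall>k<length (y # ys). m (i + k) = (y # ys) ! k) \<longleftrightarrow> (\<forall>k<length ys. m (Suc i + k) = ys ! k)"
      by (simp only: all simp_thms)
    then show "runs (MATCH_FROM (Suc i) ys) (?r, m) (9 * length ys + 1) P"
      by (intro Cons.IH Cons.prems) (simp_all only:, auto)
  qed
  then have "runs (MATCH_FROM i (y # ys)) (r, m)
      (1 + (1 + (1 + (1 + (1 + (1 + ((9 * length ys + 1 + 1) + 1))))))) P"
    unfolding MATCH_FROM.simps
    apply (intro runs_seqs_Cons runs_Const runs_Load runs_Sub runs_Add)
    apply (rule runs_mono[where T = "9 * length ys + 1 + 1"])
      apply (simp add: fun_upd_twist)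
     apply simp
    apply (erule runs_seqs_Nil)
    done
  then show ?case by (rule runs_mono) (simp_all add: One_nat_def)
qed

definition MATCH :: "nat list \<Rightarrow> ram_com" where
  "MATCH ys = seqs [RConst 8 (length ys), RSub 10 0 8, RSub 11 8 0, RAdd 10 10 11,
     RIf 10 RSkip (MATCH_FROM 0 ys)]"

lemma runs_MATCH:
  assumes r: "r 0 = length xs" and m: "\<And>i. i < length xs \<Longrightarrow> m i = xs ! i"
    and P: "\<And>r'. \<lbrakk>\<And>x. x \<notin> {8, 9, 10, 11, 23} \<Longrightarrow> r' x = r x;
      r' 23 = (if xs = ys then 1 else r 23)\<rbrakk> \<Longrightarrow> P (r', m)"
  shows "runs (MATCH ys) (r, m) (9 * length ys + 7) P"
proof -
  let ?r = "r(8 := length ys, 10 := (length xs - length ys) + (length ys - length xs),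
    11 := length ys - length xs)"
  have eq: "xs = ys \<longleftrightarrow> length xs = length ys \<and> (\<forall>k<length ys. m (0 + k) = ys ! k)"
    using m by (auto simp: list_eq_iff_nth_eq)
  have "runs (RIf 10 RSkip (MATCH_FROM 0 ys)) (?r, m) (9 * length ys + 1 + 1) P"
  proof (rule runs_If)
    assume "?r 10 \<noteq> 0"
    then have "xs \<noteq> ys" by auto
    then have "P (?r, m)" by (intro P) auto
    then show "runs RSkip (?r, m) (9 * length ys + 1) P"
      by (intro runs_mono[OF runs_Skip]) simp_all
  next
    assume "?r 10 = 0"
    then have "length xs = length ys" by simp
    then show "runs (MATCH_FROM 0 ys) (?r, m) (9 * length ys + 1) P"
      by (intro runs_MATCH_FROM P) (auto simp: eq)
  qed
  then have "runs (MATCH ys) (r, m) (1 + (1 + (1 + (1 + ((9 * length ys + 1 + 1) + 1))))) P"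
    unfolding MATCH_def
    apply (intro runs_seqs_Cons runs_Const runs_Load runs_Sub runs_Add)
    apply (rule runs_mono[where T = "9 * length ys + 1 + 1"])
      apply (simp add: fun_upd_twist r)
     apply simp
    apply (erule runs_seqs_Nil)
    done
  then show ?thesis by (rule runs_mono) (simp_all add: One_nat_def)
qed

definition TABLE :: "nat list list \<Rightarrow> ram_com" where
  "TABLE Y = seqs [seqs (map MATCH Y), RAdd 0 23 3]"

text \<open>Independent of the input, hence a constant in the time bound.\<close>

definition TTABLE :: "nat list list \<Rightarrow> nat" where
  "TTABLE Y = length Y * (9 * sum_list (map length Y) + 7) + 1 + (1 + 1)"

lemma runs_TABLE:
  assumes r: "r 0 = length xs" "r 3 = 0" "r 23 = 0" and m: "\<And>i. i < length xs \<Longrightarrow> m i = xs ! i"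
  shows "runs (TABLE Y) (r, m) (TTABLE Y) (\<lambda>s. ram_accepting s \<longleftrightarrow> xs \<in> set Y)"
proof -
  have "runs (seqs (map MATCH Y)) (r, m) (length Y * (9 * sum_list (map length Y) + 7) + 1)
    ((\<lambda>D s. snd s = m \<and> fst s 0 = length xs \<and> fst s 3 = 0 \<and> (fst s 23 \<noteq> 0 \<longleftrightarrow> xs \<in> D)) ({} \<union> set Y))"
  proof (rule runs_seqs_map)
    fix ys D and s :: ram_state
    assume ys: "ys \<in> set Y" and s: "snd s = m \<and> fst s 0 = length xs \<and> fst s 3 = 0 \<and> (fst s 23 \<noteq> 0 \<longleftrightarrow> xs \<in> D)"
    have le: "length ys \<le> sum_list (map length Y)"
      using ys by (intro member_le_sum_list) auto
    obtain r' where s': "s = (r', m)" using s by (cases s) auto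
    show "runs (MATCH ys) s (9 * sum_list (map length Y) + 7)
        (\<lambda>s. snd s = m \<and> fst s 0 = length xs \<and> fst s 3 = 0 \<and> (fst s 23 \<noteq> 0 \<longleftrightarrow> xs \<in> insert ys D))"
      unfolding s'
    proof (rule runs_mono)
      show "runs (MATCH ys) (r', m) (9 * length ys + 7)
        (\<lambda>s. snd s = m \<and> fst s 0 = length xs \<and> fst s 3 = 0 \<and> (fst s 23 \<noteq> 0 \<longleftrightarrow> xs \<in> insert ys D))"
        by (rule runs_MATCH[where xs = xs]) (use s m in \<open>simp_all add: s'\<close>)
    qed (use le in simp_all)
  qed (use r in auto)
  then have "runs (TABLE Y) (r, m) (length Y * (9 * sum_list (map length Y) + 7) + 1 + (1 + 1))
      (\<lambda>s. ram_accepting s \<longleftrightarrow> xs \<in> set Y)"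
    unfolding TABLE_def
  proof (intro runs_seqs_Cons, elim runs_mono)
    fix s' :: ram_state
    assume s': "snd s' = m \<and> fst s' 0 = length xs \<and> fst s' 3 = 0 \<and> (fst s' 23 \<noteq> 0 \<longleftrightarrow> xs \<in> {} \<union> set Y)"
    obtain r' m' where "s' = (r', m')" by fastforce
    with s' show "runs (seqs [RAdd 0 23 3]) s' (1 + 1) (\<lambda>s. ram_accepting s \<longleftrightarrow> xs \<in> set Y)"
      by (simp only:) (intro runs_seqs_Cons runs_Add runs_seqs_Nil, simp add: ram_accepting_def)
  qed simp
  then show ?thesis by (simp add: TTABLE_def)
qed

text \<open>Register 3 is still 0, so register 4 receives the first input entry, the number of
  states; subtracting 9 leaves a nonzero value exactly from ten states on.\<close>

definition BRANCH :: "ram_com \<Rightarrow> nat list list \<Rightarrow> ram_com" where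
  "BRANCH c Y = seqs [RConst 2 1, RLoad 4 3, RConst 5 9, RSub 5 4 5, RIf 5 c (TABLE Y)]"

lemma runs_BRANCH:
  assumes xs: "xs \<noteq> []"
    and large: "10 \<le> xs ! 0 \<Longrightarrow> runs c ((\<lambda>_. 0)(0 := length xs, 2 := 1, 4 := xs ! 0, 5 := xs ! 0 - 9),
      snd (ram_init xs)) T (\<lambda>s. ram_accepting s \<longleftrightarrow> Q)"
    and small: "xs ! 0 < 10 \<Longrightarrow> xs \<in> set Y \<longleftrightarrow> Q"
  shows "runs (BRANCH c Y) (ram_init xs) (T + TTABLE Y + 6) (\<lambda>s. ram_accepting s \<longleftrightarrow> Q)"
proof -
  let ?m = "snd (ram_init xs)"
  let ?r = "(\<lambda>_. 0)(0 := length xs, 2 := 1, 4 := xs ! 0, 5 := xs ! 0 - 9)"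
  have m: "\<And>i. i < length xs \<Longrightarrow> ?m i = xs ! i" by (simp add: ram_init_def)
  have "runs (RIf 5 c (TABLE Y)) (?r, ?m) (T + TTABLE Y + 1) (\<lambda>s. ram_accepting s \<longleftrightarrow> Q)"
  proof (rule runs_If)
    assume "?r 5 \<noteq> 0"
    then have "10 \<le> xs ! 0" by simp
    then show "runs c (?r, ?m) (T + TTABLE Y) (\<lambda>s. ram_accepting s \<longleftrightarrow> Q)"
      by (rule runs_mono[OF large]) simp_all
  next
    assume "?r 5 = 0"
    then have "xs ! 0 < 10" by simp
    then show "runs (TABLE Y) (?r, ?m) (T + TTABLE Y) (\<lambda>s. ram_accepting s \<longleftrightarrow> Q)"
      by (intro runs_mono[OF runs_TABLE[where xs = xs]]) (use small m in simp_all)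
  qed
  then have rif: "runs (RIf 5 c (TABLE Y)) ((\<lambda>_. 0)(0 := length xs, 2 := 1, 4 := ?m 0, 5 := ?m 0 - 9), ?m)
      (T + TTABLE Y + 1) (\<lambda>s. ram_accepting s \<longleftrightarrow> Q)"
    using xs m[of 0] by simp
  have init: "ram_init xs = ((\<lambda>_. 0)(0 := length xs), ?m)"
    by (simp add: ram_init_def)
  have "runs (BRANCH c Y) (ram_init xs) (1 + (1 + (1 + (1 + ((T + TTABLE Y + 1) + 1)))))
      (\<lambda>s. ram_accepting s \<longleftrightarrow> Q)"
    unfolding BRANCH_def
    apply (subst init)
    apply (intro runs_seqs_Cons runs_Const runs_Load runs_Sub)
    apply (rule runs_mono[where T = "T + TTABLE Y + 1"])
      apply (use rif in simp)
     apply simp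
    apply (erule runs_seqs_Nil)
    done
  then show ?thesis by (rule runs_mono) (simp_all add: One_nat_def)
qed

section \<open>Polynomial time bound and properties of the encoding\<close>

lemma nat_poly_mono: "x \<le> y \<Longrightarrow> poly p x \<le> poly (p :: nat poly) y"
  by (induction p) (auto intro: add_mono mult_mono)

text \<open>\<open>TPAIRS\<close> as a polynomial in \<open>n\<close>, with \<open>I\<close>,
  \<open>B\<close>, \<open>D\<close>, \<open>T\<close> for \<open>TI\<close>, \<open>TB\<close>,
  \<open>TE\<close>, \<open>TT\<close>. The parameters \<open>K\<close>, \<open>e\<close>,
  \<open>s\<close> will depend on the constraint automaton only.\<close>

definition pair_time :: "nat \<Rightarrow> nat \<Rightarrow> nat \<Rightarrow> nat poly" where
  "pair_time K e s = (let
     X = [:0, 1:];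
     I = [:3 * K + 20:] + [:3 * K + 3:] * X;
     B = I + I + [:20:];
     D = X * (X * (B + [:2:]) + [:4:]) + [:2:];
     T = X * (X * (I + [:6:]) + [:4:]) + [:5:]
   in [:K:] * (X * (I + [:4:]) + [:2:]) + [:5:] + [:3 * e + 6:] + [:e * 3:] * X +
     [:e:] * X * X * ([:e:] * D + [:3:]) + [:2:] + [:s:] * T)"

lemma (in pair_graph) TPAIRS_le: "TPAIRS \<le> poly (pair_time K (length E) (length S)) n"
  by (simp add: TPAIRS_def TE_def TT_def TB_def TI_def pair_time_def Let_def algebra_simps One_nat_def)

lemma length_le_input_size: "length xs \<le> input_size xs"
  by (induction xs) (auto simp: input_size_def)

lemma encode_nth:
  assumes "length as = 2" "q < card (sa_states A)" "j < 2"
  shows "encode_semi_automaton as A ! (1 + 2 * q + j) = sa_trans A q (as ! j)"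
proof -
  obtain a0 a1 where as: "as = [a0, a1]"
    using assms(1) by (auto simp: numeral_2_eq_2 length_Suc_conv)
  have "concat (map (\<lambda>q. [f q a0, f q a1]) [0..<n]) ! (2 * q + j) = f q (as ! j)" if "q < n" for n and f :: "nat \<Rightarrow> 'a \<Rightarrow> nat"
    using that
  proof (induction n)
    case (Suc n)
    have len: "length (concat (map (\<lambda>q. [f q a0, f q a1]) [0..<n])) = 2 * n"
      by (induction n) auto
    show ?case
    proof (cases "q = n")
      case True
      then show ?thesis using assms(3) len as by (auto simp: nth_append less_2_cases_iff)
    next
      case False
      then have "2 * q + j < 2 * n" using Suc.prems assms(3) by auto
      then show ?thesis using Suc False len by (simp add: nth_append)
    qed
  qed simp
  from this[OF assms(2), of "sa_trans A"] show ?thesis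
    by (simp add: encode_semi_automaton_def as)
qed

lemma length_encode: "length (encode_semi_automaton as A) = 1 + card (sa_states A) * length as"
  by (simp add: encode_semi_automaton_def length_concat comp_def sum_list_triv)

lemma encode_eqD:
  assumes "encode_semi_automaton as A = encode_semi_automaton as A'"
  shows "card (sa_states A) = card (sa_states A')"
    and "q < card (sa_states A) \<Longrightarrow> a \<in> set as \<Longrightarrow> sa_trans A q a = sa_trans A' q a"
proof -
  show card: "card (sa_states A) = card (sa_states A')"
    using assms by (simp add: encode_semi_automaton_def)
  have "map (\<lambda>q. map (sa_trans A q) as) [0..<card (sa_states A)] = map (\<lambda>q. map (sa_trans A' q) as) [0..<card (sa_states A)]"
    using assms card
    by (intro concat_injective) (auto simp: encode_semi_automaton_def set_zip)
  then show "q < card (sa_states A) \<Longrightarrow> a \<in> set as \<Longrightarrow> sa_trans A q a = sa_trans A' q a"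
    by simp
qed

section \<open>Correctness of the table lookup and of the pair test\<close>

lemma has_constrained_sync_word_iff:
  assumes "is_semi_automaton A" "sa_alphabet A = pdfa_alphabet B"
  shows "has_constrained_sync_word B A \<longleftrightarrow>
    sa_states A \<noteq> {} \<and> (\<exists>w\<in>pdfa_lang B. collapses A (sa_states A) w)"
  using assms by (auto simp: has_constrained_sync_word_def synchronizing_iff_collapses pdfa_lang_def)

text \<open>Equal encodings fix the transitions on all states and letters, hence the runs. This
  makes a lookup by encoding sound.\<close>

lemma has_constrained_sync_word_cong:
  assumes "A \<in> simple_idempotent_instances (pdfa_alphabet B)" "A' \<in> simple_idempotent_instances (pdfa_alphabet B)"
    and "set as = pdfa_alphabet B" and eq: "encode_semi_automaton as A = encode_semi_automaton as A'"
  shows "has_constrained_sync_word B A \<longleftrightarrow> has_constrained_sync_word B A'"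
proof -
  have A: "is_semi_automaton A" "sa_alphabet A = pdfa_alphabet B" "is_semi_automaton A'" "sa_alphabet A' = pdfa_alphabet B"
    and "\<exists>n. sa_states A = {..<n}" "\<exists>n. sa_states A' = {..<n}"
    using assms(1,2) by (auto simp: simple_idempotent_instances_def)
  then have states: "sa_states A = {..<card (sa_states A)}" "sa_states A' = sa_states A"
    using encode_eqD(1)[OF eq] by auto
  have "sa_run A q w = sa_run A' q w" if "w \<in> lists (pdfa_alphabet B)" "q \<in> sa_states A" for w q
    using that
  proof (induction w arbitrary: q rule: list.induct)
    case (Cons c w)
    have "sa_trans A q c \<in> sa_states A"
      using sa_run_closed[OF A(1), of "[c]" q] Cons.prems A(2) by auto
    moreover have "sa_trans A q c = sa_trans A' q c"
      using Cons.prems states assms(3) by (intro encode_eqD(2)[OF eq]) auto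
    ultimately show ?case using Cons by auto
  qed simp
  then have "collapses A (sa_states A) w = collapses A' (sa_states A) w" if "w \<in> pdfa_lang B" for w
    using that by (simp add: collapses_def pdfa_lang_def)
  then show ?thesis
    using A states(2) by (auto simp: has_constrained_sync_word_iff)
qed

text \<open>The loop found by \<open>sync_word_yields_loop\<close> merges all pairs at once.
  Conversely, a merging word may end anywhere in the component of \<open>x\<close> and is extended
  to a loop; concatenated loops collapse everything, and paths from the start and to a final state
  complete the word.\<close>

lemma sync_iff_mergeable:
  assumes B: "is_pdfa B" "card (pdfa_states B) \<le> 3" "card (pdfa_alphabet B) \<le> 2"
    and A: "is_semi_automaton A" "has_simple_idempotents A" "sa_alphabet A = pdfa_alphabet B"
    and card: "10 \<le> card (sa_states A)"
  shows "has_constrained_sync_word B A \<longleftrightarrow>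
    (\<exists>x\<in>pdfa_states B. reach B (pdfa_start B) x \<and> (\<exists>f\<in>pdfa_final B. reach B x f) \<and>
      (\<forall>q\<in>sa_states A. \<forall>r\<in>sa_states A. \<exists>w\<in>lists (pdfa_alphabet B).
        pdfa_run (intra B) x w \<noteq> None \<and> sa_run A q w = sa_run A r w))"
    (is "_ \<longleftrightarrow> (\<exists>x\<in>_. ?start x \<and> ?final x \<and> ?pairs x)")
proof
  assume "has_constrained_sync_word B A"
  then obtain w f where w: "w \<in> lists (pdfa_alphabet B)" "collapses A (sa_states A) w"
      "pdfa_run B (pdfa_start B) w = Some f" "f \<in> pdfa_final B"
    using A by (auto simp: has_constrained_sync_word_iff pdfa_lang_def)
  have "pdfa_start B \<in> pdfa_states B" using B(1) by (simp add: is_pdfa_def)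
  then obtain x m where x: "x \<in> pdfa_states B" "reach B (pdfa_start B) x" "reach B x f"
      "m \<in> loops B x" "collapses A (sa_states A) m"
    using sync_word_yields_loop[OF B A card w(1,2,3)] by blast
  have m: "m \<in> lists (pdfa_alphabet B)" "pdfa_run (intra B) x m \<noteq> None"
    using x(4) loops_intra[of B x] by (auto simp: loops_def)
  have "?pairs x"
    using m collapsesD[OF x(5)] by blast
  with x w(4) show "\<exists>x\<in>pdfa_states B. ?start x \<and> ?final x \<and> ?pairs x" by blast
next
  assume "\<exists>x\<in>pdfa_states B. ?start x \<and> ?final x \<and> ?pairs x"
  then obtain x f where x: "reach B (pdfa_start B) x" "f \<in> pdfa_final B" "reach B x f" and pairs: "?pairs x"
    by blast
  have "\<exists>m\<in>loops B x. collapses A (sa_states A) m"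
  proof (rule collapses_if_pairs[OF A(1)])
    show "loops B x \<subseteq> lists (sa_alphabet A)" using A(3) by (auto simp: loops_def)
    fix q r assume "q \<in> sa_states A" "r \<in> sa_states A"
    then obtain w y where w: "w \<in> lists (pdfa_alphabet B)" "pdfa_run (intra B) x w = Some y"
        "sa_run A q w = sa_run A r w"
      using pairs by blast
    obtain v where v: "v \<in> lists (pdfa_alphabet B)" "pdfa_run B y v = Some x"
      using intra_run_reach(2)[OF w(1,2)] by (auto simp: reach_def)
    have "w @ v \<in> loops B x"
      using w v intra_run[OF w(2)] by (simp add: loops_def pdfa_run_append)
    moreover have "sa_run A q (w @ v) = sa_run A r (w @ v)" using w(3) by simp
    ultimately show "\<exists>w\<in>loops B x. sa_run A q w = sa_run A r w" by blast
  qed (auto intro: loops_Nil loops_append)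
  then obtain m where m: "m \<in> loops B x" "collapses A (sa_states A) m" by blast
  obtain u v where uv: "u \<in> lists (pdfa_alphabet B)" "pdfa_run B (pdfa_start B) u = Some x"
      "v \<in> lists (pdfa_alphabet B)" "pdfa_run B x v = Some f"
    using x by (auto simp: reach_def)
  have "u @ m @ v \<in> pdfa_lang B"
    using uv m(1) x(2) by (simp add: pdfa_lang_def loops_def pdfa_run_append)
  moreover have "collapses A (sa_states A) (u @ m @ v)"
    unfolding collapses_def
  proof (intro ballI)
    fix q r assume "q \<in> sa_states A" "r \<in> sa_states A"
    then have "sa_run A (sa_run A q u) m = sa_run A (sa_run A r u) m"
      using uv(1) A by (intro collapsesD[OF m(2)] sa_run_closed) auto
    then show "sa_run A q (u @ m @ v) = sa_run A r (u @ m @ v)" by simp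
  qed
  moreover have "sa_states A \<noteq> {}" using card by auto
  ultimately show "has_constrained_sync_word B A"
    using A by (auto simp: has_constrained_sync_word_iff)
qed

text \<open>\<open>sync_letters\<close> provides two letters, which are distinct because
  \<open>a\<close> merges \<open>d\<close> with \<open>x0\<close> while \<open>b\<close> is
  injective.\<close>

lemma no_sync_small_alphabet:
  assumes "is_semi_automaton A" "has_simple_idempotents A" "sa_alphabet A = pdfa_alphabet B"
    and "card (pdfa_alphabet B) < 2" "10 \<le> card (sa_states A)"
  shows "\<not> has_constrained_sync_word B A"
proof
  assume "has_constrained_sync_word B A"
  then obtain w where w: "w \<in> lists (sa_alphabet A)" "collapses A (sa_states A) w"
    using assms by (auto simp: has_constrained_sync_word_iff pdfa_lang_def)
  obtain a b x0 d where "sync_idem_perm A a b x0 d w"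
    by (rule sync_letters[of A w]) (use assms w in auto)
  then interpret sync_idem_perm A a b x0 d w .
  have "sa_trans A d a = sa_trans A x0 a" using a_fix[OF d d_neq] a_x0 by simp
  then have "a \<noteq> b" using inj_onD[OF b_inj, of d x0] d x0 d_neq by auto
  then show False using alphabet assms(3,4) by simp
qed

text \<open>Paths in the product graph correspond to words read by \<open>intra B\<close>;
  \<open>\<phi>\<close> numbers the states of \<open>B\<close>, and an edge label is an index into
  \<open>as\<close>.\<close>

lemma (in pair_graph) good_iff:
  assumes \<phi>: "inj_on \<phi> (pdfa_states B)" and B: "is_pdfa B"
    and E: "set E = {(\<phi> p, j, \<phi> p') | p j p'. p \<in> pdfa_states B \<and> p' \<in> pdfa_states B \<and> j < 2 \<and>
      pdfa_trans (intra B) p (as ! j) = Some p'}"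
    and as: "length as = 2" "set as = pdfa_alphabet B"
    and A: "\<And>q j. q < n \<Longrightarrow> j < 2 \<Longrightarrow> \<delta> q j = sa_trans A q (as ! j)"
    and p: "p \<in> pdfa_states B" "q < n" "r < n"
  shows "(\<phi> p, q, r) \<in> good \<longleftrightarrow>
    (\<exists>w\<in>lists (pdfa_alphabet B). pdfa_run (intra B) p w \<noteq> None \<and> sa_run A q w = sa_run A r w)"
proof
  assume "(\<phi> p, q, r) \<in> good"
  then obtain y where y: "((\<phi> p, q, r), y) \<in> steps\<^sup>*" "fst (snd y) = snd (snd y)"
    by (auto simp: good_def)
  define z where "z = (\<phi> p, q, r)"
  have "\<exists>w\<in>lists (pdfa_alphabet B). pdfa_run (intra B) p w \<noteq> None \<and> sa_run A q w = sa_run A r w"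
    if "(z, y) \<in> steps\<^sup>*" "z = (\<phi> p, q, r)" "p \<in> pdfa_states B" "q < n" "r < n" for z p q r
    using that
  proof (induction arbitrary: p q r rule: converse_rtrancl_induct)
    case base
    then show ?case using y(2) by (intro bexI[of _ "[]"]) auto
  next
    case (step x z)
    from step.hyps(1) step.prems obtain j v' where
      edge: "(\<phi> p, j, v') \<in> set E" "z = (v', \<delta> q j, \<delta> r j)"
      by (auto simp: steps_def)
    then obtain p1 p' where "\<phi> p = \<phi> p1" "v' = \<phi> p'" "p1 \<in> pdfa_states B" "p' \<in> pdfa_states B" "j < 2"
        "pdfa_trans (intra B) p1 (as ! j) = Some p'"
      unfolding E by auto
    moreover from this have "p1 = p" using inj_onD[OF \<phi>] step.prems(2) by metis
    ultimately have p': "v' = \<phi> p'" "p' \<in> pdfa_states B" "j < 2" "pdfa_trans (intra B) p (as ! j) = Some p'"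
      by auto
    obtain w where w: "w \<in> lists (pdfa_alphabet B)" "pdfa_run (intra B) p' w \<noteq> None"
        "sa_run A (\<delta> q j) w = sa_run A (\<delta> r j) w"
      using step.IH[of p' "\<delta> q j" "\<delta> r j"] edge(2) p' \<delta> step.prems by auto
    have "as ! j \<in> pdfa_alphabet B" using as p'(3) nth_mem by metis
    with w p' step.prems show ?case
      by (intro bexI[of _ "as ! j # w"]) (auto simp: A)
  qed
  then show "\<exists>w\<in>lists (pdfa_alphabet B). pdfa_run (intra B) p w \<noteq> None \<and> sa_run A q w = sa_run A r w"
    using y(1) p by blast
next
  assume "\<exists>w\<in>lists (pdfa_alphabet B). pdfa_run (intra B) p w \<noteq> None \<and> sa_run A q w = sa_run A r w"
  then obtain w where "w \<in> lists (pdfa_alphabet B)" "pdfa_run (intra B) p w \<noteq> None" "sa_run A q w = sa_run A r w"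
    by blast
  then show "(\<phi> p, q, r) \<in> good"
    using p
  proof (induction w arbitrary: p q r rule: list.induct)
    case Nil
    then show ?case by (auto simp: good_def)
  next
    case (Cons c w)
    then obtain p' where p': "pdfa_trans (intra B) p c = Some p'" "pdfa_run (intra B) p' w \<noteq> None"
      by (auto simp: bind_eq_None_conv)
    have "c \<in> set as" using Cons.prems(1) as by simp
    then obtain j where j: "j < 2" "c = as ! j" using as(1) by (metis in_set_conv_nth)
    have "p' \<in> pdfa_states B"
      using p'(1) B Cons.prems(1,4) by (auto simp: is_pdfa_def intra_trans)
    moreover have "(\<phi> p, j, \<phi> p') \<in> set E"
      unfolding E using p'(1) j Cons.prems(4) calculation by blast
    moreover have "(\<phi> p', \<delta> q j, \<delta> r j) \<in> good"
    proof (rule Cons.IH)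
      show "sa_run A (\<delta> q j) w = sa_run A (\<delta> r j) w" using Cons.prems j by (simp add: A)
    qed (use Cons.prems p' j \<delta> calculation in auto)
    ultimately show ?case using Cons.prems good_step by blast
  qed
qed

theorem theorem4p3:
  fixes B :: "('p, 'a) pdfa" and as :: "'a list"
  assumes "is_pdfa B"
    and "card (pdfa_states B) \<le> 3"
    and "card (pdfa_alphabet B) \<le> 2"
    and "distinct as" and "set as = pdfa_alphabet B"
  shows "decidable_in_polynomial_time
           (simple_idempotent_instances (pdfa_alphabet B))
           (encode_semi_automaton as)
           (has_constrained_sync_word B)"
proof -
  let ?I = "simple_idempotent_instances (pdfa_alphabet B)" and ?enc = "encode_semi_automaton as"
    and ?Q = "has_constrained_sync_word B"
  have inst: "is_semi_automaton A" "has_simple_idempotents A" "sa_alphabet A = pdfa_alphabet B"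
      "sa_states A = {..<card (sa_states A)}" if "A \<in> ?I" for A
    using that by (auto simp: simple_idempotent_instances_def)
  \<comment> \<open>The lookup table of yes-instances, finite because both the entries and the
    lengths of their encodings are bounded.\<close>
  define small where "small = ?enc ` {A \<in> ?I. card (sa_states A) < 10 \<and> ?Q A}"
  have "small \<subseteq> {xs. set xs \<subseteq> {..<10} \<and> length xs \<le> 1 + 10 * length as}"
  proof
    fix xs assume "xs \<in> small"
    then obtain A where A: "A \<in> ?I" "card (sa_states A) < 10" "xs = ?enc A"
      by (auto simp: small_def)
    have "sa_trans A q a < 10" if "q < card (sa_states A)" "a \<in> set as" for q a
    proof -
      have "q \<in> sa_states A" using that(1) equalityD2[OF inst(4)[OF A(1)]] by auto
      then have "sa_trans A q a \<in> sa_states A"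
        using inst(1,3)[OF A(1)] that(2) assms(5) by (auto simp: is_semi_automaton_def)
      then have "sa_trans A q a < card (sa_states A)"
        using equalityD1[OF inst(4)[OF A(1)]] by auto
      then show ?thesis using A(2) by simp
    qed
    then show "xs \<in> {xs. set xs \<subseteq> {..<10} \<and> length xs \<le> 1 + 10 * length as}"
      using A(2,3) by (auto simp: encode_semi_automaton_def length_concat comp_def sum_list_triv)
  qed
  then have "finite small"
    using finite_lists_length_le[of "{..<10 :: nat}"] finite_subset by blast
  then obtain Y where Y: "set Y = small" using finite_list by blast
  have small_iff: "?enc A \<in> set Y \<longleftrightarrow> ?Q A" if "A \<in> ?I" "card (sa_states A) < 10" for A
    using that has_constrained_sync_word_cong[OF _ _ assms(5)] unfolding Y small_def by blast
  have hd: "?enc A ! 0 = card (sa_states A)" "?enc A \<noteq> []" for A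
    by (simp_all add: encode_semi_automaton_def)
  \<comment> \<open>It remains to supply a program \<open>c\<close> for at least ten states, started
    from the registers that \<open>BRANCH\<close> has set up.\<close>
  have main: "decidable_in_polynomial_time ?I ?enc ?Q"
    if large: "\<And>A. A \<in> ?I \<Longrightarrow> 10 \<le> card (sa_states A) \<Longrightarrow>
      runs c ((\<lambda>_. 0)(0 := length (?enc A), 2 := 1, 4 := ?enc A ! 0, 5 := ?enc A ! 0 - 9), snd (ram_init (?enc A)))
        (poly p (length (?enc A))) (\<lambda>s. ram_accepting s \<longleftrightarrow> ?Q A)" for c p
    unfolding decidable_in_polynomial_time_def
  proof (intro exI[of _ "BRANCH c Y"] exI[of _ "p + [:TTABLE Y + 6:]"] ballI)
    fix A assume A: "A \<in> ?I"
    have "runs (BRANCH c Y) (ram_init (?enc A)) (poly p (length (?enc A)) + TTABLE Y + 6)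
        (\<lambda>s. ram_accepting s \<longleftrightarrow> ?Q A)"
      using large[OF A] small_iff[OF A] hd by (intro runs_BRANCH) auto
    then obtain t s where ts: "ram_exec (BRANCH c Y) (ram_init (?enc A)) t s"
        "t \<le> poly p (length (?enc A)) + TTABLE Y + 6" "ram_accepting s \<longleftrightarrow> ?Q A"
      by (auto simp: runs_def)
    moreover have "poly p (length (?enc A)) \<le> poly p (input_size (?enc A))"
      by (intro nat_poly_mono length_le_input_size)
    ultimately show "\<exists>t s. ram_exec (BRANCH c Y) (ram_init (?enc A)) t s \<and>
        t \<le> poly (p + [:TTABLE Y + 6:]) (input_size (?enc A)) \<and> (ram_accepting s \<longleftrightarrow> ?Q A)"
      by (intro exI[of _ t] exI[of _ s]) auto
  qed
  have len_as: "length as = card (pdfa_alphabet B)"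
    using distinct_card[OF assms(4)] assms(5) by simp
  show ?thesis
  proof (cases "length as = 2")
    \<comment> \<open>With fewer than two letters no large instance has a synchronizing word, so the
      program simply rejects.\<close>
    case False
    show ?thesis
    proof (rule main[of "RConst 0 0" 1])
      fix A assume A: "A \<in> ?I" "10 \<le> card (sa_states A)"
      have "\<not> ?Q A"
        using False len_as assms(3) inst[OF A(1)] A(2) by (intro no_sync_small_alphabet) auto
      then show "runs (RConst 0 0) ((\<lambda>_. 0)(0 := length (?enc A), 2 := 1, 4 := ?enc A ! 0, 5 := ?enc A ! 0 - 9),
          snd (ram_init (?enc A))) (poly 1 (length (?enc A))) (\<lambda>s. ram_accepting s \<longleftrightarrow> ?Q A)"
        by (intro runs_mono[OF runs_Const]) (simp_all add: ram_accepting_def)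
    qed
  next
    case True
    let ?P = "pdfa_states B" and ?K = "card (pdfa_states B)"
    have fin: "finite ?P" using assms(1) by (simp add: is_pdfa_def)
    obtain \<phi> where \<phi>: "bij_betw \<phi> ?P {0..<?K}" using ex_bij_betw_finite_nat[OF fin] by blast
    have inj: "inj_on \<phi> ?P" and \<phi>_less: "\<And>p. p \<in> ?P \<Longrightarrow> \<phi> p < ?K"
      using \<phi> by (auto simp: bij_betw_def)
    let ?edges = "{(\<phi> p, j, \<phi> p') | p j p'. p \<in> ?P \<and> p' \<in> ?P \<and> j < 2 \<and>
      pdfa_trans (intra B) p (as ! j) = Some p'}"
    have "?edges \<subseteq> {..<?K} \<times> {..<2} \<times> {..<?K}" using \<phi>_less by auto
    then have "finite ?edges" by (rule finite_subset) simp
    then obtain E where edges: "set E = ?edges" by (rule finite_list[THEN exE])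
    \<comment> \<open>A loop can be completed to a word of the language exactly at these
      states.\<close>
    let ?useful = "{x \<in> ?P. reach B (pdfa_start B) x \<and> (\<exists>f\<in>pdfa_final B. reach B x f)}"
    have "finite (\<phi> ` ?useful)" using fin by simp
    then obtain S where starts: "set S = \<phi> ` ?useful" by (rule finite_list[THEN exE])
    show ?thesis
    proof (rule main[of "pair_graph.PAIRS ?K E S" "pair_time ?K (length E) (length S)"])
      fix A assume A: "A \<in> ?I" "10 \<le> card (sa_states A)"
      note A' = inst[OF A(1)]
      define n where "n = card (sa_states A)"
      define inp where "inp i = ?enc A ! i" for i
      define \<delta> where "\<delta> q j = sa_trans A q (as ! j)" for q j
      have states: "sa_states A = {..<n}" using A'(4) unfolding n_def .
      have len: "length (?enc A) = 1 + 2 * n" using length_encode[of as A] True by (simp add: n_def)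
      interpret pair_graph ?K E S "length (?enc A)" n inp \<delta>
      proof
        fix v j v' assume "(v, j, v') \<in> set E"
        then show "v < ?K \<and> j < 2 \<and> v' < ?K" using edges \<phi>_less by auto
      next
        fix v assume "v \<in> set S"
        then show "v < ?K" using starts \<phi>_less by auto
      next
        fix q j :: nat assume qj: "q < n" "j < 2"
        then have "as ! j \<in> set as" using True by (intro nth_mem) simp
        then have "sa_trans A q (as ! j) \<in> sa_states A"
          using A'(1,3) states qj assms(5) by (auto simp: is_semi_automaton_def)
        then show "inp (1 + 2 * q + j) = \<delta> q j \<and> \<delta> q j < n"
          using encode_nth[OF True qj(1)[unfolded n_def] qj(2)] states by (simp add: inp_def \<delta>_def)
      qed (rule len)
      let ?r = "(\<lambda>_ :: nat. 0 :: nat)(0 := length (?enc A), 2 := 1, 4 := ?enc A ! 0, 5 := ?enc A ! 0 - 9)"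
      let ?m = "snd (ram_init (?enc A))"
      have "runs PAIRS (?r, ?m) TPAIRS (\<lambda>(r', m'). r' 0 \<noteq> 0 \<longleftrightarrow> (\<exists>v\<in>set S. \<forall>q<n. \<forall>r<n. (v, q, r) \<in> good))"
      proof (rule runs_PAIRS)
        show "regs_ok ?r" unfolding regs_ok_def by (simp add: hd n_def)
        show "?r 23 = 0" by simp
        show "input ?m" by (simp add: input_def inp_def ram_init_def)
        \<comment> \<open>All cells of the mark table lie behind the input and are initially
          0.\<close>
        show "marks ?m = {}" by (auto simp: marks_def ram_init_def adr_def)
      qed
      moreover have "(\<exists>v\<in>set S. \<forall>q<n. \<forall>r<n. (v, q, r) \<in> good) \<longleftrightarrow> ?Q A"
      proof -
        have good: "(\<phi> x, q, r) \<in> good \<longleftrightarrow> (\<exists>w\<in>lists (pdfa_alphabet B).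
            pdfa_run (intra B) x w \<noteq> None \<and> sa_run A q w = sa_run A r w)"
          if "x \<in> ?P" "q < n" "r < n" for x q r
          by (rule good_iff[OF inj assms(1) edges True assms(5) _ that]) (simp add: \<delta>_def)
        have "(\<exists>v\<in>set S. \<forall>q<n. \<forall>r<n. (v, q, r) \<in> good) \<longleftrightarrow>
            (\<exists>x\<in>?useful. \<forall>q<n. \<forall>r<n. (\<phi> x, q, r) \<in> good)"
          by (simp only: starts bex_simps)
        also have "\<dots> \<longleftrightarrow> (\<exists>x\<in>?useful. \<forall>q<n. \<forall>r<n. \<exists>w\<in>lists (pdfa_alphabet B).
            pdfa_run (intra B) x w \<noteq> None \<and> sa_run A q w = sa_run A r w)"
          by (rule bex_cong[OF refl]) (simp add: good)
        also have "\<dots> \<longleftrightarrow> ?Q A"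
          unfolding sync_iff_mergeable[OF assms(1-3) A'(1-3) A(2)] states by auto
        finally show ?thesis .
      qed
      moreover have "TPAIRS \<le> poly (pair_time ?K (length E) (length S)) (length (?enc A))"
        by (rule order_trans[OF TPAIRS_le nat_poly_mono]) (simp add: len)
      ultimately show "runs PAIRS (?r, ?m) (poly (pair_time ?K (length E) (length S)) (length (?enc A)))
          (\<lambda>s. ram_accepting s \<longleftrightarrow> ?Q A)"
        by (elim runs_mono) (auto simp: ram_accepting_def)
    qed
  qed
qed

end
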